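(* Let $k$ be a field of characteristic $0$ and let $X=\operatorname{Spec}k[S]$ be a seminormal affine toric surface with $S\subset M\cong\mathbb Z^2$ and such that the cone $\sigma=(\mathbb Q_{\ge0}S)^\vee$ is two-dimensional. Let $\tilde X$ be the normalisation of $X$, and assume that the covering indices satisfy $\ell_1,\ell_2\ge 3$. Then for every $u\in M$ $$\dim_k (T^1_X)_u=d_1(u)+d_2(u)+\dim_k (T^1_{\tilde X})_u ,$$ where for $i=1,2$ $$d_i(u)=\begin{cases}1 & u=-u_i^0(m),\ 1\le m<\ell_i\\ \ell_i-2 & u=-u_i^1(m),\ m\le 0\\ \ell_i-1 & u=-u_i^1(1)\\ \ell_i-m+1 & u=-u_i^1(m),\ 2\le m<\ell_i\\ 1 & u=-u_i^1(\ell_i),\ \tilde X\not\cong\mathbb A^2\\ 0&\text{otherwise.}\end{cases}$$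
   Context: $M$ is a lattice of rank 2 with dual lattice $N$ and pairing $\langle\cdot,\cdot\rangle$; $S\subset M$ is an affine (finitely generated) monoid spanning $M$ as an abelian group; $k[S]$ has $k$-basis $\chi^w$, $w\in S$. $\sigma=(\mathbb Q_{\ge0}S)^\vee\subset N_{\mathbb Q}$ has two rays $\rho_1,\rho_2$ with primitive lattice generators $v_1,v_2\in N$. The normalisation is $\tilde X=\operatorname{Spec}k[\sigma^\vee\cap M]$. For a face $\tau$ of $\sigma$ let $G_\tau$ be the subgroup of $M$ generated by $S\cap\tau^\perp$. The monoid $S$ (equivalently $X$) is seminormal if $S=\bigcup_{\tau\prec\sigma}G_\tau\cap\operatorname{relint}(\sigma^\vee\cap\tau^\perp)$, the union being over all faces of $\sigma$. The covering index $\ell_i$ is the index of $G_{\rho_i}$ in $M\cap\rho_i^\perp$, i.e. the degree of the restriction of the normalisation map to the $i$-th torus invariant curve. Numbering of lattice points: for $i\in\{1,2\}$ and $j\in\{0,1\}$ the lattice points on the line $\{u\in M_{\mathbb Q}\mid\langle u,v_i\rangle=j\}$ are numbered consecutively by $m\in\mathbb Z$ such that the points with positive number are exactly those which pair positively with the other ray generator of $\sigma$; $u_i^j(m)$ is the $m$-th point. $T^1$: writing $A=k[S]=R/I$ with $R=k[z_1,\dots,z_r]$, $z_i\mapsto\chi^{w_i}$ for a finite generating set $w_1,\dots,w_r$ of $S$, one has $T^1_X=\operatorname{Hom}_A(I/I^2,A)/D$ with $D$ the $A$-submodule generated by $\partial_i:f\mapsto\partial f/\partial z_i$. It is independent of the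 presentation and $M$-graded ($\deg\chi^w=w$, $\deg z_i=w_i$; a homomorphism of degree $u$ maps degree $d$ to degree $d+u$); $(T^1_X)_u$ is the component of degree $u$. The same definition applies to $\tilde X$. *)

theory Defs
  imports
    "HOL-Library.Poly_Mapping"
    "HOL-Library.Product_Plus"
    "HOL-Library.Function_Algebras"
    "HOL-Library.Set_Algebras"
    "HOL-Library.Extended_Nat"
    "HOL-Library.Numeral_Type"
    "HOL-Computational_Algebra.Group_Closure"
begin

section \<open>Lattices and cones in rank two\<close>

text \<open>
  Both the lattice \<open>M\<close> and its dual \<open>N\<close> are \<open>int \<times> int\<close>, with the standard pairing; the
  vector spaces \<open>M\<^sub>\<rat>\<close> and \<open>N\<^sub>\<rat>\<close> are \<open>rat \<times> rat\<close>.
\<close>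

type_synonym lattice = "int \<times> int"
type_synonym ratvec = "rat \<times> rat"

definition pairing :: "'a::comm_ring_1 \<times> 'a \<Rightarrow> 'a \<times> 'a \<Rightarrow> 'a"
  where "pairing x y = fst x * fst y + snd x * snd y"

definition rat_point :: "lattice \<Rightarrow> ratvec"
  where "rat_point m = (of_int (fst m), of_int (snd m))"

definition qscale :: "rat \<Rightarrow> ratvec \<Rightarrow> ratvec"
  where "qscale q x = (q * fst x, q * snd x)"

lemma vector_space_qscale: "vector_space qscale"
  by unfold_locales (auto simp: qscale_def algebra_simps)

definition lattice_points :: "ratvec set \<Rightarrow> lattice set"
  where "lattice_points C = {m. rat_point m \<in> C}"

definition cone_over :: "lattice set \<Rightarrow> ratvec set"
  where "cone_over S =
    {(\<Sum>s\<in>F. qscale (c s) (rat_point s)) | F c. finite F \<and> F \<subseteq> S \<and> (\<forall>s\<in>F. 0 \<le> c s)}"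

definition dual_cone :: "ratvec set \<Rightarrow> ratvec set"
  where "dual_cone C = {y. \<forall>x\<in>C. 0 \<le> pairing x y}"

definition perp :: "ratvec set \<Rightarrow> ratvec set"
  where "perp C = {y. \<forall>x\<in>C. pairing x y = 0}"

definition is_face :: "ratvec set \<Rightarrow> ratvec set \<Rightarrow> bool"
  where "is_face \<tau> \<sigma> \<longleftrightarrow> (\<exists>m\<in>dual_cone \<sigma>. \<tau> = {v \<in> \<sigma>. pairing m v = 0})"

text \<open>
  Relative interior of a cone \<open>C\<close>: since \<open>0 \<in> C\<close>, the affine hull of \<open>C\<close> is its linear span.
\<close>

definition relint :: "ratvec set \<Rightarrow> ratvec set"
  where "relint C = {x \<in> C. \<exists>e>0. \<forall>y \<in> module.span qscale C.
    \<bar>fst y - fst x\<bar> < e \<and> \<bar>snd y - snd x\<bar> < e \<longrightarrow> y \<in> C}"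

definition ray :: "lattice \<Rightarrow> ratvec set"
  where "ray v = {qscale q (rat_point v) | q. 0 \<le> q}"

definition primitive_ray_generator :: "ratvec set \<Rightarrow> lattice \<Rightarrow> bool"
  where "primitive_ray_generator \<sigma> v \<longleftrightarrow> coprime (fst v) (snd v) \<and> is_face (ray v) \<sigma>"


section \<open>Affine monoids\<close>

definition sigma_cone :: "lattice set \<Rightarrow> ratvec set"
  where "sigma_cone S = dual_cone (cone_over S)"

text \<open>The monoid \<open>\<sigma>\<^sup>\<or> \<inter> M\<close> of the normalisation.\<close>

definition normalisation :: "lattice set \<Rightarrow> lattice set"
  where "normalisation S = lattice_points (dual_cone (sigma_cone S))"

definition face_group :: "lattice set \<Rightarrow> ratvec set \<Rightarrow> lattice set"
  where "face_group S \<tau> = group_closure (S \<inter> lattice_points (perp \<tau>))"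

definition seminormal :: "lattice set \<Rightarrow> bool"
  where "seminormal S \<longleftrightarrow>
    S = (\<Union>\<tau>\<in>{\<tau>. is_face \<tau> (sigma_cone S)}.
          face_group S \<tau> \<inter> lattice_points (relint (dual_cone (sigma_cone S) \<inter> perp \<tau>)))"

text \<open>
  The index of \<open>face_group S (ray v)\<close> in \<open>M \<inter> v\<^sup>\<bottom>\<close>, as the number of cosets (0 if infinite).
\<close>

definition covering_index :: "lattice set \<Rightarrow> lattice \<Rightarrow> nat"
  where "covering_index S v =
    card ((\<lambda>m. m +o face_group S (ray v)) ` lattice_points (perp (ray v)))"

text \<open>
  \<open>p\<close> numbers the lattice points on the line \<open>\<langle>\<cdot>, v\<rangle> = j\<close> consecutively, the positive numbers
  being those of the points which pair positively with \<open>v'\<close>.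
\<close>

definition line_numbering :: "lattice \<Rightarrow> lattice \<Rightarrow> int \<Rightarrow> (int \<Rightarrow> lattice) \<Rightarrow> bool"
  where "line_numbering v v' j p \<longleftrightarrow>
    bij_betw p UNIV {x. pairing x v = j} \<and>
    (\<exists>e. \<forall>m. p (m + 1) = p m + e) \<and>
    (\<forall>m. 0 < m \<longleftrightarrow> 0 < pairing (p m) v')"


section \<open>Monoid algebras and presentations\<close>

text \<open>
  Laurent polynomials are finitely supported functions \<open>M \<Rightarrow> k\<close> with convolution, \<open>\<chi>\<^sup>w\<close> being
  \<open>Poly_Mapping.single w 1\<close>. Polynomials in variables indexed by a finite type \<open>'v\<close> are finitely
  supported functions on exponent vectors \<open>'v \<Rightarrow>\<^sub>0 nat\<close>.
\<close>

type_synonym 'k laurent = "lattice \<Rightarrow>\<^sub>0 'k"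
type_synonym ('v, 'k) mpoly = "('v \<Rightarrow>\<^sub>0 nat) \<Rightarrow>\<^sub>0 'k"

definition monoid_algebra :: "lattice set \<Rightarrow> 'k::comm_ring_1 laurent set"
  where "monoid_algebra S = {a. Poly_Mapping.keys a \<subseteq> S}"

text \<open>Degree of the monomial with exponent vector \<open>m\<close>, for \<open>deg z\<^sub>i = w i\<close>.\<close>

definition weight :: "('v::finite \<Rightarrow> lattice) \<Rightarrow> ('v \<Rightarrow>\<^sub>0 nat) \<Rightarrow> lattice"
  where "weight w m =
    (\<Sum>i\<in>UNIV. (int (Poly_Mapping.lookup m i) * fst (w i), int (Poly_Mapping.lookup m i) * snd (w i)))"

definition generates_monoid :: "('v::finite \<Rightarrow> lattice) \<Rightarrow> lattice set \<Rightarrow> bool"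
  where "generates_monoid w S \<longleftrightarrow> S = {weight w m | m. True}"

definition presentation :: "('v::finite \<Rightarrow> lattice) \<Rightarrow> ('v, 'k::comm_ring_1) mpoly \<Rightarrow> 'k laurent"
  where "presentation w f =
    (\<Sum>m\<in>Poly_Mapping.keys f. Poly_Mapping.single 0 (Poly_Mapping.lookup f m) *
       (\<Prod>i\<in>UNIV. Poly_Mapping.single (w i) 1 ^ Poly_Mapping.lookup m i))"

definition toric_ideal :: "('v::finite \<Rightarrow> lattice) \<Rightarrow> ('v, 'k::comm_ring_1) mpoly set"
  where "toric_ideal w = {f. presentation w f = 0}"

definition partial_deriv :: "'v \<Rightarrow> ('v, 'k::comm_ring_1) mpoly \<Rightarrow> ('v, 'k) mpoly"
  where "partial_deriv i f =
    (\<Sum>m\<in>Poly_Mapping.keys f. Poly_Mapping.single (m - Poly_Mapping.single i 1)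
       (of_nat (Poly_Mapping.lookup m i) * Poly_Mapping.lookup f m))"

text \<open>
  An isomorphism of \<open>k\<close>-algebras \<open>k[S] \<cong> k[x, y]\<close>, i.e. of \<open>Spec k[S]\<close> with the affine plane over
  \<open>k\<close>.
\<close>

definition affine_plane :: "'k::comm_ring_1 itself \<Rightarrow> lattice set \<Rightarrow> bool"
  where "affine_plane _ S \<longleftrightarrow> (\<exists>F :: 'k laurent \<Rightarrow> (2, 'k) mpoly.
    bij_betw F (monoid_algebra S) UNIV \<and>
    (\<forall>c. F (Poly_Mapping.single 0 c) = Poly_Mapping.single 0 c) \<and>
    (\<forall>a\<in>monoid_algebra S. \<forall>b\<in>monoid_algebra S. F (a + b) = F a + F b \<and> F (a * b) = F a * F b))"


section \<open>The module \<open>T\<^sup>1\<close>\<close>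

text \<open>\<open>I\<^sup>2\<close> is the ideal (the \<open>R\<close>-span) generated by the products of two elements of \<open>I\<close>.\<close>

definition toric_ideal_square :: "('v::finite \<Rightarrow> lattice) \<Rightarrow> ('v, 'k::comm_ring_1) mpoly set"
  where "toric_ideal_square w = module.span (*) {f * g | f g. f \<in> toric_ideal w \<and> g \<in> toric_ideal w}"

definition conormal_class ::
    "('v::finite \<Rightarrow> lattice) \<Rightarrow> ('v, 'k::comm_ring_1) mpoly \<Rightarrow> ('v, 'k) mpoly set"
  where "conormal_class w f = f +o toric_ideal_square w"

definition conormal_module :: "('v::finite \<Rightarrow> lattice) \<Rightarrow> ('v, 'k::comm_ring_1) mpoly set set"
  where "conormal_module w = conormal_class w ` toric_ideal w"

text \<open>
  The elements of \<open>Hom\<^sub>A (I/I\<^sup>2, A)\<close> for \<open>A = k[S]\<close>, extended by 0 outside \<open>I/I\<^sup>2\<close>. The element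
  \<open>presentation w r\<close> of \<open>A\<close> acts on \<open>I/I\<^sup>2\<close> through multiplication by \<open>r\<close>.
\<close>

definition normal_hom :: "lattice set \<Rightarrow> ('v::finite \<Rightarrow> lattice) \<Rightarrow>
    (('v, 'k::comm_ring_1) mpoly set \<Rightarrow> 'k laurent) \<Rightarrow> bool"
  where "normal_hom S w \<phi> \<longleftrightarrow>
    (\<forall>C\<in>conormal_module w. \<phi> C \<in> monoid_algebra S) \<and>
    (\<forall>C. C \<notin> conormal_module w \<longrightarrow> \<phi> C = 0) \<and>
    (\<forall>f\<in>toric_ideal w. \<forall>g\<in>toric_ideal w.
       \<phi> (conormal_class w (f + g)) = \<phi> (conormal_class w f) + \<phi> (conormal_class w g)) \<and>
    (\<forall>r. \<forall>f\<in>toric_ideal w.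
       \<phi> (conormal_class w (r * f)) = presentation w r * \<phi> (conormal_class w f))"

definition normal_hom_degree :: "lattice set \<Rightarrow> ('v::finite \<Rightarrow> lattice) \<Rightarrow> lattice \<Rightarrow>
    (('v, 'k::comm_ring_1) mpoly set \<Rightarrow> 'k laurent) set"
  where "normal_hom_degree S w u = {\<phi>. normal_hom S w \<phi> \<and>
    (\<forall>d. \<forall>f\<in>toric_ideal w. (\<forall>m\<in>Poly_Mapping.keys f. weight w m = d) \<longrightarrow>
       Poly_Mapping.keys (\<phi> (conormal_class w f)) \<subseteq> {d + u})}"

text \<open>
  The homomorphism induced by \<open>f \<mapsto> \<partial>f/\<partial>z\<^sub>i\<close>; the image in \<open>the_elem\<close> is a singleton because the
  presentation map kills \<open>\<partial>(I\<^sup>2)/\<partial>z\<^sub>i\<close>.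
\<close>

definition deriv_hom ::
    "('v::finite \<Rightarrow> lattice) \<Rightarrow> 'v \<Rightarrow> ('v, 'k::comm_ring_1) mpoly set \<Rightarrow> 'k laurent"
  where "deriv_hom w i C =
    (if C \<in> conormal_module w then the_elem ((\<lambda>f. presentation w (partial_deriv i f)) ` C) else 0)"

definition deriv_submodule :: "lattice set \<Rightarrow> ('v::finite \<Rightarrow> lattice) \<Rightarrow>
    (('v, 'k::comm_ring_1) mpoly set \<Rightarrow> 'k laurent) set"
  where "deriv_submodule S w =
    {\<lambda>C. \<Sum>i\<in>UNIV. a i * deriv_hom w i C | a. \<forall>i. a i \<in> monoid_algebra S}"

definition hom_scale :: "'k::comm_ring_1 \<Rightarrow> ('c \<Rightarrow> 'k laurent) \<Rightarrow> 'c \<Rightarrow> 'k laurent"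
  where "hom_scale c \<phi> = (\<lambda>C. Poly_Mapping.single 0 c * \<phi> C)"

text \<open>
  The classes modulo \<open>W\<close> of the elements of \<open>B\<close> form a finite basis of the image of \<open>V\<close> in the
  quotient by \<open>W\<close>, and the dimension of this image.
\<close>

definition basis_modulo ::
    "('k::field \<Rightarrow> 'a::ab_group_add \<Rightarrow> 'a) \<Rightarrow> 'a set \<Rightarrow> 'a set \<Rightarrow> 'a set \<Rightarrow> bool"
  where "basis_modulo scale V W B \<longleftrightarrow> finite B \<and> B \<subseteq> V \<and>
    (\<forall>x\<in>V. \<exists>c. x - (\<Sum>b\<in>B. scale (c b) b) \<in> W) \<and>
    (\<forall>c. (\<Sum>b\<in>B. scale (c b) b) \<in> W \<longrightarrow> (\<forall>b\<in>B. c b = 0))"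

definition dim_modulo :: "('k::field \<Rightarrow> 'a::ab_group_add \<Rightarrow> 'a) \<Rightarrow> 'a set \<Rightarrow> 'a set \<Rightarrow> enat"
  where "dim_modulo scale V W =
    (if \<exists>B. basis_modulo scale V W B then enat (card (SOME B. basis_modulo scale V W B)) else \<infinity>)"

text \<open>
  The dimension over \<open>k\<close> of the degree \<open>u\<close> component of \<open>T\<^sup>1\<close>, i.e. of the image in the quotient
  by \<open>D\<close> of the homomorphisms of degree \<open>u\<close>.
\<close>

definition T1_dim ::
    "'k::field itself \<Rightarrow> lattice set \<Rightarrow> ('v::finite \<Rightarrow> lattice) \<Rightarrow> lattice \<Rightarrow> enat"
  where "T1_dim _ S w u = dim_modulo hom_scale
    (normal_hom_degree S w u :: (('v, 'k) mpoly set \<Rightarrow> 'k laurent) set) (deriv_submodule S w)"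


section \<open>The local contributions\<close>

text \<open>
  Here \<open>p0\<close> and \<open>p1\<close> number the lattice points on the two lines belonging to a ray, \<open>l\<close> is its
  covering index and \<open>plane\<close> states that the normalisation is the affine plane.
\<close>

definition local_contribution ::
    "(int \<Rightarrow> lattice) \<Rightarrow> (int \<Rightarrow> lattice) \<Rightarrow> nat \<Rightarrow> bool \<Rightarrow> lattice \<Rightarrow> nat"
  where "local_contribution p0 p1 l plane u =
    (if - u \<in> range p0 then
       (let m = inv p0 (- u) in if 1 \<le> m \<and> m < int l then 1 else 0)
     else if - u \<in> range p1 then
       (let m = inv p1 (- u) in
         if m \<le> 0 then l - 2
         else if m = 1 then l - 1
         else if m < int l then nat (int l - m + 1)
         else if m = int l \<and> \<not> plane then 1
         else 0)
     else 0)"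

end

theory Submission
  imports Defs
begin

text \<open>
  The proof first removes the presentation from \<open>T\<^sup>1\<close> and then counts lattice points.

  On a binomial \<open>z\<^sup>m - z\<^sup>n\<close> of weight \<open>d\<close> a homomorphism \<open>I/I\<^sup>2 \<rightarrow> A\<close> of degree \<open>u\<close> takes a value
  \<open>c(m, n) \<chi>\<^bsup>d + u\<^esup>\<close>, and \<open>c\<close> depends only on \<open>m - n\<close>. It is thus a homomorphism from the group of
  relations among the generators to \<open>k\<close>, extends to all exponents, and makes the homomorphism a
  logarithmic derivation \<open>z\<^sub>i \<mapsto> a\<^sub>i \<chi>\<^bsup>w\<^sub>i + u\<^esup>\<close> with values in \<open>k[M]\<close> (\<open>normal_hom_eq_euler_hom\<close>). Its
  values on \<open>I\<close> lie in \<open>k[S]\<close> precisely if \<open>\<Sum> m\<^sub>i a\<^sub>i\<close> depends only on the weight of \<open>m\<close> whenever this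
  weight belongs to the gap \<open>K = {s \<in> S. s + u \<notin> S}\<close>. So it defines a function \<open>g\<close> on \<open>K\<close> that is
  additive on all sums lying in \<open>K\<close>. The derivations with coefficients in \<open>k[S]\<close> change \<open>g\<close> by the
  restriction of a linear form only, and \<open>(T\<^sup>1)\<^sub>u\<close> is the space of additive functions on \<open>K\<close> modulo
  linear forms (\<open>T1_dim_eq_card_basis\<close>).

  Let \<open>e\<^sub>i\<close> be the primitive generator of the ray \<open>\<sigma>\<^sup>\<or> \<inter> v\<^sub>i\<^sup>\<bottom>\<close>. Seminormality means that \<open>S\<close> consists of
  the interior lattice points of \<open>\<sigma>\<^sup>\<or>\<close> and of the nonnegative multiples of \<open>\<ell>\<^sub>1 e\<^sub>1\<close> and \<open>\<ell>\<^sub>2 e\<^sub>2\<close>. The normalisation has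
  the same shape with \<open>\<ell>\<^sub>1 = \<ell>\<^sub>2 = 1\<close>, so both monoids are treated together. With \<open>R = -u\<close>, the gap is
  a union of two strips (\<open>gap_eq\<close>): the strip \<open>K\<^sub>i\<close> consists of the \<open>s \<in> S\<close> with
  \<open>\<langle>s, v\<^sub>i\<rangle> \<le> \<langle>R, v\<^sub>i\<rangle>\<close> that do not lie on the progression \<open>R + \<int> \<ell>\<^sub>i e\<^sub>i\<close>. Both are closed under summands, so
  an additive function on the gap is a pair of additive functions on the strips which agree on
  \<open>K\<^sub>1 \<inter> K\<^sub>2\<close>. A single strip is understood completely:

  \<^item> If \<open>\<langle>R, v\<^sub>i\<rangle> \<ge> 2\<close>, every additive function is linear (\<open>strip1_vanish\<close>). The values at height one are
    periodic up to a slope, and sums of two points of height one fill all residue classes modulo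
    \<open>\<ell>\<^sub>i\<close> at height two, except one class if \<open>\<langle>R, v\<^sub>i\<rangle> = 2\<close>. For \<open>\<ell>\<^sub>i \<ge> 3\<close> this suffices to make
    the values affine; for \<open>\<ell>\<^sub>i = 2\<close> it need not.
  \<^item> If \<open>\<langle>R, v\<^sub>i\<rangle> = 1\<close>, the values at height one may be chosen freely on each residue class modulo
    \<open>\<ell>\<^sub>i\<close> other than that of \<open>R\<close>, in addition to the slope along the ray. This is the source of the
    contributions that grow with \<open>\<ell>\<^sub>i\<close>.
  \<^item> If \<open>\<langle>R, v\<^sub>i\<rangle> = 0\<close>, only multiples of \<open>\<ell>\<^sub>i e\<^sub>i\<close> occur, and if \<open>\<langle>R, v\<^sub>i\<rangle> < 0\<close>, the strip is empty.

  If one strip is wide, a linear form makes the function vanish there, and what is left are the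
  additive functions on the other strip which vanish on the intersection. Counting the points at which
  these can still be prescribed gives the table for \<open>d\<^sub>i\<close> (\<open>evaluation_basis_level0\<close>,
  \<open>evaluation_basis_level1\<close>). If both strips are wide, \<open>T\<^sup>1\<close> is the space of linear forms vanishing on
  \<open>K\<^sub>1 \<inter> K\<^sub>2\<close>, and this is the same for \<open>S\<close> and for the normalisation (\<open>evaluation_basis_wide\<close>). If
  neither is wide, the strips meet at most in \<open>0\<close>.

  In the table the affine plane is singled out by \<open>\<ell>\<^sub>i e\<^sub>i\<close> lying in the other strip for
  \<open>R = u\<^sub>i\<^sup>1(\<ell>\<^sub>i)\<close>, which happens just if \<open>e\<^sub>1\<close> and \<open>e\<^sub>2\<close> generate the lattice. Otherwise the
  normalisation has at least three irreducible elements, and their coefficients are independent point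
  derivations at the origin, more than a plane can have (\<open>affine_plane_irreducibles\<close>).
\<close>

section \<open>Dimension modulo a subspace\<close>

lemma nontrivial_solution:
  fixes A :: "'i \<Rightarrow> 'j \<Rightarrow> 'k::field"
  assumes "finite J" "finite I" "card J < card I"
  shows "\<exists>x. (\<exists>i\<in>I. x i \<noteq> 0) \<and> (\<forall>j\<in>J. (\<Sum>i\<in>I. x i * A i j) = 0)"
  using assms
proof (induction J arbitrary: I A rule: finite_induct)
  case empty
  then have "I \<noteq> {}" by auto
  then show ?case by (intro exI[of _ "\<lambda>_. 1"]) auto
next
  case (insert j J)
  show ?case
  proof (cases "\<forall>i\<in>I. A i j = 0")
    case True
    have "card J < card I" using insert by simp
    then obtain x where "\<exists>i\<in>I. x i \<noteq> 0" "\<forall>j\<in>J. (\<Sum>i\<in>I. x i * A i j) = 0"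
      using insert.IH[of I A] insert.prems by auto
    with True show ?thesis by (intro exI[of _ x]) auto
  next
    case False
    then obtain i0 where i0: "i0 \<in> I" "A i0 j \<noteq> 0" by auto
    define A' where "A' i j' = A i j' - A i j / A i0 j * A i0 j'" for i j'
    have "card J < card (I - {i0})" using insert i0 by simp
    then obtain x where x: "\<exists>i\<in>I - {i0}. x i \<noteq> 0"
        "\<forall>j\<in>J. (\<Sum>i\<in>I - {i0}. x i * A' i j) = 0"
      using insert.IH[of "I - {i0}" A'] insert.prems by auto
    define t where "t = - (\<Sum>i\<in>I - {i0}. x i * A i j) / A i0 j"
    define y where "y = x(i0 := t)"
    have split: "(\<Sum>i\<in>I. y i * A i j') = t * A i0 j' + (\<Sum>i\<in>I - {i0}. x i * A i j')" for j'
      using sum.remove[OF insert.prems(1) i0(1), of "\<lambda>i. y i * A i j'"]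
      by (auto simp: y_def intro!: sum.cong)
    have "(\<Sum>i\<in>I. y i * A i j') = 0" if "j' \<in> J" for j'
    proof -
      have "(\<Sum>i\<in>I - {i0}. x i * A' i j') =
          (\<Sum>i\<in>I - {i0}. x i * A i j') - (\<Sum>i\<in>I - {i0}. x i * A i j) / A i0 j * A i0 j'"
        unfolding A'_def
        by (simp add: right_diff_distrib sum_subtractf sum_distrib_left sum_distrib_right sum_divide_distrib mult_ac)
      with x(2) that split[of j'] show ?thesis by (simp add: t_def)
    qed
    moreover have "(\<Sum>i\<in>I. y i * A i j) = 0"
      using split[of j] i0 by (simp add: t_def)
    ultimately show ?thesis
      using x(1) by (intro exI[of _ y]) (auto simp: y_def)
  qed
qed

text \<open>
  The space \<open>V\<close> of homomorphisms of a fixed degree and the space \<open>W\<close> of derivations of all degrees do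
  not contain one another. The image of \<open>V\<close> in the quotient by \<open>W\<close> is therefore studied inside the
  ambient space, by computing modulo \<open>W\<close>.
\<close>

locale quotient_space = vector_space scale
  for scale :: "'k::field \<Rightarrow> 'a::ab_group_add \<Rightarrow> 'a" +
  fixes W :: "'a set"
  assumes zero_mem: "0 \<in> W"
    and add_mem: "x \<in> W \<Longrightarrow> y \<in> W \<Longrightarrow> x + y \<in> W"
    and scale_mem: "x \<in> W \<Longrightarrow> scale c x \<in> W"
begin

lemma sum_mem: "(\<And>i. i \<in> I \<Longrightarrow> f i \<in> W) \<Longrightarrow> sum f I \<in> W"
  by (induction I rule: infinite_finite_induct) (auto intro: zero_mem add_mem)

text \<open>
  Writing the elements of \<open>B\<close> modulo \<open>W\<close> in terms of \<open>B'\<close> gives a matrix; if it had more rows than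
  columns, an element of its left kernel would be a nontrivial relation in \<open>B\<close>. By symmetry any two
  bases have the same number of elements, so the choice made in \<open>dim_modulo\<close> does not matter.
\<close>

lemma basis_card_le:
  assumes "basis_modulo scale V W B" "basis_modulo scale V W B'"
  shows "card B \<le> card B'"
proof (rule ccontr)
  assume "\<not> card B \<le> card B'"
  have B: "finite B" "B \<subseteq> V" "\<And>c. (\<Sum>b\<in>B. scale (c b) b) \<in> W \<Longrightarrow> \<forall>b\<in>B. c b = 0"
    and B': "finite B'" "\<And>x. x \<in> V \<Longrightarrow> \<exists>c. x - (\<Sum>b\<in>B'. scale (c b) b) \<in> W"
    using assms by (auto simp: basis_modulo_def)
  obtain C where C: "\<And>b. b \<in> B \<Longrightarrow> b - (\<Sum>b'\<in>B'. scale (C b b') b') \<in> W"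
    using B'(2) B(2) by (metis subsetD)
  obtain x where x: "\<exists>b\<in>B. x b \<noteq> 0" "\<forall>b'\<in>B'. (\<Sum>b\<in>B. x b * C b b') = 0"
    using nontrivial_solution[of B' B C] B(1) B'(1) \<open>\<not> card B \<le> card B'\<close> by auto
  have "(\<Sum>b\<in>B. scale (x b) (b - (\<Sum>b'\<in>B'. scale (C b b') b'))) \<in> W"
    using C by (intro sum_mem scale_mem)
  also have "(\<Sum>b\<in>B. scale (x b) (b - (\<Sum>b'\<in>B'. scale (C b b') b'))) =
      (\<Sum>b\<in>B. scale (x b) b) - (\<Sum>b\<in>B. \<Sum>b'\<in>B'. scale (x b * C b b') b')"
    by (simp add: scale_right_diff_distrib sum_subtractf scale_sum_right)
  also have "(\<Sum>b\<in>B. \<Sum>b'\<in>B'. scale (x b * C b b') b') =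
      (\<Sum>b'\<in>B'. scale (\<Sum>b\<in>B. x b * C b b') b')"
    by (subst sum.swap) (simp add: scale_sum_left)
  also have "\<dots> = 0" using x(2) by simp
  finally have "(\<Sum>b\<in>B. scale (x b) b) \<in> W" by simp
  with B(3) x(1) show False by blast
qed

lemma dim_modulo_eq_card:
  assumes P: "finite P" "\<And>p. p \<in> P \<Longrightarrow> b p \<in> V"
    and spanning: "\<And>x. x \<in> V \<Longrightarrow> \<exists>c. x - (\<Sum>p\<in>P. scale (c p) (b p)) \<in> W"
    and indep: "\<And>c. (\<Sum>p\<in>P. scale (c p) (b p)) \<in> W \<Longrightarrow> \<forall>p\<in>P. c p = 0"
  shows "dim_modulo scale V W = enat (card P)"
proof -
  have inj: "inj_on b P"
  proof (rule inj_onI, rule ccontr)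
    fix p q assume pq: "p \<in> P" "q \<in> P" "b p = b q" "p \<noteq> q"
    define c where "c r = (if r = p then 1 else if r = q then -1 else (0::'k))" for r
    have "(\<Sum>r\<in>P. scale (c r) (b r)) = (\<Sum>r\<in>{p, q}. scale (c r) (b r))"
      using P pq by (intro sum.mono_neutral_right) (auto simp: c_def)
    also have "\<dots> = 0" using pq by (simp add: c_def)
    finally have "c p = 0" using indep[of c] zero_mem pq by auto
    then show False by (simp add: c_def)
  qed
  have reindex: "(\<Sum>x\<in>b ` P. scale (c x) x) = (\<Sum>p\<in>P. scale (c (b p)) (b p))" for c
    using inj by (simp add: sum.reindex)
  have "basis_modulo scale V W (b ` P)"
    unfolding basis_modulo_def
  proof (intro conjI ballI allI impI)
    fix x assume "x \<in> V"
    then obtain c where c: "x - (\<Sum>p\<in>P. scale (c p) (b p)) \<in> W" using spanning by blast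
    have "(\<Sum>y\<in>b ` P. scale ((c \<circ> inv_into P b) y) y) = (\<Sum>p\<in>P. scale (c p) (b p))"
      unfolding reindex using inj by (intro sum.cong) auto
    with c show "\<exists>c. x - (\<Sum>y\<in>b ` P. scale (c y) y) \<in> W" by metis
  next
    fix c x assume "(\<Sum>y\<in>b ` P. scale (c y) y) \<in> W" "x \<in> b ` P"
    then show "c x = 0" using indep[of "c \<circ> b"] by (auto simp: reindex)
  qed (use P in auto)
  then have *: "basis_modulo scale V W (SOME B. basis_modulo scale V W B)" by (rule someI)
  have "card (SOME B. basis_modulo scale V W B) = card (b ` P)"
    using basis_card_le * \<open>basis_modulo scale V W (b ` P)\<close> by (intro antisym)
  with \<open>basis_modulo scale V W (b ` P)\<close> show ?thesis
    unfolding dim_modulo_def using card_image[OF inj] by auto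
qed

end

section \<open>Laurent polynomials and presentations\<close>

definition zscale :: "int \<Rightarrow> lattice \<Rightarrow> lattice" (infixr \<open>\<cdot>\<close> 75)
  where "n \<cdot> x = (n * fst x, n * snd x)"

lemma fst_zscale [simp]: "fst (n \<cdot> x) = n * fst x"
  and snd_zscale [simp]: "snd (n \<cdot> x) = n * snd x"
  by (simp_all add: zscale_def)

lemma zscale_simps [simp]: "0 \<cdot> x = 0" "1 \<cdot> x = x" "n \<cdot> 0 = 0"
  by (auto simp: prod_eq_iff)

lemma zscale_add_left: "(m + n) \<cdot> x = m \<cdot> x + n \<cdot> x"
  by (simp add: prod_eq_iff algebra_simps)

lemma single_sum_monomials: "f = (\<Sum>m\<in>Poly_Mapping.keys f. Poly_Mapping.single m (Poly_Mapping.lookup f m))"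
  by (rule poly_mapping_eqI)
    (auto simp: lookup_sum lookup_single "when_def" sum.delta[OF finite_keys] in_keys_iff)

lemma monomial_induct:
  assumes "\<And>m c. P (Poly_Mapping.single m c)" "\<And>f g. P f \<Longrightarrow> P g \<Longrightarrow> P (f + g)"
  shows "P (f :: 'a \<Rightarrow>\<^sub>0 'b::comm_monoid_add)"
proof -
  have "P (\<Sum>m\<in>X. Poly_Mapping.single m (Poly_Mapping.lookup f m))" if "finite X" for X
    using that
  proof induction
    case empty
    show ?case using assms(1)[of undefined 0] by simp
  qed (auto intro: assms)
  from this[OF finite_keys[of f]] single_sum_monomials[of f] show ?thesis by simp
qed

lemma single_sum: "Poly_Mapping.single x (sum h A) = (\<Sum>i\<in>A. Poly_Mapping.single x (h i))"
  by (induction A rule: infinite_finite_induct) (simp_all add: single_add)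

lemma weight_eq_sum: "weight w m = (\<Sum>i\<in>UNIV. int (Poly_Mapping.lookup m i) \<cdot> w i)"
  by (simp add: weight_def zscale_def)

lemma weight_add: "weight w (m + n) = weight w m + weight w n"
  by (simp add: weight_eq_sum lookup_add zscale_add_left sum.distrib)

lemma weight_zero [simp]: "weight w 0 = 0"
  by (simp add: weight_eq_sum)

lemma weight_single: "weight w (Poly_Mapping.single i n) = int n \<cdot> w i"
  unfolding weight_eq_sum by (subst sum.remove[of _ i]) (auto simp: lookup_single_not_eq intro!: sum.neutral)

lemma single_power: "Poly_Mapping.single (a :: lattice) (1::'k::comm_ring_1) ^ n = Poly_Mapping.single (int n \<cdot> a) 1"
  by (induction n) (simp_all add: mult_single zscale_add_left flip: single_one)

lemma prod_single:
  "finite I \<Longrightarrow> (\<Prod>i\<in>I. Poly_Mapping.single (f i) (1::'k::comm_ring_1)) = Poly_Mapping.single (\<Sum>i\<in>I. f i) 1"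
  by (induction I rule: finite_induct) (simp_all add: mult_single)

text \<open>
  With \<open>c = 1\<close> this is the presentation map, and with \<open>c m = m\<^sub>i\<close> it is \<open>\<chi>\<^bsup>w\<^sub>i\<^esup>\<close> times the image of
  \<open>\<partial>f/\<partial>z\<^sub>i\<close>. All maps needed from \<open>R\<close> to the Laurent polynomials are shifts of maps of this form.
\<close>

definition twist :: "('v::finite \<Rightarrow> lattice) \<Rightarrow> (('v \<Rightarrow>\<^sub>0 nat) \<Rightarrow> 'k) \<Rightarrow> ('v, 'k::comm_ring_1) mpoly \<Rightarrow> 'k laurent"
  where "twist w c f =
    (\<Sum>m\<in>Poly_Mapping.keys f. Poly_Mapping.single (weight w m) (c m * Poly_Mapping.lookup f m))"

lemma presentation_eq_twist: "presentation w f = twist w (\<lambda>_. 1) f"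
  unfolding presentation_def twist_def
  by (intro sum.cong refl) (simp add: single_power prod_single mult_single flip: weight_eq_sum)

lemma twist_add: "twist w c (f + g) = twist w c f + twist w c g"
  unfolding twist_def
  by (rule setsum_keys_plus_distrib) (simp_all add: distrib_left single_add)

lemma twist_single: "twist w c (Poly_Mapping.single m x) = Poly_Mapping.single (weight w m) (c m * x)"
  by (simp add: twist_def)

lemma twist_zero [simp]: "twist w c 0 = 0" by (simp add: twist_def)

lemma twist_uminus: "twist w c (- f) = - twist w c f"
  using twist_add[of w c f "- f"] by (simp add: eq_neg_iff_add_eq_0 add.commute)

lemma twist_diff: "twist w c (f - g) = twist w c f - twist w c g"
  using twist_add[of w c f "- g"] by (simp add: twist_uminus)

lemma twist_sum: "twist w c (sum f I) = (\<Sum>i\<in>I. twist w c (f i))"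
  by (induction I rule: infinite_finite_induct) (simp_all add: twist_add)

lemma lookup_twist: "Poly_Mapping.lookup (twist w c f) d =
   (\<Sum>m\<in>{m\<in>Poly_Mapping.keys f. weight w m = d}. c m * Poly_Mapping.lookup f m)"
  unfolding twist_def lookup_sum
  by (subst sum.inter_filter[OF finite_keys]) (auto simp: lookup_single "when_def" intro!: sum.cong)

text \<open>
  The Leibniz rule: on monomials it is the additivity of \<open>c\<close>.
\<close>

lemma twist_mult:
  assumes "\<And>m n. c (m + n) = c m + c n"
  shows "twist w c (f * g) = presentation w f * twist w c g + twist w c f * presentation w g"
proof (induction f rule: monomial_induct)
  case (1 m x)
  show ?case
  proof (induction g rule: monomial_induct)
    case (1 n y)
    show ?case
      by (simp add: presentation_eq_twist mult_single twist_single assms weight_add distrib_left single_add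
          distrib_right mult_ac add_ac)
  qed (simp add: presentation_eq_twist twist_add distrib_left add_ac)
qed (simp add: presentation_eq_twist twist_add distrib_right add_ac)

lemma presentation_mult: "presentation w (f * g) = presentation w f * presentation w g"
proof (induction f rule: monomial_induct)
  case (1 m x)
  show ?case
    by (induction g rule: monomial_induct)
      (simp_all add: presentation_eq_twist mult_single twist_single weight_add twist_add distrib_left)
qed (simp add: presentation_eq_twist twist_add distrib_right)

lemma presentation_add: "presentation w (f + g) = presentation w f + presentation w g"
  by (simp add: presentation_eq_twist twist_add)

lemma presentation_diff: "presentation w (f - g) = presentation w f - presentation w g"
  by (simp add: presentation_eq_twist twist_diff)

lemma presentation_single: "presentation w (Poly_Mapping.single m x) = Poly_Mapping.single (weight w m) x"
  by (simp add: presentation_eq_twist twist_single)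

definition exponent_pairing :: "('v::finite \<Rightarrow> 'k::comm_ring_1) \<Rightarrow> ('v \<Rightarrow>\<^sub>0 nat) \<Rightarrow> 'k"
  where "exponent_pairing a m = (\<Sum>i\<in>UNIV. of_nat (Poly_Mapping.lookup m i) * a i)"

lemma exponent_pairing_add: "exponent_pairing a (m + n) = exponent_pairing a m + exponent_pairing a n"
  by (simp add: exponent_pairing_def lookup_add distrib_right sum.distrib)

lemma exponent_pairing_single: "exponent_pairing a (Poly_Mapping.single i n) = of_nat n * a i"
  unfolding exponent_pairing_def
  by (subst sum.remove[of _ i]) (auto simp: lookup_single_not_eq intro!: sum.neutral)

lemma presentation_partial_deriv:
  "presentation w (partial_deriv i f) = Poly_Mapping.single (- w i) 1 * twist w (\<lambda>m. of_nat (Poly_Mapping.lookup m i)) f"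
proof -
  have "Poly_Mapping.single (weight w (m - Poly_Mapping.single i 1)) (of_nat (Poly_Mapping.lookup m i) * Poly_Mapping.lookup f m) =
     Poly_Mapping.single (weight w m - w i) (of_nat (Poly_Mapping.lookup m i) * Poly_Mapping.lookup f m)" for m
  proof (cases "Poly_Mapping.lookup m i = 0")
    case False
    then have "m = (m - Poly_Mapping.single i 1) + Poly_Mapping.single i 1"
      by (intro poly_mapping_eqI) (auto simp: lookup_add lookup_minus lookup_single "when_def")
    then have "weight w m = weight w (m - Poly_Mapping.single i 1) + w i"
      by (metis weight_add weight_single of_nat_1 zscale_simps(2))
    then show ?thesis by simp
  qed simp
  then show ?thesis
    unfolding partial_deriv_def presentation_eq_twist twist_sum twist_single
    by (simp add: twist_def sum_distrib_left mult_single add.commute)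
qed

text \<open>
  The derivation \<open>z\<^sub>i \<mapsto> a\<^sub>i \<chi>\<^bsup>w\<^sub>i + u\<^esup>\<close> is logarithmic: up to the shift by \<open>u\<close> it multiplies the image of
  \<open>z\<^sup>m\<close> by \<open>\<Sum> m\<^sub>i a\<^sub>i\<close>.
\<close>

lemma sum_presentation_partial_deriv:
  "(\<Sum>i\<in>UNIV. Poly_Mapping.single (w i + u) (a i) * presentation w (partial_deriv i f)) =
    Poly_Mapping.single u 1 * twist w (exponent_pairing a) f"
proof -
  have "Poly_Mapping.single (w i + u) (a i) * presentation w (partial_deriv i f) =
      (\<Sum>m\<in>Poly_Mapping.keys f. Poly_Mapping.single (u + weight w m) (a i * (of_nat (Poly_Mapping.lookup m i) * Poly_Mapping.lookup f m)))" for i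
    unfolding presentation_partial_deriv twist_def
    by (simp add: mult_single sum_distrib_left flip: mult.assoc)
  then show ?thesis
    by (simp add: twist_def sum_distrib_left mult_single exponent_pairing_def sum_distrib_right sum.swap[of _ _ UNIV]
      single_sum mult_ac)
qed

section \<open>Homomorphisms of the conormal module\<close>

lemma module_mult: "module ((*) :: 'a::comm_ring_1 \<Rightarrow> 'a \<Rightarrow> 'a)"
  by unfold_locales (simp_all add: algebra_simps)

lemma toric_ideal_iff: "f \<in> toric_ideal w \<longleftrightarrow> presentation w f = 0"
  by (simp add: toric_ideal_def)

text \<open>
  By the Leibniz rule a derivation along the presentation map kills every product of two elements of
  its kernel.
\<close>

lemma square_vanishing:
  fixes f :: "('v::finite, 'k::comm_ring_1) mpoly"
  assumes c: "\<And>m n. c (m + n) = c m + c n" and f: "f \<in> toric_ideal_square w"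
  shows "twist w c f = 0 \<and> presentation w f = 0"
proof (rule module.span_induct_alt[OF module_mult, where x = f])
  show "f \<in> module.span (*) {f * g |f g. f \<in> toric_ideal w \<and> g \<in> toric_ideal w}"
    using f by (simp add: toric_ideal_square_def)
  show "twist w c 0 = 0 \<and> presentation w 0 = 0"
    by (simp add: presentation_eq_twist)
next
  fix r x y :: "('v, 'k) mpoly"
  assume x: "x \<in> {f * g |f g. f \<in> toric_ideal w \<and> g \<in> toric_ideal w}"
    and y: "twist w c y = 0 \<and> presentation w y = 0"
  then have "presentation w x = 0" "twist w c x = 0"
    by (auto simp: toric_ideal_iff twist_mult[OF c] presentation_mult)
  with y show "twist w c (r * x + y) = 0 \<and> presentation w (r * x + y) = 0"
    by (simp add: twist_add twist_mult[OF c] presentation_mult presentation_add)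
qed

lemma zero_in_square: "0 \<in> toric_ideal_square w"
  unfolding toric_ideal_square_def by (rule module.span_zero[OF module_mult])

lemma mem_conormal_class: "f \<in> conormal_class w f"
  using zero_in_square[of w] by (auto simp: conormal_class_def elt_set_plus_def)

lemma deriv_hom_class:
  assumes "f \<in> toric_ideal w"
  shows "deriv_hom w i (conormal_class w f) = presentation w (partial_deriv i f)"
proof -
  have "presentation w (partial_deriv i g) = presentation w (partial_deriv i f)" if g: "g \<in> conormal_class w f" for g
  proof -
    obtain h where h: "g = f + h" "h \<in> toric_ideal_square w"
      using g by (auto simp: conormal_class_def elt_set_plus_def)
    have "twist w (\<lambda>m. of_nat (Poly_Mapping.lookup m i)) h = 0"
      by (rule conjunct1[OF square_vanishing[OF _ h(2)]]) (simp add: lookup_add)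
    then show ?thesis by (simp add: h(1) presentation_partial_deriv twist_add)
  qed
  then have "(\<lambda>f. presentation w (partial_deriv i f)) ` conormal_class w f =
      (\<lambda>f'. presentation w (partial_deriv i f)) ` conormal_class w f"
    by (rule image_cong[OF refl])
  also have "\<dots> = {presentation w (partial_deriv i f)}"
    using mem_conormal_class[of f w] by (intro image_constant)
  finally have "(\<lambda>f. presentation w (partial_deriv i f)) ` conormal_class w f =
      {presentation w (partial_deriv i f)}" .
  then show ?thesis
    using assms by (simp add: deriv_hom_def conormal_module_def)
qed

lemma vector_space_hom_scale: "vector_space (hom_scale :: 'k::field \<Rightarrow> ('c \<Rightarrow> 'k laurent) \<Rightarrow> _)"
  by unfold_locales
    (auto simp: hom_scale_def fun_eq_iff distrib_left distrib_right single_add mult_single simp flip: mult.assoc)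


text \<open>Lattice points are treated as points, not as pairs of integers.\<close>

declare split_paired_All [simp del] split_paired_Ex [simp del]

section \<open>Linear forms and partially additive functions\<close>

definition linear_form :: "'k \<times> 'k \<Rightarrow> lattice \<Rightarrow> 'k::comm_ring_1"
  where "linear_form t x = of_int (fst x) * fst t + of_int (snd x) * snd t"

lemma linear_form_add: "linear_form t (x + y) = linear_form t x + linear_form t y"
  by (simp add: linear_form_def algebra_simps)

lemma linear_form_zero [simp]: "linear_form t 0 = 0"
  by (simp add: linear_form_def)

lemma linear_form_zscale: "linear_form t (n \<cdot> x) = of_int n * linear_form t x"
  by (simp add: linear_form_def algebra_simps)

text \<open>
  Additivity is required only for sums which lie in \<open>K\<close>. Values outside \<open>K\<close> carry no information and
  are set to \<open>0\<close>, so that two functions which agree on \<open>K\<close> are equal.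
\<close>

definition additive_on :: "lattice set \<Rightarrow> lattice set \<Rightarrow> (lattice \<Rightarrow> 'k::comm_ring_1) set"
  where "additive_on S K = {g. (\<forall>x. x \<notin> K \<longrightarrow> g x = 0) \<and>
    (\<forall>a\<in>S. \<forall>b\<in>S. a + b \<in> K \<longrightarrow> g (a + b) = g a + g b)}"

text \<open>
  In a degree \<open>d\<close> of this set every homomorphism of degree \<open>u\<close> vanishes, because \<open>k[S]\<close> has nothing in
  degree \<open>d + u\<close>.
\<close>

definition shift_gap :: "lattice set \<Rightarrow> lattice \<Rightarrow> lattice set"
  where "shift_gap S u = {s \<in> S. s + u \<notin> S}"

lemma additive_onD:
  assumes "g \<in> additive_on S K"
  shows "x \<notin> K \<Longrightarrow> g x = 0" "a \<in> S \<Longrightarrow> b \<in> S \<Longrightarrow> a + b \<in> K \<Longrightarrow> g (a + b) = g a + g b"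
  using assms by (auto simp: additive_on_def)

lemma additive_on_diff:
  "g \<in> additive_on S K \<Longrightarrow> h \<in> additive_on S K \<Longrightarrow> (\<lambda>x. g x - h x) \<in> additive_on S K"
  by (auto simp: additive_on_def)

lemma additive_on_sum:
  assumes "\<And>p. p \<in> P \<Longrightarrow> G p \<in> additive_on S K"
  shows "(\<lambda>x. \<Sum>p\<in>P. c p * G p x) \<in> additive_on S K"
  using assms by (auto simp: additive_on_def distrib_left simp flip: sum.distrib intro!: sum.cong sum.neutral)

lemma additive_on_restrict_linear_form:
  assumes "\<And>a b. a \<in> S \<Longrightarrow> b \<in> S \<Longrightarrow> a + b \<in> K \<Longrightarrow> a \<in> K \<and> b \<in> K"
  shows "(\<lambda>x. if x \<in> K then linear_form t x else 0) \<in> additive_on S K"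
  using assms by (auto simp: additive_on_def linear_form_add)

lemma linear_form_exists:
  fixes a b :: "'k::field_char_0"
  assumes "fst x * snd y \<noteq> snd x * fst y"
  shows "\<exists>t. linear_form t x = a \<and> linear_form t y = b"
proof -
  define d :: 'k where "d = of_int (fst x * snd y - snd x * fst y)"
  have d: "d \<noteq> 0" using assms by (simp add: d_def del: of_int_diff of_int_mult)
  let ?t = "((a * of_int (snd y) - b * of_int (snd x)) / d, (of_int (fst x) * b - of_int (fst y) * a) / d)"
  have "linear_form ?t x = a * d / d" "linear_form ?t y = b * d / d"
    by (simp_all add: linear_form_def d_def algebra_simps add_divide_distrib diff_divide_distrib)
  with d show ?thesis by (intro exI[of _ ?t]) simp
qed

lemma linear_form_eq_zero:
  fixes t :: "'k::field_char_0 \<times> 'k"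
  assumes "fst x * snd y \<noteq> snd x * fst y" "linear_form t x = 0" "linear_form t y = 0"
  shows "linear_form t z = 0"
proof -
  define d :: 'k where "d = of_int (fst x * snd y - snd x * fst y)"
  have d: "d \<noteq> 0" using assms by (simp add: d_def del: of_int_diff of_int_mult)
  have "d * fst t = of_int (snd y) * linear_form t x - of_int (snd x) * linear_form t y"
    "d * snd t = of_int (fst x) * linear_form t y - of_int (fst y) * linear_form t x"
    by (simp_all add: linear_form_def d_def algebra_simps)
  with d assms have "fst t = 0" "snd t = 0" by simp_all
  then show ?thesis by (simp add: linear_form_def)
qed

lemma linear_form_diff: "linear_form t (x - y) = linear_form t x - linear_form t y"
  by (simp add: linear_form_def algebra_simps)

lemma linear_form_parallel:
  fixes t :: "'k::field_char_0 \<times> 'k"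
  assumes "linear_form t x = 0" "x \<noteq> 0" "fst x * snd y = snd x * fst y"
  shows "linear_form t y = 0"
proof -
  have eq: "of_int (fst x) * of_int (snd y) = (of_int (snd x) * of_int (fst y) :: 'k)"
    using arg_cong[OF assms(3), of "of_int :: int \<Rightarrow> 'k"] by simp
  have "of_int (fst x) * linear_form t y = of_int (fst y) * linear_form t x +
      snd t * (of_int (fst x) * of_int (snd y) - of_int (snd x) * of_int (fst y))"
    "of_int (snd x) * linear_form t y = of_int (snd y) * linear_form t x -
      fst t * (of_int (fst x) * of_int (snd y) - of_int (snd x) * of_int (fst y))"
    by (simp_all add: linear_form_def algebra_simps)
  then have "of_int (fst x) * linear_form t y = 0" "of_int (snd x) * linear_form t y = 0"
    by (simp_all add: assms(1) eq)
  then show ?thesis using assms(2) by (auto simp: prod_eq_iff)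
qed

lemma additive_int:
  fixes f :: "int \<Rightarrow> 'k::comm_ring_1"
  assumes "\<And>x y. f (x + y) = f x + f y"
  shows "f n = of_int n * f 1"
proof (induction n rule: int_induct[of _ 0])
  case base
  show ?case using assms[of 0 0] by simp
next
  case (step1 i)
  then show ?case using assms[of i 1] by (simp add: distrib_right)
next
  case (step2 i)
  then show ?case using assms[of "i - 1" 1] by (simp add: left_diff_distrib eq_diff_eq)
qed

lemma additive_lattice:
  fixes f :: "lattice \<Rightarrow> 'k::comm_ring_1"
  assumes add: "\<And>x y. f (x + y) = f x + f y"
  shows "f z = linear_form (f (1, 0), f (0, 1)) z"
proof -
  have "f z = f (fst z, 0) + f (0, snd z)"
    using add[of "(fst z, 0)" "(0, snd z)"] by simp
  also have "f (fst z, 0) = of_int (fst z) * f (1, 0)"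
    using additive_int[of "\<lambda>n. f (n, 0)" "fst z"] add[of "(_, 0)" "(_, 0)"] by simp
  also have "f (0, snd z) = of_int (snd z) * f (0, 1)"
    using additive_int[of "\<lambda>n. f (0, n)" "snd z"] add[of "(0, _)" "(0, _)"] by simp
  finally show ?thesis by (simp add: linear_form_def)
qed

lemma additive_exponent:
  fixes h :: "('v::finite \<Rightarrow>\<^sub>0 nat) \<Rightarrow> 'k::comm_ring_1"
  assumes add: "\<And>m n. h (m + n) = h m + h n"
  shows "h m = exponent_pairing (\<lambda>i. h (Poly_Mapping.single i 1)) m"
proof (induction m rule: monomial_induct)
  case (1 i n)
  have "h (Poly_Mapping.single i n) = of_nat n * h (Poly_Mapping.single i 1)"
  proof (induction n)
    case 0
    show ?case using add[of 0 0] by simp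
  next
    case (Suc n)
    have "Poly_Mapping.single i (Suc n) = Poly_Mapping.single i n + Poly_Mapping.single i 1"
      by (simp flip: single_add)
    with Suc show ?case by (simp add: add algebra_simps)
  qed
  then show ?case by (simp add: exponent_pairing_single)
qed (simp add: add exponent_pairing_add)

lemma linear_form_weight:
  "exponent_pairing (\<lambda>i. linear_form t (w i)) m = linear_form t (weight w m)"
  using additive_exponent[of "\<lambda>m. linear_form t (weight w m)" m]
  by (simp add: weight_add linear_form_add weight_single)

section \<open>The lattice of a presented monoid\<close>

locale presented_monoid =
  fixes S :: "lattice set" and w :: "'v::finite \<Rightarrow> lattice"
  assumes generates: "generates_monoid w S"
    and full: "group_closure S = UNIV"
begin

lemma mem_iff: "x \<in> S \<longleftrightarrow> (\<exists>m. x = weight w m)"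
  using generates by (auto simp: generates_monoid_def)

lemma weight_mem: "weight w m \<in> S"
  by (auto simp: mem_iff)

lemma add_mem: "x \<in> S \<Longrightarrow> y \<in> S \<Longrightarrow> x + y \<in> S"
  unfolding mem_iff by (metis weight_add)

lemma generator_mem: "w i \<in> S"
  using weight_mem[of "Poly_Mapping.single i 1"] by (simp add: weight_single)

lemma shift_gap_down:
  assumes "a \<in> S" "b \<in> S" "a + b \<in> shift_gap S u"
  shows "a \<in> shift_gap S u \<and> b \<in> shift_gap S u"
  using assms add_mem[of "a + u" b] add_mem[of a "b + u"]
  by (auto simp: shift_gap_def add_ac)

lemma mem_difference: "\<exists>m n. x = weight w m - weight w n"
proof -
  have "x \<in> group_closure S" using full by simp
  then show ?thesis
  proof induction
    case (base s)
    show ?case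
    proof (cases "s = 0")
      case True
      then show ?thesis by (intro exI[of _ 0]) simp
    next
      case False
      then obtain m where "s = weight w m" using base by (auto simp: mem_iff)
      then show ?thesis by (intro exI[of _ m] exI[of _ 0]) simp
    qed
  next
    case (diff s t)
    then obtain a b c d where "s = weight w a - weight w b" "t = weight w c - weight w d" by auto
    then show ?case
      by (intro exI[of _ "a + d"] exI[of _ "b + c"]) (simp add: weight_add)
  qed
qed

text \<open>
  A section \<open>z \<mapsto> P z - N z\<close> of the weight map from integer exponents onto the lattice: lift the two
  standard basis vectors, using that \<open>S\<close> generates the lattice, and extend additively. The positive
  and the negative part are recorded separately because exponents of monomials are natural numbers.
\<close>

lemma lattice_section:
  obtains P N :: "lattice \<Rightarrow> 'v \<Rightarrow>\<^sub>0 nat" where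
    "\<And>z. weight w (P z) = weight w (N z) + z"
    "\<And>z z'. P (z + z') + (N z + N z') = N (z + z') + (P z + P z')"
proof -
  obtain \<alpha> \<beta> where ab: "(1, 0) = weight w \<alpha> - weight w \<beta>" using mem_difference by blast
  obtain \<gamma> \<delta> where cd: "(0, 1) = weight w \<gamma> - weight w \<delta>" using mem_difference by blast
  define s where "s z i =
    fst z * (int (Poly_Mapping.lookup \<alpha> i) - int (Poly_Mapping.lookup \<beta> i)) +
    snd z * (int (Poly_Mapping.lookup \<gamma> i) - int (Poly_Mapping.lookup \<delta> i))" for z :: lattice and i
  define P where "P z = Abs_poly_mapping (\<lambda>i. nat (s z i))" for z
  define N where "N z = Abs_poly_mapping (\<lambda>i. nat (- s z i))" for z
  have lookup: "Poly_Mapping.lookup (P z) i = nat (s z i)" "Poly_Mapping.lookup (N z) i = nat (- s z i)" for z i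
    by (simp_all add: P_def N_def)
  have s_add: "s (z + z') i = s z i + s z' i" for z z' i
    by (simp add: s_def algebra_simps)
  have s_sum: "(\<Sum>i\<in>UNIV. s z i * x i) =
      fst z * ((\<Sum>i\<in>UNIV. int (Poly_Mapping.lookup \<alpha> i) * x i) - (\<Sum>i\<in>UNIV. int (Poly_Mapping.lookup \<beta> i) * x i)) +
      snd z * ((\<Sum>i\<in>UNIV. int (Poly_Mapping.lookup \<gamma> i) * x i) - (\<Sum>i\<in>UNIV. int (Poly_Mapping.lookup \<delta> i) * x i))" for z x
    by (simp add: s_def sum_distrib_left sum.distrib sum_subtractf algebra_simps)
  have split: "(\<Sum>i\<in>UNIV. int (nat (s z i)) * x i) - (\<Sum>i\<in>UNIV. int (nat (- s z i)) * x i) = (\<Sum>i\<in>UNIV. s z i * x i)" for z x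
  proof -
    have "int (nat (s z i)) * x i - int (nat (- s z i)) * x i = s z i * x i" for i
      by (cases "0 \<le> s z i") auto
    then show ?thesis by (simp flip: sum_subtractf)
  qed
  have "weight w (P z) - weight w (N z) = z" for z
    using ab cd split[of z "\<lambda>i. fst (w i)"] split[of z "\<lambda>i. snd (w i)"]
    by (simp add: prod_eq_iff weight_eq_sum fst_sum snd_sum lookup s_sum)
  then have "weight w (P z) = weight w (N z) + z" for z by (metis add.commute diff_add_cancel)
  moreover have "P (z + z') + (N z + N z') = N (z + z') + (P z + P z')" for z z'
    by (intro poly_mapping_eqI) (simp add: lookup_add lookup s_add)
  ultimately show ?thesis using that by blast
qed

text \<open>
  The hypotheses say that \<open>c m n\<close> depends on \<open>m - n\<close> only and is additive in it, so \<open>c\<close> is a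
  homomorphism on the kernel of the weight map. Subtracting a section of the weight map extends it to
  all exponents.
\<close>

lemma weight_potential:
  fixes c :: "('v \<Rightarrow>\<^sub>0 nat) \<Rightarrow> ('v \<Rightarrow>\<^sub>0 nat) \<Rightarrow> 'k::comm_ring_1"
  assumes trans: "\<And>m n l. weight w m = weight w n \<Longrightarrow> weight w n = weight w l \<Longrightarrow> c m n + c n l = c m l"
    and shift: "\<And>m n l. weight w m = weight w n \<Longrightarrow> c (m + l) (n + l) = c m n"
  shows "\<exists>a. \<forall>m n. weight w m = weight w n \<longrightarrow> c m n = exponent_pairing a m - exponent_pairing a n"
proof -
  obtain P N :: "lattice \<Rightarrow> 'v \<Rightarrow>\<^sub>0 nat" where
    wt: "\<And>z. weight w (P z) = weight w (N z) + z" and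
    PN: "\<And>z z'. P (z + z') + (N z + N z') = N (z + z') + (P z + P z')"
    using lattice_section by blast
  have difference: "c m n = c m' n'"
    if "weight w m = weight w n" "weight w m' = weight w n'" "m + n' = n + m'" for m n m' n'
    using shift[OF that(1), of n'] shift[OF that(2), of n] that(3) by (simp add: add_ac)
  have add: "c (m + m') (n + n') = c m n + c m' n'"
    if "weight w m = weight w n" "weight w m' = weight w n'" for m n m' n'
    using trans[of "m + m'" "n + m'" "n + n'"] shift[OF that(1), of m'] shift[OF that(2), of n] that
    by (simp add: weight_add add_ac)
  define h where "h m = c (m + N (weight w m)) (P (weight w m))" for m
  have "h (m + n) = h m + h n" for m n
  proof -
    have "h m + h n = c (m + N (weight w m) + (n + N (weight w n))) (P (weight w m) + P (weight w n))"
      unfolding h_def by (rule add[symmetric]) (simp_all add: weight_add wt)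
    also have "\<dots> = h (m + n)"
      unfolding h_def using PN[of "weight w m" "weight w n"]
      by (intro difference) (simp_all add: weight_add wt add_ac)
    finally show ?thesis by simp
  qed
  then have h: "h m = exponent_pairing (\<lambda>i. h (Poly_Mapping.single i 1)) m" for m
    by (rule additive_exponent)
  have "c m n = h m - h n" if "weight w m = weight w n" for m n
    using trans[of "m + N (weight w m)" "n + N (weight w m)" "P (weight w m)"]
      shift[OF that, of "N (weight w m)"] that
    by (simp add: h_def weight_add wt eq_diff_eq)
  then have "\<forall>m n. weight w m = weight w n \<longrightarrow>
      c m n = exponent_pairing (\<lambda>i. h (Poly_Mapping.single i 1)) m - exponent_pairing (\<lambda>i. h (Poly_Mapping.single i 1)) n"
    unfolding h[symmetric] by simp
  then show ?thesis by (rule exI[of _ "\<lambda>i. h (Poly_Mapping.single i 1)"])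
qed

text \<open>
  A functional on exponents that vanishes on the kernel of the weight map factors through the lattice.
\<close>

lemma exponent_pairing_linear:
  fixes a :: "'v \<Rightarrow> 'k::comm_ring_1"
  assumes "\<And>m n. weight w m = weight w n \<Longrightarrow> exponent_pairing a m = exponent_pairing a n"
  shows "\<exists>t. \<forall>m. exponent_pairing a m = linear_form t (weight w m)"
proof -
  obtain P N :: "lattice \<Rightarrow> 'v \<Rightarrow>\<^sub>0 nat" where
    wt: "\<And>z. weight w (P z) = weight w (N z) + z" and
    PN: "\<And>z z'. P (z + z') + (N z + N z') = N (z + z') + (P z + P z')"
    using lattice_section by blast
  define G where "G z = exponent_pairing a (P z) - exponent_pairing a (N z)" for z
  have "G (z + z') = G z + G z'" for z z'
    using arg_cong[OF PN[of z z'], of "exponent_pairing a"]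
    by (simp add: G_def exponent_pairing_add algebra_simps)
  then have G: "G z = linear_form (G (1, 0), G (0, 1)) z" for z
    by (rule additive_lattice)
  have "exponent_pairing a m = G (weight w m)" for m
    using assms[of "m + N (weight w m)" "P (weight w m)"]
    by (simp add: G_def weight_add wt exponent_pairing_add eq_diff_eq)
  with G show ?thesis by metis
qed

end

section \<open>The homogeneous components of \<open>T\<^sup>1\<close>\<close>

lemma lookup_mult_single:
  "Poly_Mapping.lookup (p * Poly_Mapping.single y c) x = Poly_Mapping.lookup p (x - y) * (c :: 'k::comm_ring_1)"
  for x y :: lattice
  by (induction p rule: monomial_induct)
    (auto simp: mult_single lookup_single "when_def" lookup_add distrib_right)

lemma lookup_single_mult:
  "Poly_Mapping.lookup (Poly_Mapping.single y c * p) x = (c :: 'k::comm_ring_1) * Poly_Mapping.lookup p (x - y)"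
  for x y :: lattice
  by (simp add: lookup_mult_single mult.commute)

lemma toric_ideal_add: "f \<in> toric_ideal w \<Longrightarrow> g \<in> toric_ideal w \<Longrightarrow> f + g \<in> toric_ideal w"
  by (simp add: toric_ideal_iff presentation_add)

lemma toric_ideal_mult: "f \<in> toric_ideal w \<Longrightarrow> r * f \<in> toric_ideal w"
  by (simp add: toric_ideal_iff presentation_mult)

text \<open>
  In degree \<open>d\<close> the twist is \<open>y\<close> times the presentation map.
\<close>

lemma twist_weight_eq_zero:
  assumes "f \<in> toric_ideal w" "\<And>m. weight w m = d \<Longrightarrow> c m = y"
  shows "Poly_Mapping.lookup (twist w c f) d = 0"
proof -
  have "Poly_Mapping.lookup (twist w c f) d = y * Poly_Mapping.lookup (presentation w f) d"
    unfolding presentation_eq_twist lookup_twist sum_distrib_left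
    by (intro sum.cong) (simp_all add: assms)
  with assms(1) show ?thesis by (simp add: toric_ideal_iff)
qed

text \<open>
  The homomorphism induced by \<open>z\<^sub>i \<mapsto> a\<^sub>i \<chi>\<^bsup>w\<^sub>i + u\<^esup>\<close>. Since \<open>w i + u\<close> may lie outside \<open>S\<close>, it need not
  belong to \<open>deriv_submodule\<close>, even if its values lie in \<open>k[S]\<close>.
\<close>

definition euler_hom :: "('v::finite \<Rightarrow> lattice) \<Rightarrow> lattice \<Rightarrow> ('v \<Rightarrow> 'k) \<Rightarrow> ('v, 'k::comm_ring_1) mpoly set \<Rightarrow> 'k laurent"
  where "euler_hom w u a C = (\<Sum>i\<in>UNIV. Poly_Mapping.single (w i + u) (a i) * deriv_hom w i C)"

lemma euler_hom_class:
  "f \<in> toric_ideal w \<Longrightarrow>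
    euler_hom w u a (conormal_class w f) = Poly_Mapping.single u 1 * twist w (exponent_pairing a) f"
  by (simp add: euler_hom_def deriv_hom_class sum_presentation_partial_deriv)

lemma euler_hom_outside: "C \<notin> conormal_module w \<Longrightarrow> euler_hom w u a C = 0"
  by (simp add: euler_hom_def deriv_hom_def)

lemma euler_hom_diff: "euler_hom w u a - euler_hom w u b = euler_hom w u (\<lambda>i. a i - b i)"
  by (rule ext) (simp add: euler_hom_def single_diff left_diff_distrib sum_subtractf)

lemma sum_fun_apply: "sum F P x = (\<Sum>p\<in>P. F p x)"
  by (induction P rule: infinite_finite_induct) auto

lemma euler_hom_sum:
  "(\<Sum>p\<in>P. hom_scale (c p) (euler_hom w u (a p))) = euler_hom w u (\<lambda>i. \<Sum>p\<in>P. c p * a p i)"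
  by (rule ext)
    (simp add: sum_fun_apply euler_hom_def hom_scale_def single_sum sum_distrib_left sum_distrib_right
      sum.swap[of _ _ P] mult_single flip: mult.assoc)

lemma keys_subset_singleton:
  "Poly_Mapping.keys p \<subseteq> {x} \<Longrightarrow> p = Poly_Mapping.single x (Poly_Mapping.lookup p x)"
  by (intro poly_mapping_eqI) (auto simp: lookup_single "when_def" in_keys_iff)

abbreviation binomial :: "'a \<Rightarrow> 'a \<Rightarrow> 'a \<Rightarrow>\<^sub>0 'k::comm_ring_1"
  where "binomial m n \<equiv> Poly_Mapping.single m 1 - Poly_Mapping.single n 1"

lemma binomial_toric: "weight w m = weight w n \<Longrightarrow> binomial m n \<in> toric_ideal w"
  by (simp add: toric_ideal_iff presentation_diff presentation_single)

lemma quotient_space_deriv_submodule: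
  assumes "0 \<in> S"
  shows "quotient_space hom_scale (deriv_submodule S w :: (('v::finite, 'k::field) mpoly set \<Rightarrow> _) set)"
proof -
  interpret vector_space "hom_scale :: 'k \<Rightarrow> (('v, 'k) mpoly set \<Rightarrow> _) \<Rightarrow> _"
    by (rule vector_space_hom_scale)
  have mem: "(\<lambda>C. \<Sum>i\<in>UNIV. a i * deriv_hom w i C) \<in> deriv_submodule S w"
    if "\<And>i. Poly_Mapping.keys (a i) \<subseteq> S" for a :: "'v \<Rightarrow> 'k laurent"
    using that by (auto simp: deriv_submodule_def monoid_algebra_def)
  show ?thesis
  proof
    show "0 \<in> (deriv_submodule S w :: (('v, 'k) mpoly set \<Rightarrow> _) set)"
      using mem[of "\<lambda>_. 0"] by (simp add: zero_fun_def)
  next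
    fix x y :: "('v, 'k) mpoly set \<Rightarrow> 'k laurent"
    assume "x \<in> deriv_submodule S w" "y \<in> deriv_submodule S w"
    then obtain a b where ab: "x = (\<lambda>C. \<Sum>i\<in>UNIV. a i * deriv_hom w i C)" "\<And>i. Poly_Mapping.keys (a i) \<subseteq> S"
       "y = (\<lambda>C. \<Sum>i\<in>UNIV. b i * deriv_hom w i C)" "\<And>i. Poly_Mapping.keys (b i) \<subseteq> S"
      by (auto simp: deriv_submodule_def monoid_algebra_def)
    have "Poly_Mapping.keys (a i + b i) \<subseteq> S" for i
      using ab(2)[of i] ab(4)[of i] keys_add[of "a i" "b i"] by blast
    then have "(\<lambda>C. \<Sum>i\<in>UNIV. (a i + b i) * deriv_hom w i C) \<in> deriv_submodule S w"
      by (rule mem)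
    then show "x + y \<in> deriv_submodule S w"
      by (simp add: ab plus_fun_def distrib_right sum.distrib)
  next
    fix x :: "('v, 'k) mpoly set \<Rightarrow> 'k laurent" and c
    assume "x \<in> deriv_submodule S w"
    then obtain a where a: "x = (\<lambda>C. \<Sum>i\<in>UNIV. a i * deriv_hom w i C)" "\<And>i. Poly_Mapping.keys (a i) \<subseteq> S"
      by (auto simp: deriv_submodule_def monoid_algebra_def)
    have "Poly_Mapping.keys (Poly_Mapping.single 0 c * a i) \<subseteq> S" for i
      using a(2)[of i] by (auto simp: in_keys_iff lookup_single_mult)
    then have "(\<lambda>C. \<Sum>i\<in>UNIV. (Poly_Mapping.single 0 c * a i) * deriv_hom w i C) \<in> deriv_submodule S w"
      by (rule mem)
    then show "hom_scale c x \<in> deriv_submodule S w"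
      by (simp add: a hom_scale_def sum_distrib_left mult.assoc)
  qed
qed

context presented_monoid
begin

lemma zero_mem: "0 \<in> S"
  using weight_mem[of 0] by simp

text \<open>
  Outside the gap \<open>w i + u\<close> lies in \<open>S\<close>, so the coefficient \<open>a\<^sub>i \<chi>\<^bsup>w\<^sub>i + u\<^esup>\<close> is in \<open>k[S]\<close>.
\<close>

lemma euler_hom_mem_deriv_submodule:
  fixes a :: "'v \<Rightarrow> 'k::comm_ring_1"
  assumes "\<And>i. w i \<in> shift_gap S u \<Longrightarrow> a i = 0"
  shows "euler_hom w u a \<in> deriv_submodule S w"
proof -
  have "Poly_Mapping.single (w i + u) (a i) \<in> monoid_algebra S" for i
    using assms[of i] generator_mem[of i] by (auto simp: monoid_algebra_def shift_gap_def)
  then show ?thesis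
    unfolding deriv_submodule_def euler_hom_def
    by (intro CollectI exI[of _ "\<lambda>i. Poly_Mapping.single (w i + u) (a i)"]) auto
qed

lemma additive_on_weight:
  assumes g: "g \<in> additive_on S (shift_gap S u)"
  shows "weight w m \<in> shift_gap S u \<Longrightarrow> g (weight w m) = exponent_pairing (\<lambda>i. g (w i)) m"
proof (induction m rule: monomial_induct)
  case (1 i n)
  then show ?case
  proof (induction n)
    case 0
    then show ?case using additive_onD(2)[OF g zero_mem zero_mem] by (simp add: exponent_pairing_def)
  next
    case (Suc n)
    have eq: "weight w (Poly_Mapping.single i (Suc n)) = weight w (Poly_Mapping.single i n) + w i"
      by (simp add: weight_single zscale_add_left add.commute)
    with Suc.prems shift_gap_down[OF weight_mem[of "Poly_Mapping.single i n"] generator_mem[of i], of u]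
    have "weight w (Poly_Mapping.single i n) \<in> shift_gap S u" by simp
    with Suc eq additive_onD(2)[OF g weight_mem generator_mem, of "Poly_Mapping.single i n" i]
    show ?case by (simp add: exponent_pairing_single distrib_right add.commute)
  qed
next
  case (2 f h)
  with shift_gap_down[OF weight_mem[of f] weight_mem[of h], of u]
    additive_onD(2)[OF g weight_mem[of f] weight_mem[of h]]
  show ?case by (simp add: weight_add exponent_pairing_add)
qed

text \<open>
  In a degree \<open>d\<close> of the gap all monomials are multiplied by the same number \<open>g d\<close>, so an element of
  the ideal is sent to \<open>0\<close>; in the other degrees of \<open>S\<close> the value lies in \<open>k[S]\<close> in any case.
\<close>

lemma euler_hom_normal:
  fixes g :: "lattice \<Rightarrow> 'k::comm_ring_1"
  assumes g: "g \<in> additive_on S (shift_gap S u)"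
  shows "euler_hom w u (\<lambda>i. g (w i)) \<in> normal_hom_degree S w u"
proof -
  let ?a = "\<lambda>i. g (w i)"
  have "Poly_Mapping.keys (Poly_Mapping.single u 1 * twist w (exponent_pairing ?a) f) \<subseteq> S"
    if f: "f \<in> toric_ideal w" for f :: "('v, 'k) mpoly"
  proof (rule ccontr)
    assume "\<not> ?thesis"
    then obtain x where "x \<notin> S" "x \<in> Poly_Mapping.keys (Poly_Mapping.single u 1 * twist w (exponent_pairing ?a) f)"
      by blast
    then have x: "x \<notin> S" "Poly_Mapping.lookup (twist w (exponent_pairing ?a) f) (x - u) \<noteq> 0"
      by (simp_all add: in_keys_iff lookup_single_mult)
    have "exponent_pairing ?a m = g (x - u)" if "weight w m = x - u" for m
    proof -
      have "x - u \<in> shift_gap S u" using x(1) weight_mem[of m] that by (simp add: shift_gap_def)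
      with that additive_on_weight[OF g, of m] show ?thesis by simp
    qed
    with twist_weight_eq_zero[OF f] x(2) show False by blast
  qed
  then have "normal_hom S w (euler_hom w u ?a)"
    unfolding normal_hom_def
    by (auto simp: conormal_module_def monoid_algebra_def euler_hom_class toric_ideal_add toric_ideal_mult
        twist_add distrib_left twist_mult[OF exponent_pairing_add] mult_ac euler_hom_outside[unfolded conormal_module_def])
       (simp add: toric_ideal_iff)
  moreover have "Poly_Mapping.keys (euler_hom w u ?a (conormal_class w f)) \<subseteq> {d + u}"
    if f: "f \<in> toric_ideal w" "\<forall>m\<in>Poly_Mapping.keys f. weight w m = d" for d and f :: "('v, 'k) mpoly"
  proof
    fix x assume "x \<in> Poly_Mapping.keys (euler_hom w u ?a (conormal_class w f))"
    then have "Poly_Mapping.lookup (twist w (exponent_pairing ?a) f) (x - u) \<noteq> 0"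
      by (simp add: euler_hom_class f in_keys_iff lookup_single_mult)
    then obtain m where "m \<in> Poly_Mapping.keys f" "weight w m = x - u"
      unfolding lookup_twist by (auto elim: sum.not_neutral_contains_not_neutral)
    with f(2) have "d = x - u" by auto
    then show "x \<in> {d + u}" by simp
  qed
  ultimately show ?thesis by (auto simp: normal_hom_degree_def)
qed

text \<open>
  A homomorphism of degree \<open>u\<close> maps the binomial of \<open>m\<close> and \<open>n\<close>, of weight \<open>d\<close>, to a multiple \<open>c m n\<close> of
  \<open>\<chi>\<^bsup>d + u\<^esup>\<close>. Additivity and linearity over \<open>R\<close> are the two hypotheses of \<open>weight_potential\<close>, and the
  binomials span the ideal over \<open>k\<close>. In a degree of the gap \<open>c\<close> vanishes, which is the second
  conclusion.
\<close>

lemma normal_hom_eq_euler_hom: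
  fixes \<phi> :: "('v, 'k::comm_ring_1) mpoly set \<Rightarrow> 'k laurent"
  assumes \<phi>: "\<phi> \<in> normal_hom_degree S w u"
  obtains a where "\<phi> = euler_hom w u a"
    "\<And>m n. weight w m = weight w n \<Longrightarrow> weight w m \<in> shift_gap S u \<Longrightarrow> exponent_pairing a m = exponent_pairing a n"
proof -
  define ev where "ev f = \<phi> (conormal_class w f)" for f
  have ev_add: "ev (f + g) = ev f + ev g" if "f \<in> toric_ideal w" "g \<in> toric_ideal w" for f g
    using \<phi> that by (simp add: ev_def normal_hom_degree_def normal_hom_def)
  have ev_mult: "ev (r * f) = presentation w r * ev f" if "f \<in> toric_ideal w" for r f
    using \<phi> that by (simp add: ev_def normal_hom_degree_def normal_hom_def)
  have ev_keys: "Poly_Mapping.keys (ev f) \<subseteq> S" if "f \<in> toric_ideal w" for f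
    using \<phi> that by (simp add: ev_def normal_hom_degree_def normal_hom_def conormal_module_def monoid_algebra_def)
  define c where "c m n = Poly_Mapping.lookup (ev (binomial m n)) (weight w m + u)" for m n
  have keys_binomial: "Poly_Mapping.keys (ev (binomial m n)) \<subseteq> {weight w m + u}"
    if "weight w m = weight w n" for m n
  proof -
    have "\<forall>l\<in>Poly_Mapping.keys (binomial m n :: ('v, 'k) mpoly). weight w l = weight w m"
      using that by (auto simp: in_keys_iff lookup_minus lookup_single "when_def" split: if_splits)
    then show ?thesis
      using \<phi> binomial_toric[OF that] unfolding ev_def normal_hom_degree_def by blast
  qed
  have ev_binomial: "ev (binomial m n) = Poly_Mapping.single (weight w m + u) (c m n)"
    if "weight w m = weight w n" for m n
    unfolding c_def by (rule keys_subset_singleton[OF keys_binomial[OF that]])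
  have trans: "c m n + c n l = c m l" if "weight w m = weight w n" "weight w n = weight w l" for m n l
    using ev_add[OF binomial_toric[OF that(1)] binomial_toric[OF that(2)]] that
    by (simp add: c_def lookup_add)
  have shift: "c (m + l) (n + l) = c m n" if "weight w m = weight w n" for m n l
  proof -
    have "binomial (m + l) (n + l) = Poly_Mapping.single l 1 * (binomial m n :: ('v, 'k) mpoly)"
      by (simp add: right_diff_distrib mult_single add.commute)
    with ev_mult[OF binomial_toric[OF that], of "Poly_Mapping.single l 1"] show ?thesis
      by (simp add: c_def presentation_single lookup_single_mult weight_add add_ac)
  qed
  have "\<exists>a. \<forall>m n. weight w m = weight w n \<longrightarrow> c m n = exponent_pairing a m - exponent_pairing a n"
    using trans shift by (rule weight_potential)
  then obtain a where
    a: "\<And>m n. weight w m = weight w n \<Longrightarrow> c m n = exponent_pairing a m - exponent_pairing a n"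
    by blast
  define E where "E f = Poly_Mapping.single u 1 * twist w (exponent_pairing a) f" for f :: "('v, 'k) mpoly"
  have E_add: "E (f + g) = E f + E g" for f g
    by (simp add: E_def twist_add distrib_left)
  \<comment> \<open>Comparing every monomial with a chosen one of the same weight exhibits each element of the ideal as
    a combination of binomials: what is left over depends only on the presentation.\<close>
  define rep where "rep x = (SOME m. weight w m = x)" for x
  have rep: "weight w (rep (weight w m)) = weight w m" for m
    unfolding rep_def by (rule someI) (rule refl)
  define lift where "lift p = (\<Sum>d\<in>Poly_Mapping.keys p. Poly_Mapping.single (rep d) (Poly_Mapping.lookup p d))"
    for p :: "'k laurent"
  have lift_add: "lift (p + q) = lift p + lift q" for p q
    unfolding lift_def by (rule setsum_keys_plus_distrib) (simp_all add: single_add)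
  have reduced: "f - lift (presentation w f) \<in> toric_ideal w \<and>
      ev (f - lift (presentation w f)) = E (f - lift (presentation w f))" for f
  proof (induction f rule: monomial_induct)
    case (1 m x)
    have lift: "lift (presentation w (Poly_Mapping.single m x)) = Poly_Mapping.single (rep (weight w m)) x"
      by (simp add: presentation_single lift_def)
    have eq: "Poly_Mapping.single m x - Poly_Mapping.single (rep (weight w m)) x =
        Poly_Mapping.single 0 x * binomial m (rep (weight w m))"
      by (simp add: right_diff_distrib mult_single)
    have wt: "weight w m = weight w (rep (weight w m))" by (simp add: rep)
    have "ev (Poly_Mapping.single 0 x * binomial m (rep (weight w m))) =
        Poly_Mapping.single (weight w m + u)
          (x * (exponent_pairing a m - exponent_pairing a (rep (weight w m))))"
      using ev_mult[OF binomial_toric[OF wt]] ev_binomial[OF wt] a[OF wt]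
      by (simp only:) (simp add: presentation_single mult_single)
    also have "\<dots> = E (Poly_Mapping.single 0 x * binomial m (rep (weight w m)))"
      unfolding eq[symmetric]
      by (simp add: E_def twist_diff twist_single rep mult_single
          right_diff_distrib single_diff add.commute mult.commute)
    finally show ?case
      unfolding lift eq using toric_ideal_mult[OF binomial_toric[OF wt]] by simp
  next
    case (2 f g)
    have "f + g - lift (presentation w (f + g)) =
        (f - lift (presentation w f)) + (g - lift (presentation w g))"
      by (simp add: presentation_add lift_add)
    with 2 show ?case by (simp only: toric_ideal_add ev_add E_add)
  qed
  have "ev f = E f" if "f \<in> toric_ideal w" for f
  proof -
    have "lift (presentation w f) = 0" using that by (simp add: toric_ideal_iff lift_def)
    with reduced[of f] show ?thesis by simp
  qed
  then have "\<phi> (conormal_class w f) = euler_hom w u a (conormal_class w f)" if "f \<in> toric_ideal w" for f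
    using that by (simp add: euler_hom_class ev_def E_def)
  moreover have "\<phi> C = 0" if "C \<notin> conormal_module w" for C
    using \<phi> that by (simp add: normal_hom_degree_def normal_hom_def)
  ultimately have "\<phi> C = euler_hom w u a C" for C
    by (cases "C \<in> conormal_module w") (auto simp: euler_hom_outside conormal_module_def)
  then have "\<phi> = euler_hom w u a" by (rule ext)
  moreover have "exponent_pairing a m = exponent_pairing a n"
    if "weight w m = weight w n" "weight w m \<in> shift_gap S u" for m n
  proof -
    have "c m n = 0"
      using that(2) ev_keys[OF binomial_toric[OF that(1)]] unfolding c_def shift_gap_def
      by (auto simp: in_keys_iff)
    with a[OF that(1)] show ?thesis by simp
  qed
  ultimately show ?thesis using that by blast
qed

text \<open>
  The coefficients at generators outside the gap can be removed by a derivation with coefficients in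
  \<open>k[S]\<close>; those at generators in the gap are values of an additive function.
\<close>

lemma normal_hom_mod_deriv:
  fixes \<phi> :: "('v, 'k::comm_ring_1) mpoly set \<Rightarrow> 'k laurent"
  assumes "\<phi> \<in> normal_hom_degree S w u"
  obtains g where "g \<in> additive_on S (shift_gap S u)"
    "\<phi> - euler_hom w u (\<lambda>i. g (w i)) \<in> deriv_submodule S w"
proof -
  obtain a where a: "\<phi> = euler_hom w u a"
    "\<And>m n. weight w m = weight w n \<Longrightarrow> weight w m \<in> shift_gap S u \<Longrightarrow> exponent_pairing a m = exponent_pairing a n"
    using normal_hom_eq_euler_hom[OF assms] by blast
  define g where "g x = (if x \<in> shift_gap S u then exponent_pairing a (SOME m. weight w m = x) else 0)" for x
  have g: "g (weight w m) = exponent_pairing a m" if "weight w m \<in> shift_gap S u" for m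
  proof -
    have "weight w (SOME n. weight w n = weight w m) = weight w m" by (rule someI) (rule refl)
    from a(2)[OF this] that this show ?thesis by (simp add: g_def)
  qed
  have "g \<in> additive_on S (shift_gap S u)"
  proof -
    have "g (weight w m + weight w n) = g (weight w m) + g (weight w n)"
      if "weight w m + weight w n \<in> shift_gap S u" for m n
      using shift_gap_down[OF weight_mem weight_mem that] g[of m] g[of n] g[of "m + n"] that
      by (simp add: weight_add exponent_pairing_add)
    then have "g (x + y) = g x + g y" if "x \<in> S" "y \<in> S" "x + y \<in> shift_gap S u" for x y
      using that unfolding mem_iff by blast
    moreover have "g x = 0" if "x \<notin> shift_gap S u" for x
      using that by (simp add: g_def)
    ultimately show ?thesis by (simp add: additive_on_def)
  qed
  moreover have "g (w i) = a i" if "w i \<in> shift_gap S u" for i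
    using g[of "Poly_Mapping.single i 1"] that by (simp add: weight_single exponent_pairing_single)
  then have "\<phi> - euler_hom w u (\<lambda>i. g (w i)) \<in> deriv_submodule S w"
    unfolding a(1) euler_hom_diff by (intro euler_hom_mem_deriv_submodule) simp
  ultimately show ?thesis by (rule that)
qed

text \<open>
  A linear form yields a derivation that acts on each graded piece of \<open>R\<close> by a scalar and hence kills
  the ideal. Conversely, comparing the coefficients of \<open>\<chi>\<^bsup>d + u\<^esup>\<close> at binomials of weight \<open>d\<close> shows that \<open>g\<close>
  and the degree \<open>u\<close> part of the given derivation differ by a linear form on the generators; in the gap
  this part has no coefficient.
\<close>

lemma euler_hom_mem_iff:
  fixes g :: "lattice \<Rightarrow> 'k::comm_ring_1"
  assumes g: "g \<in> additive_on S (shift_gap S u)"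
  shows "euler_hom w u (\<lambda>i. g (w i)) \<in> deriv_submodule S w \<longleftrightarrow>
    (\<exists>t. \<forall>x\<in>shift_gap S u. g x = linear_form t x)"
proof
  assume "\<exists>t. \<forall>x\<in>shift_gap S u. g x = linear_form t x"
  then obtain t where t: "\<And>x. x \<in> shift_gap S u \<Longrightarrow> g x = linear_form t x" by blast
  have "euler_hom w u (\<lambda>i. linear_form t (w i)) C = (0 :: 'k laurent)" for C
  proof (cases "C \<in> conormal_module w")
    case True
    then obtain f where f: "f \<in> toric_ideal w" "C = conormal_class w f" by (auto simp: conormal_module_def)
    have "twist w (exponent_pairing (\<lambda>i. linear_form t (w i))) f = 0"
    proof (rule poly_mapping_eqI)
      fix d show "Poly_Mapping.lookup (twist w (exponent_pairing (\<lambda>i. linear_form t (w i))) f) d =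
          Poly_Mapping.lookup 0 d"
        using twist_weight_eq_zero[OF f(1), of d "exponent_pairing (\<lambda>i. linear_form t (w i))" "linear_form t d"]
        by (simp add: linear_form_weight)
    qed
    with f show ?thesis by (simp add: euler_hom_class)
  qed (simp add: euler_hom_outside)
  then have "euler_hom w u (\<lambda>i. linear_form t (w i)) = (0 :: ('v, 'k) mpoly set \<Rightarrow> 'k laurent)"
    by (simp add: fun_eq_iff)
  then have "euler_hom w u (\<lambda>i. g (w i)) = euler_hom w u (\<lambda>i. g (w i) - linear_form t (w i))"
    using euler_hom_diff[of w u "\<lambda>i. g (w i)" "\<lambda>i. linear_form t (w i)"] by simp
  also have "\<dots> \<in> deriv_submodule S w"
    by (intro euler_hom_mem_deriv_submodule) (simp add: t)
  finally show "euler_hom w u (\<lambda>i. g (w i)) \<in> deriv_submodule S w" .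
next
  assume "euler_hom w u (\<lambda>i. g (w i)) \<in> deriv_submodule S w"
  then obtain b where b: "euler_hom w u (\<lambda>i. g (w i)) = (\<lambda>C. \<Sum>i\<in>UNIV. b i * deriv_hom w i C)"
    "\<And>i. Poly_Mapping.keys (b i) \<subseteq> S"
    by (auto simp: deriv_submodule_def monoid_algebra_def)
  define \<beta> where "\<beta> i = Poly_Mapping.lookup (b i) (w i + u)" for i
  have "exponent_pairing (\<lambda>i. g (w i) - \<beta> i) m = exponent_pairing (\<lambda>i. g (w i) - \<beta> i) n"
    if wt: "weight w m = weight w n" for m n
  proof -
    let ?f = "binomial m n :: ('v, 'k) mpoly"
    let ?d = "weight w m"
    have "Poly_Mapping.lookup (euler_hom w u (\<lambda>i. g (w i)) (conormal_class w ?f)) (?d + u) =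
        exponent_pairing (\<lambda>i. g (w i)) m - exponent_pairing (\<lambda>i. g (w i)) n"
      by (simp add: euler_hom_class binomial_toric wt lookup_single_mult twist_diff twist_single lookup_minus)
    moreover have "Poly_Mapping.lookup (b i * deriv_hom w i (conormal_class w ?f)) (?d + u) =
        (of_nat (Poly_Mapping.lookup m i) - of_nat (Poly_Mapping.lookup n i)) * \<beta> i" for i
    proof -
      have "presentation w (partial_deriv i ?f) =
          Poly_Mapping.single (?d - w i) (of_nat (Poly_Mapping.lookup m i) - of_nat (Poly_Mapping.lookup n i))"
        by (simp add: presentation_partial_deriv twist_diff twist_single wt right_diff_distrib mult_single single_diff)
      then show ?thesis
        by (simp add: deriv_hom_class binomial_toric wt lookup_mult_single \<beta>_def mult.commute algebra_simps)
    qed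
    then have "Poly_Mapping.lookup (\<Sum>i\<in>UNIV. b i * deriv_hom w i (conormal_class w ?f)) (?d + u) =
        exponent_pairing \<beta> m - exponent_pairing \<beta> n"
      by (simp add: lookup_sum exponent_pairing_def left_diff_distrib sum_subtractf)
    ultimately have "exponent_pairing (\<lambda>i. g (w i)) m - exponent_pairing (\<lambda>i. g (w i)) n =
        exponent_pairing \<beta> m - exponent_pairing \<beta> n"
      by (simp add: b(1))
    moreover have "x - x' = (x - y) - (x' - y') + (y - y')" for x x' y y' :: 'k
      by simp
    ultimately have "exponent_pairing (\<lambda>i. g (w i)) m - exponent_pairing \<beta> m =
        exponent_pairing (\<lambda>i. g (w i)) n - exponent_pairing \<beta> n"
      by (metis add_0 diff_self)
    then show ?thesis
      by (simp add: exponent_pairing_def right_diff_distrib sum_subtractf)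
  qed
  then have "\<exists>t. \<forall>m. exponent_pairing (\<lambda>i. g (w i) - \<beta> i) m = linear_form t (weight w m)"
    by (rule exponent_pairing_linear)
  then obtain t where t: "\<And>m. exponent_pairing (\<lambda>i. g (w i) - \<beta> i) m = linear_form t (weight w m)"
    by blast
  have "g x = linear_form t x" if x: "x \<in> shift_gap S u" for x
  proof -
    obtain m where m: "x = weight w m" using x by (auto simp: shift_gap_def mem_iff)
    have "of_nat (Poly_Mapping.lookup m i) * \<beta> i = 0" for i
    proof (cases "Poly_Mapping.lookup m i = 0")
      case False
      then have "m = Poly_Mapping.single i 1 + (m - Poly_Mapping.single i 1)"
        by (intro poly_mapping_eqI) (auto simp: lookup_add lookup_minus lookup_single "when_def")
      then have "x = w i + weight w (m - Poly_Mapping.single i 1)"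
        unfolding m by (metis weight_add weight_single of_nat_1 zscale_simps(2))
      then have "w i \<in> shift_gap S u"
        using shift_gap_down[OF generator_mem weight_mem] x by metis
      then have "\<beta> i = 0" using b(2)[of i] by (auto simp: \<beta>_def shift_gap_def in_keys_iff)
      then show ?thesis by simp
    qed simp
    then have "exponent_pairing (\<lambda>i. g (w i) - \<beta> i) m = exponent_pairing (\<lambda>i. g (w i)) m"
      by (simp add: exponent_pairing_def right_diff_distrib)
    with t[of m] additive_on_weight[OF g, of m] x m show ?thesis by simp
  qed
  then show "\<exists>t. \<forall>x\<in>shift_gap S u. g x = linear_form t x" by blast
qed

text \<open>
  The component of \<open>T\<^sup>1\<close> of degree \<open>u\<close> is the space of additive functions on the gap modulo linear
  forms; here this is stated for a family \<open>G\<close> which is a basis of the latter quotient.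
\<close>

theorem T1_dim_eq_card_basis:
  fixes G :: "'p \<Rightarrow> lattice \<Rightarrow> 'k::field"
  assumes P: "finite P" "\<And>p. p \<in> P \<Longrightarrow> G p \<in> additive_on S (shift_gap S u)"
    and spanning: "\<And>g. g \<in> additive_on S (shift_gap S u) \<Longrightarrow>
      \<exists>c t. \<forall>x\<in>shift_gap S u. g x = (\<Sum>p\<in>P. c p * G p x) + linear_form t x"
    and indep: "\<And>c t. \<forall>x\<in>shift_gap S u. (\<Sum>p\<in>P. c p * G p x) = linear_form t x \<Longrightarrow> \<forall>p\<in>P. c p = 0"
  shows "T1_dim TYPE('k) S w u = enat (card P)"
proof -
  interpret quotient_space hom_scale "deriv_submodule S w :: (('v, 'k) mpoly set \<Rightarrow> _) set"
    by (rule quotient_space_deriv_submodule[OF zero_mem])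
  let ?b = "\<lambda>p. euler_hom w u (\<lambda>i. G p (w i))"
  have sum: "(\<Sum>p\<in>P. hom_scale (c p) (?b p)) = euler_hom w u (\<lambda>i. \<Sum>p\<in>P. c p * G p (w i))" for c
    by (rule euler_hom_sum)
  have sum_additive: "(\<lambda>x. \<Sum>p\<in>P. c p * G p x) \<in> additive_on S (shift_gap S u)" for c
    using P(2) by (rule additive_on_sum)
  show ?thesis
    unfolding T1_dim_def
  proof (rule dim_modulo_eq_card)
    show "finite P" by fact
    show "?b p \<in> normal_hom_degree S w u" if "p \<in> P" for p
      using P(2)[OF that] by (rule euler_hom_normal)
    fix \<phi> :: "('v, 'k) mpoly set \<Rightarrow> 'k laurent"
    assume "\<phi> \<in> normal_hom_degree S w u"
    then obtain g where g: "g \<in> additive_on S (shift_gap S u)"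
      "\<phi> - euler_hom w u (\<lambda>i. g (w i)) \<in> deriv_submodule S w"
      by (rule normal_hom_mod_deriv)
    obtain c t where ct: "\<And>x. x \<in> shift_gap S u \<Longrightarrow> g x = (\<Sum>p\<in>P. c p * G p x) + linear_form t x"
      using spanning[OF g(1)] by blast
    have "euler_hom w u (\<lambda>i. g (w i) - (\<Sum>p\<in>P. c p * G p (w i))) \<in> deriv_submodule S w"
      using euler_hom_mem_iff[OF additive_on_diff[OF g(1) sum_additive[of c]]] ct by auto
    then have "\<phi> - euler_hom w u (\<lambda>i. g (w i)) +
        (euler_hom w u (\<lambda>i. g (w i)) - (\<Sum>p\<in>P. hom_scale (c p) (?b p))) \<in> deriv_submodule S w"
      using add_mem[OF g(2)] by (simp add: sum euler_hom_diff)
    then show "\<exists>c. \<phi> - (\<Sum>p\<in>P. hom_scale (c p) (?b p)) \<in> deriv_submodule S w"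
      by (intro exI[of _ c]) simp
  next
    fix c assume "(\<Sum>p\<in>P. hom_scale (c p) (?b p)) \<in> deriv_submodule S w"
    then show "\<forall>p\<in>P. c p = 0"
      using euler_hom_mem_iff[OF sum_additive[of c]] indep[of c] by (auto simp: sum)
  qed
qed

corollary T1_dim_eq_zero:
  assumes "\<And>g :: lattice \<Rightarrow> 'k::field. g \<in> additive_on S (shift_gap S u) \<Longrightarrow>
    \<exists>t. \<forall>x\<in>shift_gap S u. g x = linear_form t x"
  shows "T1_dim TYPE('k) S w u = 0"
  using T1_dim_eq_card_basis[of "{}" "\<lambda>_ _. 0 :: 'k" u] assms by (simp add: zero_enat_def)

text \<open>
  The form in which dimensions are computed. Linear forms can be prescribed freely at the independent
  points \<open>x\<close> and \<open>y\<close>, so the quotient is represented by the functions vanishing there; the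
  values at the points of \<open>P\<close> are coordinates on these functions.
\<close>

theorem T1_dim_eq_card:
  fixes u x y :: lattice
  defines "K \<equiv> shift_gap S u"
  assumes xy: "x \<in> K" "y \<in> K" "fst x * snd y \<noteq> snd x * fst y"
    and P: "finite P" "P \<subseteq> K"
    and determined: "\<And>g :: lattice \<Rightarrow> 'k::field_char_0. g \<in> additive_on S K \<Longrightarrow> g x = 0 \<Longrightarrow> g y = 0 \<Longrightarrow>
      \<forall>p\<in>P. g p = 0 \<Longrightarrow> \<forall>z\<in>K. g z = 0"
    and free: "\<And>p. p \<in> P \<Longrightarrow> \<exists>g :: lattice \<Rightarrow> 'k. g \<in> additive_on S K \<and> g x = 0 \<and> g y = 0 \<and> g p = 1 \<and>
      (\<forall>q\<in>P - {p}. g q = 0)"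
  shows "T1_dim TYPE('k) S w u = enat (card P)"
proof -
  obtain G :: "lattice \<Rightarrow> lattice \<Rightarrow> 'k" where G: "\<And>p. p \<in> P \<Longrightarrow> G p \<in> additive_on S K \<and> G p x = 0 \<and> G p y = 0 \<and> G p p = 1 \<and>
      (\<forall>q\<in>P - {p}. G p q = 0)"
    using free by metis
  have eval: "(\<Sum>p\<in>P. c p * G p q) = c q" if "q \<in> P" for c q
  proof -
    have "(\<Sum>p\<in>P. c p * G p q) = (\<Sum>p\<in>P. if p = q then c p else 0)"
      using G that by (intro sum.cong) auto
    then show ?thesis using that P(1) by simp
  qed
  have zero: "(\<Sum>p\<in>P. c p * G p x) = 0" "(\<Sum>p\<in>P. c p * G p y) = 0" for c
    using G by (auto intro: sum.neutral)
  show ?thesis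
  proof (rule T1_dim_eq_card_basis)
    show "finite P" by fact
    show "G p \<in> additive_on S (shift_gap S u)" if "p \<in> P" for p using G[OF that] by (simp add: K_def)
  next
    fix g :: "lattice \<Rightarrow> 'k" assume g: "g \<in> additive_on S (shift_gap S u)"
    obtain t where t: "linear_form t x = g x" "linear_form t y = g y"
      using linear_form_exists[OF xy(3)] by blast
    define c where "c p = g p - linear_form t p" for p
    define h where "h z = g z - (\<Sum>p\<in>P. c p * G p z) - (if z \<in> K then linear_form t z else 0)" for z
    have "h \<in> additive_on S K"
      unfolding h_def using g G shift_gap_down unfolding K_def
      by (intro additive_on_diff additive_on_sum additive_on_restrict_linear_form) auto
    moreover have "h x = 0" "h y = 0" using xy t zero by (auto simp: h_def)
    moreover have "\<forall>p\<in>P. h p = 0" using P(2) by (auto simp: h_def eval c_def)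
    ultimately have "\<forall>z\<in>K. h z = 0" by (rule determined)
    then show "\<exists>c t. \<forall>z\<in>shift_gap S u. g z = (\<Sum>p\<in>P. c p * G p z) + linear_form t z"
      by (intro exI[of _ c] exI[of _ t]) (auto simp: h_def K_def algebra_simps)
  next
    fix c t assume eq: "\<forall>z\<in>shift_gap S u. (\<Sum>p\<in>P. c p * G p z) = linear_form t z"
    then have "linear_form t x = 0" "linear_form t y = 0"
      using xy zero by (metis K_def)+
    then have t: "linear_form t z = 0" for z by (rule linear_form_eq_zero[OF xy(3)])
    show "\<forall>p\<in>P. c p = 0"
    proof
      fix p assume p: "p \<in> P"
      then have "p \<in> shift_gap S u" using P(2) by (auto simp: K_def)
      from bspec[OF eq this] have "(\<Sum>q\<in>P. c q * G q p) = 0" by (simp add: t)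
      with eval[OF p] show "c p = 0" by simp
    qed
  qed
qed

end


section \<open>Monoids between two axes\<close>

lemma pairing_add [simp]: "pairing (x + y) v = pairing x v + pairing y v"
  and pairing_diff [simp]: "pairing (x - y) v = pairing x v - pairing y v"
  and pairing_zero [simp]: "pairing 0 v = 0"
  by (simp_all add: pairing_def algebra_simps)

lemma pairing_zscale [simp]: "pairing (n \<cdot> x) v = n * pairing x v"
  by (simp add: pairing_def algebra_simps)

text \<open>
  The seminormal monoids: interior points are free, and on each ray only the multiples of the covering
  index are present. With both indices \<open>1\<close> this is the normalisation (\<open>mem_normal_iff\<close>).
\<close>

definition axis_monoid :: "lattice \<Rightarrow> lattice \<Rightarrow> lattice \<Rightarrow> lattice \<Rightarrow> int \<Rightarrow> int \<Rightarrow> lattice set"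
  where "axis_monoid v1 v2 e1 e2 l1 l2 = {x. 0 < pairing x v1 \<and> 0 < pairing x v2} \<union>
    {(n * l1) \<cdot> e1 | n. 0 \<le> n} \<union> {(n * l2) \<cdot> e2 | n. 0 \<le> n}"

lemma axis_monoid_swap: "axis_monoid v2 v1 e2 e1 l2 l1 = axis_monoid v1 v2 e1 e2 l1 l2"
  by (auto simp: axis_monoid_def)

text \<open>
  The points of \<open>S\<close> which stay outside \<open>R + S\<close> because of the ray \<open>v\<close>. The whole progression
  \<open>R + \<int> l e\<close> is removed, although only half of it lies in \<open>R + S\<close>: this makes the strip invariant under
  translation by \<open>l e\<close>, and the points of \<open>S\<close> in the other half belong to the strip of the second ray.
\<close>

definition strip :: "lattice set \<Rightarrow> lattice \<Rightarrow> lattice \<Rightarrow> int \<Rightarrow> lattice \<Rightarrow> lattice set"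
  where "strip S v e l R = {s \<in> S. pairing s v \<le> pairing R v \<and> (\<forall>j. s \<noteq> R + (j * l) \<cdot> e)}"

text \<open>
  Coordinates adapted to the two rays. The edges of the dual cone are spanned by \<open>e1\<close> and \<open>e2\<close>, which
  generate a subgroup of index \<open>D\<close>. On the line of height one over the edge of \<open>e1\<close>, \<open>p1\<close> is the
  last lattice point that does not pair positively with \<open>v2\<close>; it is the point number \<open>0\<close>.
\<close>

locale cone_frame =
  fixes v1 v2 e1 e2 :: lattice and D :: int and p1 p2 :: lattice
  assumes D_pos: "0 < D"
    and e1: "pairing e1 v1 = 0" "pairing e1 v2 = D"
    and e2: "pairing e2 v2 = 0" "pairing e2 v1 = D"
    and p1: "pairing p1 v1 = 1" "- D < pairing p1 v2" "pairing p1 v2 \<le> 0"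
    and p2: "pairing p2 v2 = 1" "- D < pairing p2 v1" "pairing p2 v1 \<le> 0"
    and basis1: "\<exists>n. x = pairing x v1 \<cdot> p1 + n \<cdot> e1"
    and basis2: "\<exists>n. x = pairing x v2 \<cdot> p2 + n \<cdot> e2"
begin

lemma frame_swap: "cone_frame v2 v1 e2 e1 D p2 p1"
  by unfold_locales (simp_all add: D_pos e1 e2 p1 p2 basis1 basis2)

lemma coords_eqI:
  assumes "pairing x v1 = pairing y v1" "pairing x v2 = pairing y v2"
  shows "x = y"
proof -
  obtain n where n: "x - y = pairing (x - y) v1 \<cdot> p1 + n \<cdot> e1" using basis1 by blast
  then have "x - y = n \<cdot> e1" using assms(1) by simp
  moreover from this have "pairing (x - y) v2 = n * D" using e1(2) by (simp only: pairing_zscale)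
  then have "n = 0" using D_pos assms(2) by simp
  ultimately show ?thesis by simp
qed

lemma coords_eq_iff: "x = y \<longleftrightarrow> pairing x v1 = pairing y v1 \<and> pairing x v2 = pairing y v2"
  using coords_eqI by blast

lemma independentI:
  assumes "pairing x v1 * pairing y v2 \<noteq> pairing x v2 * pairing y v1"
  shows "fst x * snd y \<noteq> snd x * fst y"
proof -
  have "pairing x v1 * pairing y v2 - pairing x v2 * pairing y v1 =
      (fst x * snd y - snd x * fst y) * (fst v1 * snd v2 - snd v1 * fst v2)"
    by (simp add: pairing_def algebra_simps)
  with assms show ?thesis by auto
qed

end

text \<open>
  The two cases are the normalisation and the seminormal monoids under consideration. Covering index
  \<open>2\<close> must be left out: additive functions on wide strips need not be linear then.
\<close>

locale cone_monoid = cone_frame +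
  fixes l1 l2 :: int
  assumes indices: "l1 = 1 \<and> l2 = 1 \<or> 3 \<le> l1 \<and> 3 \<le> l2"
begin

abbreviation "S \<equiv> axis_monoid v1 v2 e1 e2 l1 l2"
abbreviation "K1 \<equiv> strip S v1 e1 l1"
abbreviation "K2 \<equiv> strip S v2 e2 l2"
abbreviation "q n \<equiv> p1 + n \<cdot> e1"

lemma l_pos: "0 < l1" "0 < l2" using indices by auto

lemma monoid_swap: "cone_monoid v2 v1 e2 e1 D p2 p1 l2 l1"
  using frame_swap indices by (auto simp: cone_monoid_def cone_monoid_axioms_def)

lemma mem_cases [consumes 1, case_names interior ray1 ray2]:
  assumes "x \<in> S"
  obtains "0 < pairing x v1" "0 < pairing x v2"
  | n where "0 \<le> n" "x = (n * l1) \<cdot> e1" "pairing x v1 = 0" "pairing x v2 = n * l1 * D"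
  | n where "0 \<le> n" "x = (n * l2) \<cdot> e2" "pairing x v2 = 0" "pairing x v1 = n * l2 * D"
  using assms by (auto simp: axis_monoid_def e1 e2)

lemma mem_nonneg: "x \<in> S \<Longrightarrow> 0 \<le> pairing x v1 \<and> 0 \<le> pairing x v2"
  using D_pos l_pos by (elim mem_cases) auto

lemma interior_mem: "0 < pairing x v1 \<Longrightarrow> 0 < pairing x v2 \<Longrightarrow> x \<in> S"
  by (simp add: axis_monoid_def)

lemma ray1_mem: "0 \<le> n \<Longrightarrow> (n * l1) \<cdot> e1 \<in> S"
  by (auto simp: axis_monoid_def)

lemma mem_ray1:
  assumes "x \<in> S" "pairing x v1 = 0"
  obtains n where "0 \<le> n" "x = (n * l1) \<cdot> e1"
  using assms(1)
proof (cases rule: mem_cases)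
  case (ray2 n)
  from ray2(4) assms(2) have "n * l2 * D = 0" by (simp only:)
  then have "n = 0" using D_pos l_pos by simp
  with ray2 that[of 0] show ?thesis by simp
qed (use assms that in auto)

text \<open>
  A summand on the removed progression has the full height \<open>\<langle>R, v1\<rangle>\<close>, so the other summand has height
  zero, is a multiple of \<open>l1 e1\<close>, and does not leave the progression.
\<close>

lemma strip1_down:
  assumes "a \<in> S" "b \<in> S" "a + b \<in> K1 R"
  shows "a \<in> K1 R \<and> b \<in> K1 R"
proof -
  have *: "a \<in> K1 R" if "a \<in> S" "b \<in> S" "a + b \<in> K1 R" for a b
  proof -
    have "a \<noteq> R + (j * l1) \<cdot> e1" for j
    proof
      assume a: "a = R + (j * l1) \<cdot> e1"
      then have "pairing b v1 = 0"
        using that mem_nonneg[of b] by (auto simp: strip_def e1)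
      from mem_ray1[OF that(2) this] obtain n where "b = (n * l1) \<cdot> e1" by blast
      with a have "a + b = R + ((j + n) * l1) \<cdot> e1"
        by (simp add: distrib_right zscale_add_left add_ac)
      with that(3) show False by (auto simp: strip_def)
    qed
    with that mem_nonneg[of b] show ?thesis by (auto simp: strip_def)
  qed
  show ?thesis using *[of a b] *[of b a] assms by (simp add: add.commute)
qed

lemma strip1_subset_gap: "K1 R \<subseteq> shift_gap S (- R)"
proof
  fix s assume s: "s \<in> K1 R"
  have "s - R \<notin> S"
  proof
    assume m: "s - R \<in> S"
    with s mem_nonneg[of "s - R"] have "pairing (s - R) v1 = 0" by (auto simp: strip_def)
    then obtain n where "s - R = (n * l1) \<cdot> e1" using m mem_ray1 by blast
    then have "s = R + (n * l1) \<cdot> e1" by (simp add: diff_eq_eq add.commute)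
    with s show False by (auto simp: strip_def)
  qed
  with s show "s \<in> shift_gap S (- R)" by (auto simp: shift_gap_def strip_def)
qed

text \<open>
  A point \<open>R + j l1 e1\<close> of \<open>S\<close> outside \<open>R + S\<close> has \<open>j < 0\<close>, so it pairs with \<open>v2\<close> less than \<open>R\<close> does.
\<close>

lemma gap_cases1:
  assumes "s \<in> S" "s - R \<notin> S" "pairing s v1 \<le> pairing R v1"
  shows "s \<in> K1 R \<union> K2 R"
proof (cases "s \<in> K1 R")
  case False
  then obtain j where j: "s = R + (j * l1) \<cdot> e1" using assms by (auto simp: strip_def)
  have "j < 0"
  proof (rule ccontr)
    assume "\<not> j < 0"
    then have "s - R \<in> S" using ray1_mem[of j] j by simp
    with assms(2) show False by simp
  qed
  then have "pairing s v2 < pairing R v2"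
    using j D_pos l_pos by (simp add: e1 mult_neg_pos)
  then have "s \<in> K2 R" using assms(1) by (auto simp: strip_def e2)
  then show ?thesis by simp
qed simp

end

context cone_monoid
begin

interpretation sw: cone_monoid v2 v1 e2 e1 D p2 p1 l2 l1 by (rule monoid_swap)

lemma S_swap: "axis_monoid v2 v1 e2 e1 l2 l1 = S"
  by (rule axis_monoid_swap)

lemma strip2_down: "a \<in> S \<Longrightarrow> b \<in> S \<Longrightarrow> a + b \<in> K2 R \<Longrightarrow> a \<in> K2 R \<and> b \<in> K2 R"
  using sw.strip1_down[of a b R] by (simp add: S_swap)

lemma gap_eq: "shift_gap S (- R) = K1 R \<union> K2 R"
proof
  show "K1 R \<union> K2 R \<subseteq> shift_gap S (- R)"
    using strip1_subset_gap[of R] sw.strip1_subset_gap[of R] by (simp add: S_swap)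
  show "shift_gap S (- R) \<subseteq> K1 R \<union> K2 R"
  proof
    fix s assume "s \<in> shift_gap S (- R)"
    then have s: "s \<in> S" "s - R \<notin> S" by (auto simp: shift_gap_def)
    have "\<not> (0 < pairing (s - R) v1 \<and> 0 < pairing (s - R) v2)"
      using interior_mem s(2) by blast
    then have "pairing s v1 \<le> pairing R v1 \<or> pairing s v2 \<le> pairing R v2" by auto
    then show "s \<in> K1 R \<union> K2 R"
      using gap_cases1[OF s] sw.gap_cases1[of s R] s unfolding S_swap by blast
  qed
qed

lemma restrict_additive:
  assumes "g \<in> additive_on S (shift_gap S (- R))"
  shows "(\<lambda>x. if x \<in> K1 R then g x else 0) \<in> additive_on S (K1 R)"
  using assms strip1_down[of _ _ R] unfolding gap_eq additive_on_def by auto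

text \<open>
  Both strips are closed under summands, so a function that vanishes on the intersection can be
  extended by zero.
\<close>

lemma glue_additive:
  assumes h: "h \<in> additive_on S (K1 R)" and zero: "\<forall>x\<in>K1 R \<inter> K2 R. h x = 0"
  shows "h \<in> additive_on S (shift_gap S (- R))" "x \<in> K2 R \<Longrightarrow> h x = 0"
proof -
  show K2: "h x = 0" if "x \<in> K2 R" for x
    using additive_onD(1)[OF h, of x] zero that by blast
  have "h (a + b) = h a + h b" if "a \<in> S" "b \<in> S" "a + b \<in> K1 R \<union> K2 R" for a b
    using that(3)
  proof
    assume "a + b \<in> K2 R"
    with strip2_down[OF that(1,2)] K2[of a] K2[of b] K2[of "a + b"] show ?thesis by simp
  qed (rule additive_onD(2)[OF h that(1,2)])
  then show "h \<in> additive_on S (shift_gap S (- R))"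
    unfolding gap_eq additive_on_def using additive_onD(1)[OF h] by auto
qed

section \<open>Strips of width at least two\<close>

lemma additive_ray1:
  assumes g: "g \<in> additive_on S K" and down: "\<And>a b. a \<in> S \<Longrightarrow> b \<in> S \<Longrightarrow> a + b \<in> K \<Longrightarrow> a \<in> K \<and> b \<in> K"
    and "0 \<le> n" "(n * l1) \<cdot> e1 \<in> K"
  shows "g ((n * l1) \<cdot> e1) = of_int n * g (l1 \<cdot> e1)"
  using assms(3,4)
proof (induction n rule: int_ge_induct)
  case base
  then show ?case using additive_onD(2)[OF g, of 0 0] ray1_mem[of 0] by simp
next
  case (step n)
  have eq: "((n + 1) * l1) \<cdot> e1 = (n * l1) \<cdot> e1 + l1 \<cdot> e1"
    by (simp add: distrib_right zscale_add_left)
  have mem: "(n * l1) \<cdot> e1 \<in> S" "l1 \<cdot> e1 \<in> S"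
    using ray1_mem[of n] ray1_mem[of 1] step by auto
  from step show ?case
    using additive_onD(2)[OF g mem] down[OF mem] unfolding eq by (auto simp: distrib_right)
qed

lemma q_pos: "1 \<le> n \<Longrightarrow> 0 < pairing (q n) v2"
proof -
  assume "1 \<le> n"
  then have "D \<le> n * D" using mult_right_mono[of 1 n D] D_pos by simp
  moreover have "pairing (q n) v2 = pairing p1 v2 + n * D" by (simp add: e1)
  ultimately show "0 < pairing (q n) v2" using p1(2) by linarith
qed

lemma q_mem: "1 \<le> n \<Longrightarrow> q n \<in> S"
  by (rule interior_mem[OF _ q_pos]) (simp_all add: p1 e1)

lemma q_strip1: "1 \<le> n \<Longrightarrow> 1 < pairing R v1 \<Longrightarrow> q n \<in> K1 R"
  using q_mem[of n] by (auto simp: strip_def p1 e1 coords_eq_iff)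

lemma strip1_translate:
  assumes "x \<in> K1 R" "0 < pairing x v1" "0 < pairing (x + (n * l1) \<cdot> e1) v2"
  shows "x + (n * l1) \<cdot> e1 \<in> K1 R"
proof -
  have "x + (n * l1) \<cdot> e1 \<noteq> R + (j * l1) \<cdot> e1" for j
  proof
    assume "x + (n * l1) \<cdot> e1 = R + (j * l1) \<cdot> e1"
    then have "x = R + ((j - n) * l1) \<cdot> e1" by (simp add: coords_eq_iff algebra_simps)
    with assms(1) show False by (auto simp: strip_def)
  qed
  moreover have "x + (n * l1) \<cdot> e1 \<in> S" using assms by (intro interior_mem) (simp_all add: e1)
  ultimately show ?thesis using assms by (simp add: strip_def e1)
qed

lemma ray1_strip1: "0 \<le> n \<Longrightarrow> 0 < pairing R v1 \<Longrightarrow> (n * l1) \<cdot> e1 \<in> K1 R"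
  using ray1_mem[of n] by (auto simp: strip_def coords_eq_iff e1)

lemma translate_invariant:
  assumes g: "g \<in> additive_on S (K1 R)" and R: "0 < pairing R v1" and "g (l1 \<cdot> e1) = 0"
    and x: "x \<in> S" "0 \<le> n" "x + (n * l1) \<cdot> e1 \<in> K1 R"
  shows "g (x + (n * l1) \<cdot> e1) = g x"
  using additive_onD(2)[OF g x(1) ray1_mem[OF x(2)] x(3)]
    additive_ray1[OF g strip1_down x(2) ray1_strip1[OF x(2) R]] assms(3) by simp

text \<open>
  The values \<open>g (q n)\<close> are periodic modulo \<open>l1\<close>. The sum of \<open>q (a + 1)\<close> and \<open>q b\<close> is also the sum of \<open>q a\<close>
  and \<open>q (b + 1)\<close>, and it lies in the strip unless \<open>a + b + 1\<close> belongs to one particular class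
  modulo \<open>l1\<close>. So the increments of \<open>g\<close> at \<open>a\<close> and at \<open>b\<close> agree outside this class. For
  \<open>l1 \<ge> 3\<close> any two increments agree with a common third one, all increments are equal, and by
  periodicity they vanish. For \<open>l1 = 1\<close> periodicity is enough.
\<close>

lemma strip1_first_line_vanish:
  fixes g :: "lattice \<Rightarrow> 'k::field_char_0"
  assumes g: "g \<in> additive_on S (K1 R)" and R: "2 \<le> pairing R v1"
    and zero: "g (l1 \<cdot> e1) = 0" "g (q 1) = 0" and "1 \<le> n"
  shows "g (q n) = 0"
proof -
  have line1: "q n \<in> K1 R" if "1 \<le> n" for n
    using q_strip1[OF that, of R] R by simp
  have period: "g (q (n + l1)) = g (q n)" if "1 \<le> n" for n
  proof -
    have eq: "q (n + l1) = q n + (1 * l1) \<cdot> e1" by (simp add: zscale_add_left add_ac)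
    have "q (n + l1) \<in> K1 R" using that l_pos by (intro line1) simp
    then show ?thesis
      unfolding eq by (intro translate_invariant[OF g _ zero(1) q_mem[OF that]]) (use R in auto)
  qed
  show ?thesis
  proof (cases "l1 = 1")
    case True
    from \<open>1 \<le> n\<close> show ?thesis
      by (induction n rule: int_ge_induct) (use zero(2) period True in auto)
  next
    case False
    then have l1: "3 \<le> l1" using indices by auto
    obtain N where N: "R = pairing R v1 \<cdot> p1 + N \<cdot> e1" using basis1 by blast
    have line2: "q a + q b \<in> K1 R" if "1 \<le> a" "1 \<le> b" "\<not> l1 dvd (a + b - N)" for a b
    proof -
      have "q a + q b \<noteq> R + (j * l1) \<cdot> e1" for j
      proof
        assume eq: "q a + q b = R + (j * l1) \<cdot> e1"
        from arg_cong[OF eq, of "\<lambda>x. pairing x v1"] have R2: "pairing R v1 = 2" by (simp add: p1 e1)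
        from N have "pairing R v2 = pairing (pairing R v1 \<cdot> p1 + N \<cdot> e1) v2" by simp
        then have "pairing R v2 = 2 * pairing p1 v2 + N * D" by (simp add: e1 R2)
        with arg_cong[OF eq, of "\<lambda>x. pairing x v2"]
        have "(a + b - N) * D = (j * l1) * D" by (simp add: e1 algebra_simps)
        with D_pos have "a + b - N = j * l1" by simp
        with that(3) show False by simp
      qed
      moreover have "q a + q b \<in> S"
        using add_pos_pos[OF q_pos[OF that(1)] q_pos[OF that(2)]]
        by (intro interior_mem) (simp_all only: pairing_add[of "q a"], simp add: p1 e1)
      ultimately show ?thesis using R by (simp add: strip_def p1 e1)
    qed
    define \<delta> where "\<delta> n = g (q (n + 1)) - g (q n)" for n
    have \<delta>_eq: "\<delta> a = \<delta> b" if "1 \<le> a" "1 \<le> b" "\<not> l1 dvd (a + b + 1 - N)" for a b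
    proof -
      have eq: "q (a + 1) + q b = q a + q (b + 1)" by (simp add: zscale_add_left add_ac)
      have "q (a + 1) + q b \<in> K1 R" using that by (intro line2) (auto simp: algebra_simps)
      then have "g (q (a + 1)) + g (q b) = g (q a) + g (q (b + 1))"
        using additive_onD(2)[OF g q_mem[of "a + 1"] q_mem[of b]]
          additive_onD(2)[OF g q_mem[of a] q_mem[of "b + 1"]] that eq by auto
      then show ?thesis by (simp add: \<delta>_def algebra_simps)
    qed
    \<comment> \<open>Of three consecutive integers at most one is divisible by \<open>l1\<close>. So among three values of \<open>t\<close> one is
      excluded neither by \<open>n\<close> nor by \<open>1\<close>.\<close>
    have dvd: "\<not> (l1 dvd x \<and> l1 dvd (x + 1))" "\<not> (l1 dvd x \<and> l1 dvd (x + 2))" for x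
    proof -
      have "\<not> l1 dvd 1" "\<not> l1 dvd 2" using l1 zdvd_imp_le[of l1 1] zdvd_imp_le[of l1 2] by auto
      then show "\<not> (l1 dvd x \<and> l1 dvd (x + 1))" "\<not> (l1 dvd x \<and> l1 dvd (x + 2))"
        using dvd_diff[of l1 "x + 1" x] dvd_diff[of l1 "x + 2" x] by auto
    qed
    have \<delta>_const: "\<delta> n = \<delta> 1" if "1 \<le> n" for n
    proof -
      have "\<exists>t\<in>{1, 2, 3}. \<not> l1 dvd (n + t + 1 - N) \<and> \<not> l1 dvd (1 + t + 1 - N)"
        using dvd[of "n + 1 + 1 - N"] dvd[of "n + 2 + 1 - N"] dvd[of "1 + 1 + 1 - N"] dvd[of "1 + 2 + 1 - N"]
        by (auto simp: algebra_simps)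
      then obtain t where t: "t \<in> {1, 2, 3}" "\<not> l1 dvd (n + t + 1 - N)" "\<not> l1 dvd (1 + t + 1 - N)" by blast
      from t(1) have "1 \<le> t" by auto
      with t(2,3) show ?thesis using \<delta>_eq[of n t] \<delta>_eq[of 1 t] that by simp
    qed
    have affine: "g (q n) = of_int (n - 1) * \<delta> 1" if "1 \<le> n" for n
      using that
    proof (induction n rule: int_ge_induct)
      case (step n)
      have "g (q (n + 1)) = g (q n) + \<delta> n" by (simp add: \<delta>_def)
      also have "\<dots> = of_int (n + 1 - 1) * \<delta> 1"
        using step \<delta>_const[of n] by (simp add: algebra_simps)
      finally show ?case .
    qed (use zero in simp)
    have "of_int l1 * \<delta> 1 = 0"
      using affine[of "1 + l1"] period[of 1] zero l1 by simp
    then have "\<delta> 1 = 0" using l1 by simp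
    with affine[OF \<open>1 \<le> n\<close>] show ?thesis by simp
  qed
qed

text \<open>
  Translation along the ray does not change \<open>g\<close>, and far out on the line of height \<open>j\<close> every point is a
  sum of \<open>j\<close> points of height one.
\<close>

lemma strip1_vanish:
  fixes g :: "lattice \<Rightarrow> 'k::field_char_0"
  assumes g: "g \<in> additive_on S (K1 R)" and R: "2 \<le> pairing R v1"
    and zero: "g (l1 \<cdot> e1) = 0" "g (q 1) = 0" and x: "x \<in> K1 R"
  shows "g x = 0"
proof -
  have line: "g (int (Suc j) \<cdot> p1 + n \<cdot> e1) = 0"
    if "int (Suc j) \<cdot> p1 + n \<cdot> e1 \<in> K1 R" "int (Suc j) \<le> n" for j n
    using that
  proof (induction j arbitrary: n)
    case 0
    then show ?case using strip1_first_line_vanish[OF g R zero, of n] by simp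
  next
    case (Suc j)
    let ?y = "int (Suc j) \<cdot> p1 + (n - 1) \<cdot> e1"
    have eq: "int (Suc (Suc j)) \<cdot> p1 + n \<cdot> e1 = ?y + q 1"
      by (simp add: coords_eq_iff algebra_simps)
    have "int (Suc j) * (pairing p1 v2 + D) \<le> int (Suc j) * pairing p1 v2 + (n - 1) * D"
      using Suc.prems(2) D_pos by (simp add: distrib_left mult_right_mono)
    moreover have "0 < int (Suc j) * (pairing p1 v2 + D)" using p1 by (intro mult_pos_pos) auto
    ultimately have "?y \<in> S" by (intro interior_mem) (simp_all add: p1 e1)
    then have "?y \<in> K1 R" "g (?y + q 1) = g ?y + g (q 1)"
      using Suc.prems(1) strip1_down[of ?y "q 1" R] additive_onD(2)[OF g, of ?y "q 1"] q_mem[of 1]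
      unfolding eq by auto
    moreover have "g ?y = 0" using \<open>?y \<in> K1 R\<close> Suc.prems(2) by (intro Suc.IH) auto
    ultimately show ?case unfolding eq using zero(2) by simp
  qed
  have xS: "x \<in> S" using x by (simp add: strip_def)
  show ?thesis
  proof (cases "pairing x v1 = 0")
    case True
    then obtain n where n: "0 \<le> n" "x = (n * l1) \<cdot> e1" using xS mem_ray1 by blast
    then show ?thesis using additive_ray1[OF g strip1_down n(1)] x zero by simp
  next
    case False
    then obtain j where j: "pairing x v1 = int (Suc j)"
      using mem_nonneg[OF xS] by (metis nonneg_int_cases of_nat_0 not0_implies_Suc)
    obtain n where n: "x = pairing x v1 \<cdot> p1 + n \<cdot> e1" using basis1 by blast
    define M where "M = \<bar>n\<bar> + int (Suc j)"
    have M: "0 \<le> M" "int (Suc j) \<le> n + M * l1"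
    proof -
      show "0 \<le> M" by (simp add: M_def)
      then have "M * 1 \<le> M * l1" using l_pos by (intro mult_left_mono) auto
      then show "int (Suc j) \<le> n + M * l1" by (simp add: M_def)
    qed
    have eq: "x + (M * l1) \<cdot> e1 = int (Suc j) \<cdot> p1 + (n + M * l1) \<cdot> e1"
      using n j by (metis add.assoc zscale_add_left)
    have "int (Suc j) * (pairing p1 v2 + D) \<le> int (Suc j) * pairing p1 v2 + (n + M * l1) * D"
      using M(2) D_pos by (simp only: distrib_left) (intro add_left_mono mult_right_mono, auto)
    moreover have "0 < int (Suc j) * (pairing p1 v2 + D)" using p1 by (intro mult_pos_pos) auto
    ultimately have "0 < pairing (x + (M * l1) \<cdot> e1) v2"
      unfolding eq by (simp add: e1)
    then have y: "x + (M * l1) \<cdot> e1 \<in> K1 R" using strip1_translate[OF x] j by simp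
    have "g x = g (x + (M * l1) \<cdot> e1)"
      using translate_invariant[OF g _ zero(1) xS M(1) y] R by simp
    also have "\<dots> = 0" using line[of j "n + M * l1"] y M(2) unfolding eq by simp
    finally show ?thesis .
  qed
qed

end


section \<open>Gluing two strips\<close>

text \<open>
  The values at the points of \<open>P\<close> are coordinates on the space of those additive functions on \<open>K\<close> which
  vanish on \<open>Z\<close>.
\<close>

definition evaluation_basis ::
    "'k::comm_ring_1 itself \<Rightarrow> lattice set \<Rightarrow> lattice set \<Rightarrow> lattice set \<Rightarrow> lattice set \<Rightarrow> bool"
  where "evaluation_basis _ S K Z P \<longleftrightarrow> finite P \<and> P \<subseteq> K \<and>
    (\<forall>g :: lattice \<Rightarrow> 'k. g \<in> additive_on S K \<longrightarrow> (\<forall>x\<in>Z \<union> P. g x = 0) \<longrightarrow> (\<forall>x\<in>K. g x = 0)) \<and>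
    (\<forall>p\<in>P. \<exists>g :: lattice \<Rightarrow> 'k. g \<in> additive_on S K \<and> (\<forall>x\<in>Z. g x = 0) \<and> g p = 1 \<and>
      (\<forall>p'\<in>P - {p}. g p' = 0))"

context cone_monoid
begin

interpretation sw: cone_monoid v2 v1 e2 e1 D p2 p1 l2 l1 by (rule monoid_swap)

text \<open>
  Along each ray an additive function is determined by its value at the first point, and the first
  points of the two rays are linearly independent.
\<close>

lemma T1_dim_axes:
  fixes w :: "'v::finite \<Rightarrow> lattice"
  assumes "presented_monoid S w"
    and axes: "\<And>x. x \<in> shift_gap S (- R) \<Longrightarrow> pairing x v1 = 0 \<or> pairing x v2 = 0"
  shows "T1_dim TYPE('k::field_char_0) S w (- R) = 0"
proof -
  interpret pm: presented_monoid S w by fact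
  have indep: "fst (l1 \<cdot> e1) * snd (l2 \<cdot> e2) \<noteq> snd (l1 \<cdot> e1) * fst (l2 \<cdot> e2)"
    by (rule independentI) (use D_pos l_pos in \<open>simp add: e1 e2\<close>)
  show ?thesis
  proof (rule pm.T1_dim_eq_zero)
    fix g :: "lattice \<Rightarrow> 'k" assume g: "g \<in> additive_on S (shift_gap S (- R))"
    obtain t where t: "linear_form t (l1 \<cdot> e1) = g (l1 \<cdot> e1)" "linear_form t (l2 \<cdot> e2) = g (l2 \<cdot> e2)"
      using linear_form_exists[OF indep] by blast
    have lin: "linear_form t ((n * l) \<cdot> e) = of_int n * linear_form t (l \<cdot> e)" for n l e
      by (simp add: linear_form_zscale)
    have "g x = linear_form t x" if x: "x \<in> shift_gap S (- R)" for x
      using axes[OF x]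
    proof
      assume "pairing x v1 = 0"
      with x obtain n where n: "0 \<le> n" "x = (n * l1) \<cdot> e1"
        using mem_ray1[of x] by (auto simp: shift_gap_def)
      then show ?thesis
        using additive_ray1[OF g pm.shift_gap_down n(1)] x lin[of n l1 e1] t by simp
    next
      assume "pairing x v2 = 0"
      with x obtain n where n: "0 \<le> n" "x = (n * l2) \<cdot> e2"
        using sw.mem_ray1[of x] by (auto simp: shift_gap_def S_swap)
      then show ?thesis
        using sw.additive_ray1[unfolded S_swap, OF g pm.shift_gap_down n(1)] x lin[of n l2 e2] t by simp
    qed
    then show "\<exists>t. \<forall>x\<in>shift_gap S (- R). g x = linear_form t x" by blast
  qed
qed

text \<open>
  On the wide second strip a function is linear. Subtracting this linear form leaves the functions on
  the first strip that vanish on the intersection.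
\<close>

lemma T1_dim_second_strip:
  fixes w :: "'v::finite \<Rightarrow> lattice"
  assumes "presented_monoid S w" and R: "2 \<le> pairing R v2"
    and basis: "evaluation_basis TYPE('k::field_char_0) S (K1 R) (K1 R \<inter> K2 R) P"
  shows "T1_dim TYPE('k) S w (- R) = enat (card P)"
proof -
  interpret pm: presented_monoid S w by fact
  have mem: "l2 \<cdot> e2 \<in> K2 R" "p2 + 1 \<cdot> e2 \<in> K2 R"
    using sw.ray1_strip1[of 1 R] sw.q_strip1[of 1 R] R by (simp_all add: S_swap)
  show ?thesis
  proof (rule pm.T1_dim_eq_card[of "l2 \<cdot> e2" "- R" "p2 + 1 \<cdot> e2"], unfold gap_eq)
    show "l2 \<cdot> e2 \<in> K1 R \<union> K2 R" "p2 + 1 \<cdot> e2 \<in> K1 R \<union> K2 R" using mem by simp_all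
    show "fst (l2 \<cdot> e2) * snd (p2 + 1 \<cdot> e2) \<noteq> snd (l2 \<cdot> e2) * fst (p2 + 1 \<cdot> e2)"
      by (rule independentI) (use D_pos l_pos in \<open>simp add: p2 e2\<close>)
    show "finite P" "P \<subseteq> K1 R \<union> K2 R" using basis by (auto simp: evaluation_basis_def)
  next
    fix g :: "lattice \<Rightarrow> 'k"
    assume g: "g \<in> additive_on S (K1 R \<union> K2 R)" "g (l2 \<cdot> e2) = 0" "g (p2 + 1 \<cdot> e2) = 0" "\<forall>p\<in>P. g p = 0"
    have "(\<lambda>x. if x \<in> K2 R then g x else 0) \<in> additive_on S (K2 R)"
      using sw.restrict_additive[of g R] g(1) by (simp add: S_swap gap_eq)
    from sw.strip1_vanish[unfolded S_swap, OF this R] g mem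
    have K2: "g x = 0" if "x \<in> K2 R" for x using that by auto
    have "(\<lambda>x. if x \<in> K1 R then g x else 0) \<in> additive_on S (K1 R)"
      using restrict_additive[of g R] g(1) by (simp add: gap_eq)
    moreover have "\<forall>x\<in>K1 R \<inter> K2 R \<union> P. (if x \<in> K1 R then g x else 0) = 0"
      using K2 g(4) by auto
    ultimately have "\<forall>x\<in>K1 R. (if x \<in> K1 R then g x else 0) = 0"
      using basis unfolding evaluation_basis_def by blast
    with K2 show "\<forall>z\<in>K1 R \<union> K2 R. g z = 0" by auto
  next
    fix p assume "p \<in> P"
    then obtain h :: "lattice \<Rightarrow> 'k" where h: "h \<in> additive_on S (K1 R)" "\<forall>x\<in>K1 R \<inter> K2 R. h x = 0"
      "h p = 1" "\<forall>p'\<in>P - {p}. h p' = 0"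
      using basis unfolding evaluation_basis_def by blast
    from glue_additive[OF h(1,2)] h(3,4) mem
    show "\<exists>g :: lattice \<Rightarrow> 'k. g \<in> additive_on S (K1 R \<union> K2 R) \<and> g (l2 \<cdot> e2) = 0 \<and> g (p2 + 1 \<cdot> e2) = 0 \<and>
        g p = 1 \<and> (\<forall>p'\<in>P - {p}. g p' = 0)"
      unfolding gap_eq by (intro exI[of _ h]) auto
  qed
qed

section \<open>Strips of width at most one\<close>

lemma strip1_level1:
  assumes "x \<in> K1 (q m)" "pairing x v1 = 1"
  obtains n where "1 \<le> n" "x = q n" "\<not> l1 dvd (n - m)"
proof -
  obtain n where n: "x = q n" using basis1[of x] assms(2) by auto
  have dvd: "\<not> l1 dvd (n - m)"
  proof
    assume "l1 dvd (n - m)"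
    then obtain k where "n - m = l1 * k" by (rule dvdE)
    then have "n = m + k * l1" by (simp add: algebra_simps)
    then have "x = q m + (k * l1) \<cdot> e1" by (simp add: n zscale_add_left add.assoc)
    with assms(1) show False by (auto simp: strip_def)
  qed
  moreover have "1 \<le> n"
  proof -
    have "x \<in> S" using assms(1) by (simp add: strip_def)
    then show ?thesis
    proof (cases rule: mem_cases)
      case interior
      then have "0 < pairing p1 v2 + n * D" by (simp add: n e1)
      then have "0 < n * D" using p1 by linarith
      with D_pos show ?thesis by (simp add: zero_less_mult_iff)
    next
      case (ray2 k)
      from ray2(4) assms(2) have "l2 dvd 1" by (metis dvd_mult dvd_mult2 dvd_refl)
      then have "l2 = 1" using l_pos by (simp add: zdvd1_eq)
      then have "l1 = 1" using indices by auto
      with dvd show ?thesis by simp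
    next
      case (ray1 k)
      from ray1(3) assms(2) show ?thesis by simp
    qed
  qed
  ultimately show ?thesis using n that by blast
qed

lemma strip1_level1_mem:
  assumes "1 \<le> n" "\<not> l1 dvd (n - m)"
  shows "q n \<in> K1 (q m)"
proof -
  have "q n \<noteq> q m + (j * l1) \<cdot> e1" for j
  proof
    assume "q n = q m + (j * l1) \<cdot> e1"
    then have "n * D = (m + j * l1) * D" by (auto simp: coords_eq_iff e1 algebra_simps)
    then have "n - m = j * l1" using D_pos by simp
    with assms(2) show False by simp
  qed
  with q_mem[OF assms(1)] show ?thesis by (simp add: strip_def p1 e1)
qed

lemma strip1_level_le:
  assumes "x \<in> K1 R" "pairing R v1 \<le> 1"
  shows "pairing x v1 = 0 \<or> pairing x v1 = 1"
  using assms mem_nonneg[of x] by (auto simp: strip_def)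

lemma strip1_level0:
  assumes "l1 = 1" "x \<in> K1 R" "pairing R v1 \<le> 1"
  shows "pairing x v1 = 0"
proof -
  have "pairing x v1 \<noteq> 1"
  proof
    assume "pairing x v1 = 1"
    with assms(2,3) have "pairing (x - R) v1 = 0" by (auto simp: strip_def)
    then obtain n where "x - R = n \<cdot> e1" using basis1[of "x - R"] by auto
    then have "x = R + (n * l1) \<cdot> e1" by (simp add: \<open>l1 = 1\<close> diff_eq_eq add.commute)
    with assms(2) show False unfolding strip_def by blast
  qed
  with strip1_level_le[OF assms(2,3)] show ?thesis by simp
qed

lemma additive_onI_level1:
  assumes R: "pairing R v1 \<le> 1" and outside: "\<And>x. x \<notin> K1 R \<Longrightarrow> h x = 0"
    and add: "\<And>x k. x \<in> S \<Longrightarrow> 0 \<le> k \<Longrightarrow> x + (k * l1) \<cdot> e1 \<in> K1 R \<Longrightarrow>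
      h (x + (k * l1) \<cdot> e1) = h x + h ((k * l1) \<cdot> e1)"
  shows "h \<in> additive_on S (K1 R)"
proof -
  have *: "h (a + b) = h a + h b" if "a \<in> S" "b \<in> S" "a + b \<in> K1 R" "pairing b v1 = 0" for a b
  proof -
    from mem_ray1[OF that(2,4)] obtain k where "0 \<le> k" "b = (k * l1) \<cdot> e1" by blast
    with add[of a k] that show ?thesis by simp
  qed
  have "h (a + b) = h a + h b" if ab: "a \<in> S" "b \<in> S" "a + b \<in> K1 R" for a b
  proof -
    have "pairing a v1 + pairing b v1 \<le> 1" using ab(3) R by (auto simp: strip_def)
    with mem_nonneg[OF ab(1)] mem_nonneg[OF ab(2)]
    have "pairing b v1 = 0 \<or> pairing a v1 = 0" by linarith
    then show ?thesis using *[OF ab] *[OF ab(2,1)] ab(3) by (auto simp: add.commute)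
  qed
  with outside show ?thesis by (simp add: additive_on_def)
qed

text \<open>
  Each point of height one arises from one with index between \<open>1\<close> and \<open>l1\<close> by adding a multiple of
  \<open>l1 e1\<close>.
\<close>

lemma level1_vanish:
  assumes g: "g \<in> additive_on S (K1 (q m))" and zero: "g (l1 \<cdot> e1) = 0"
    "\<And>n. 1 \<le> n \<Longrightarrow> n \<le> l1 \<Longrightarrow> \<not> l1 dvd (n - m) \<Longrightarrow> g (q n) = 0" and x: "x \<in> K1 (q m)"
  shows "g x = 0"
proof -
  have "pairing x v1 = 0 \<or> pairing x v1 = 1"
    using strip1_level_le[OF x] by (simp add: p1 e1)
  then show ?thesis
  proof
    assume "pairing x v1 = 0"
    moreover have "x \<in> S" using x by (simp add: strip_def)
    ultimately obtain n where n: "0 \<le> n" "x = (n * l1) \<cdot> e1" using mem_ray1 by blast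
    then show ?thesis using additive_ray1[OF g strip1_down n(1)] x zero(1) by simp
  next
    assume "pairing x v1 = 1"
    with x obtain n where n: "1 \<le> n" "x = q n" "\<not> l1 dvd (n - m)" by (rule strip1_level1)
    define n' where "n' = (n - 1) mod l1 + 1"
    define k where "k = (n - 1) div l1"
    have split: "n = n' + k * l1" by (simp add: n'_def k_def mult.commute)
    have n': "1 \<le> n'" "n' \<le> l1" "0 \<le> k"
      using n(1) pos_mod_bound[OF l_pos(1), of "n - 1"] pos_mod_sign[OF l_pos(1), of "n - 1"]
        pos_imp_zdiv_nonneg_iff[OF l_pos(1), of "n - 1"]
      unfolding n'_def k_def by linarith+
    have "\<not> l1 dvd (n' - m)"
      using n(3) dvd_add[of l1 "n' - m" "k * l1"] by (auto simp: split algebra_simps)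
    then have "g (q n') = 0" using n' by (intro zero(2))
    moreover have eq: "x = q n' + (k * l1) \<cdot> e1" by (simp add: n split zscale_add_left add.assoc)
    then have "g x = g (q n')"
      using translate_invariant[OF g _ zero(1) q_mem[OF n'(1)] n'(3)] x by (simp add: p1 e1)
    ultimately show ?thesis by simp
  qed
qed

text \<open>
  In a strip of height one no relation connects different residue classes modulo \<open>l1\<close>.
\<close>

lemma class_function:
  assumes "pairing R v1 \<le> 1"
  shows "(\<lambda>x. if x \<in> K1 R \<and> (\<exists>j. x = q n + (j * l1) \<cdot> e1) then 1 else (0 :: 'k::comm_ring_1)) \<in> additive_on S (K1 R)"
proof (rule additive_onI_level1[OF assms])
  fix x k assume x: "x \<in> S" "0 \<le> k" "x + (k * l1) \<cdot> e1 \<in> K1 R"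
  have "x \<in> K1 R" using strip1_down[OF x(1) ray1_mem[OF x(2)] x(3)] by simp
  moreover have "(\<exists>j. x + (k * l1) \<cdot> e1 = q n + (j * l1) \<cdot> e1) \<longleftrightarrow> (\<exists>j. x = q n + (j * l1) \<cdot> e1)"
  proof
    assume "\<exists>j. x + (k * l1) \<cdot> e1 = q n + (j * l1) \<cdot> e1"
    then obtain j where "x + (k * l1) \<cdot> e1 = q n + (j * l1) \<cdot> e1" by blast
    then have "x = q n + ((j - k) * l1) \<cdot> e1" by (simp add: coords_eq_iff algebra_simps)
    then show "\<exists>j. x = q n + (j * l1) \<cdot> e1" by blast
  next
    assume "\<exists>j. x = q n + (j * l1) \<cdot> e1"
    then obtain j where "x = q n + (j * l1) \<cdot> e1" by blast
    then have "x + (k * l1) \<cdot> e1 = q n + ((j + k) * l1) \<cdot> e1" by (simp add: coords_eq_iff algebra_simps)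
    then show "\<exists>j. x + (k * l1) \<cdot> e1 = q n + (j * l1) \<cdot> e1" by blast
  qed
  moreover have "\<not> (\<exists>j. (k * l1) \<cdot> e1 = q n + (j * l1) \<cdot> e1)" by (simp add: coords_eq_iff p1 e1)
  ultimately show "(if x + (k * l1) \<cdot> e1 \<in> K1 R \<and> (\<exists>j. x + (k * l1) \<cdot> e1 = q n + (j * l1) \<cdot> e1) then 1 else (0 :: 'k)) =
     (if x \<in> K1 R \<and> (\<exists>j. x = q n + (j * l1) \<cdot> e1) then 1 else 0) +
     (if (k * l1) \<cdot> e1 \<in> K1 R \<and> (\<exists>j. (k * l1) \<cdot> e1 = q n + (j * l1) \<cdot> e1) then 1 else 0)"
    using x(3) by simp
qed simp

text \<open>
  Adding \<open>l1 e1\<close> increases the value by one. Subtracting the height \<open>pairing x v1\<close> makes the function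
  vanish at the first \<open>l1\<close> points of height one.
\<close>

lemma slope_function:
  assumes "pairing R v1 \<le> 1"
  shows "(\<lambda>x. if x \<in> K1 R then of_int ((pairing x v2 - pairing x v1) div (l1 * D)) else 0) \<in> additive_on S (K1 R)"
proof (rule additive_onI_level1[OF assms])
  fix x k assume x: "x \<in> S" "0 \<le> k" "x + (k * l1) \<cdot> e1 \<in> K1 R"
  have lD: "l1 * D \<noteq> 0" using D_pos l_pos by simp
  have "pairing (x + (k * l1) \<cdot> e1) v2 - pairing (x + (k * l1) \<cdot> e1) v1 =
      (pairing x v2 - pairing x v1) + k * (l1 * D)" by (simp add: e1)
  moreover have "pairing ((k * l1) \<cdot> e1) v2 - pairing ((k * l1) \<cdot> e1) v1 = k * (l1 * D)" by (simp add: e1)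
  ultimately show "(if x + (k * l1) \<cdot> e1 \<in> K1 R
         then of_int ((pairing (x + (k * l1) \<cdot> e1) v2 - pairing (x + (k * l1) \<cdot> e1) v1) div (l1 * D)) else 0) =
     (if x \<in> K1 R then of_int ((pairing x v2 - pairing x v1) div (l1 * D)) else 0) +
     (if (k * l1) \<cdot> e1 \<in> K1 R
         then of_int ((pairing ((k * l1) \<cdot> e1) v2 - pairing ((k * l1) \<cdot> e1) v1) div (l1 * D)) else 0)"
    using x(3) strip1_down[OF x(1) ray1_mem[OF x(2)] x(3)] lD by (simp only: div_mult_self1 nonzero_mult_div_cancel_right) simp
qed simp

lemma q_eq_iff: "q n = q m + (j * l) \<cdot> e1 \<longleftrightarrow> n - m = j * l"
proof -
  have "q n = q m + (j * l) \<cdot> e1 \<longleftrightarrow> n * D = (m + j * l) * D"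
    by (simp add: coords_eq_iff p1 e1 algebra_simps)
  then show ?thesis using D_pos by auto
qed

lemma same_class_eq:
  assumes "n - m = j * l1" "\<bar>n - m\<bar> < l1"
  shows "n = m"
proof (rule ccontr)
  assume "n \<noteq> m"
  then have "\<not> l1 dvd \<bar>n - m\<bar>" using assms(2) by (intro zdvd_not_zless) auto
  then show False unfolding assms(1) by simp
qed

text \<open>
  On the intersection with the second strip lie the points \<open>q n\<close> with \<open>n < m\<close>. They account for the
  classes of \<open>1, \<dots>, m - 1\<close>, and the class of \<open>m\<close> is missing from the strip, which leaves the classes of
  \<open>m + 1, \<dots>, l1\<close>. The slope along the ray is free as long as \<open>l1 e1\<close> is not in the second strip.
\<close>

lemma evaluation_basis_level1:
  assumes m: "1 \<le> m" and R: "R = q m" and l: "l1 * D = pairing R v2 \<Longrightarrow> l2 \<noteq> 1"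
  defines "P \<equiv> q ` {m<..l1} \<union> (if l1 * D \<le> pairing R v2 then {} else {l1 \<cdot> e1})"
  shows "evaluation_basis TYPE('k::field_char_0) S (K1 R) (K1 R \<inter> K2 R) P"
    and "card P = nat (l1 - m) + (if l1 * D \<le> pairing R v2 then 0 else 1)"
proof -
  have R1: "pairing R v1 = 1" by (simp add: R p1 e1)
  have ray: "l1 \<cdot> e1 \<in> K1 R" using ray1_strip1[of 1 R] R1 by simp
  have mono: "pairing (q a) v2 < pairing (q b) v2 \<longleftrightarrow> a < b" for a b
    using D_pos by (simp add: e1)
  have upper: "pairing (q n) v2 \<le> l1 * D" if "n \<le> l1" for n
  proof -
    have "n * D \<le> l1 * D" using that D_pos by simp
    moreover have "pairing (q n) v2 = pairing p1 v2 + n * D" by (simp add: e1)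
    ultimately show ?thesis using p1(3) by linarith
  qed
  have not_dvd: "\<not> l1 dvd (n - m)" if "n \<in> {m<..l1}" for n
    using that m zdvd_not_zless[of "n - m" l1] by auto
  have ray_class: "l1 \<cdot> e1 \<noteq> q n + (j * l1) \<cdot> e1" for n j
    by (simp add: coords_eq_iff p1 e1)
  have P: "finite P" "P \<subseteq> K1 R"
    using strip1_level1_mem[of _ m] not_dvd m ray by (auto simp: P_def R)
  have "\<forall>x\<in>K1 R. g x = 0" if g: "g \<in> additive_on S (K1 R)" "\<forall>x\<in>K1 R \<inter> K2 R \<union> P. g x = 0"
    for g :: "lattice \<Rightarrow> 'k"
  proof
    have ray_zero: "g (l1 \<cdot> e1) = 0"
    proof (cases "l1 * D \<le> pairing R v2")
      case True
      have "l1 \<cdot> e1 \<noteq> R + (j * l2) \<cdot> e2" for j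
      proof
        assume eq: "l1 \<cdot> e1 = R + (j * l2) \<cdot> e2"
        from arg_cong[OF eq, of "\<lambda>x. pairing x v2"] have "l2 \<noteq> 1" using l by (simp add: e1 e2)
        then have "3 \<le> l2" using indices by auto
        moreover from arg_cong[OF eq, of "\<lambda>x. pairing x v1"] have "l2 * (- j * D) = 1"
          by (simp add: e1 e2 R1 algebra_simps)
        then have "l2 dvd 1" by (metis dvd_triv_left)
        ultimately show False using zdvd_imp_le[of l2 1] by simp
      qed
      then have "l1 \<cdot> e1 \<in> K2 R" using True ray by (simp add: strip_def e1)
      with ray g(2) show ?thesis by blast
    next
      case False
      then show ?thesis using g(2) by (simp add: P_def)
    qed
    have line_zero: "g (q n) = 0" if n: "1 \<le> n" "n \<le> l1" "\<not> l1 dvd (n - m)" for n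
    proof (cases "n < m")
      case True
      have "q n \<noteq> R + (j * l2) \<cdot> e2" for j
      proof
        assume "q n = R + (j * l2) \<cdot> e2"
        from arg_cong[OF this, of "\<lambda>x. pairing x v2"] have "pairing (q n) v2 = pairing (q m) v2"
          by (simp add: R e2)
        with mono[of n m] True show False by simp
      qed
      then have "q n \<in> K2 R" using True q_mem[OF n(1)] mono[of n m] by (auto simp: strip_def R)
      moreover have "q n \<in> K1 R" using strip1_level1_mem[OF n(1,3)] by (simp add: R)
      ultimately show ?thesis using g(2) by blast
    next
      case False
      with n have "n \<in> {m<..l1}" by (cases "n = m") auto
      then show ?thesis using g(2) by (auto simp: P_def)
    qed
    fix x assume "x \<in> K1 R"
    then show "g x = 0" using level1_vanish[of g m x] g(1) ray_zero line_zero by (simp add: R)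
  qed
  moreover have "\<exists>g :: lattice \<Rightarrow> 'k. g \<in> additive_on S (K1 R) \<and> (\<forall>x\<in>K1 R \<inter> K2 R. g x = 0) \<and> g p = 1 \<and>
      (\<forall>p'\<in>P - {p}. g p' = 0)" if p: "p \<in> P" for p
  proof (cases "p \<in> q ` {m<..l1}")
    case True
    then obtain n where n: "n \<in> {m<..l1}" "p = q n" by blast
    define h where "h = (\<lambda>x. if x \<in> K1 R \<and> (\<exists>j. x = q n + (j * l1) \<cdot> e1) then (1 :: 'k) else 0)"
    have "h x = 0" if x: "x \<in> K1 R" "x \<in> K2 R" for x
    proof (rule ccontr)
      assume "h x \<noteq> 0"
      then obtain j where j: "x = q n + (j * l1) \<cdot> e1" by (auto simp: h_def split: if_splits)
      then have "pairing x v1 = 1" by (simp add: p1 e1)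
      then obtain n' where n': "1 \<le> n'" "x = q n'" using strip1_level1[of x m] x(1) R by blast
      have "q n' = q n + (j * l1) \<cdot> e1" by (rule trans[OF n'(2)[symmetric] j])
      then have eq: "n' - n = j * l1" unfolding q_eq_iff .
      have "n \<le> n'"
      proof (rule ccontr)
        assume "\<not> n \<le> n'"
        then have "\<bar>n' - n\<bar> < l1" using n n' m by auto
        then have "n' = n" by (rule same_class_eq[OF eq])
        with \<open>\<not> n \<le> n'\<close> show False by simp
      qed
      then have "pairing R v2 < pairing x v2" using n mono[of m n'] by (simp add: n' R)
      with x(2) show False by (simp add: strip_def)
    qed
    moreover have "h p = 1"
      using strip1_level1_mem[of n m] not_dvd[OF n(1)] n m by (auto simp: h_def R intro!: exI[of _ 0])
    moreover have "h p' = 0" if "p' \<in> P - {p}" for p'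
    proof -
      have "p' \<noteq> q n + (j * l1) \<cdot> e1" for j
      proof (cases "p' = l1 \<cdot> e1")
        case False
        with that obtain n' where n': "n' \<in> {m<..l1}" "p' = q n'" by (auto simp: P_def split: if_splits)
        with that n have "n' \<noteq> n" "\<bar>n' - n\<bar> < l1" using m by auto
        with same_class_eq[of n' n j] n' show ?thesis by (auto simp: q_eq_iff)
      qed (simp add: ray_class)
      then show ?thesis by (simp add: h_def)
    qed
    moreover have "h \<in> additive_on S (K1 R)"
      unfolding h_def using class_function[of R n] R1 by simp
    ultimately show ?thesis by (intro exI[of _ h]) auto
  next
    case False
    with p have p: "p = l1 \<cdot> e1" "pairing R v2 < l1 * D" by (auto simp: P_def split: if_splits)
    define h where "h = (\<lambda>x. if x \<in> K1 R then of_int ((pairing x v2 - pairing x v1) div (l1 * D)) else (0 :: 'k))"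
    have lD: "0 < l1 * D" using l_pos D_pos by simp
    have small: "h x = 0" if "pairing x v1 \<le> pairing x v2" "pairing x v2 - pairing x v1 < l1 * D" for x
      using that by (simp add: h_def div_pos_pos_trivial)
    have "h x = 0" if x: "x \<in> K1 R" "x \<in> K2 R" for x
    proof (rule small)
      have xS: "x \<in> S" using x by (simp add: strip_def)
      show "pairing x v1 \<le> pairing x v2"
        using strip1_level_le[OF x(1)] R1
      proof (auto simp: mem_nonneg[OF xS])
        assume "pairing x v1 = 1"
        then obtain n where "1 \<le> n" "x = q n" using strip1_level1[of x m] x(1) R by blast
        then show "1 \<le> pairing x v2" using q_pos[of n] by simp
      qed
      show "pairing x v2 - pairing x v1 < l1 * D"
        using x(2) p(2) mem_nonneg[OF xS] by (auto simp: strip_def)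
    qed
    moreover have "h p = 1" using ray l_pos D_pos by (simp add: h_def p e1)
    moreover have "h p' = 0" if "p' \<in> P - {p}" for p'
    proof -
      have "p' \<in> q ` {m<..l1}" using that p by (simp add: P_def split: if_splits)
      then obtain n where n: "n \<in> {m<..l1}" "p' = q n" by blast
      have "pairing (q n) v1 = 1" by (simp add: p1 e1)
      with n q_pos[of n] upper[of n] m show ?thesis by (intro small) auto
    qed
    moreover have "h \<in> additive_on S (K1 R)"
      unfolding h_def using slope_function[of R] R1 by simp
    ultimately show ?thesis by (intro exI[of _ h]) auto
  qed
  ultimately show "evaluation_basis TYPE('k) S (K1 R) (K1 R \<inter> K2 R) P"
    using P unfolding evaluation_basis_def by blast
  have "inj_on q {m<..l1}"
    using q_eq_iff[of _ _ 0 0] by (intro inj_onI) simp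
  then have "card (q ` {m<..l1}) = nat (l1 - m)" by (simp add: card_image)
  moreover have "l1 \<cdot> e1 \<notin> q ` {m<..l1}" using ray_class[of _ 0] by auto
  ultimately show "card P = nat (l1 - m) + (if l1 * D \<le> pairing R v2 then 0 else 1)"
    by (simp add: P_def)
qed

text \<open>
  If \<open>l1\<close> divides \<open>m\<close> the first strip is empty. Otherwise it is the whole ray, on which a function is
  determined by the value at \<open>l1 e1\<close>, and this point is in the second strip if \<open>m > l1\<close>.
\<close>

lemma evaluation_basis_level0:
  assumes m: "1 \<le> m" and R: "R = m \<cdot> e1"
  shows "evaluation_basis TYPE('k::field_char_0) S (K1 R) (K1 R \<inter> K2 R) (if m < l1 then {l1 \<cdot> e1} else {})"
proof -
  have R0: "pairing R v1 = 0" by (simp add: R e1)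
  have ray: "x \<in> S \<and> (\<exists>n\<ge>0. x = (n * l1) \<cdot> e1)" if "x \<in> K1 R" for x
  proof -
    have "x \<in> S" "pairing x v1 = 0" using that R0 mem_nonneg[of x] by (auto simp: strip_def)
    then show ?thesis using mem_ray1[of x] by blast
  qed
  have vanish: "g x = 0" if g: "g \<in> additive_on S (K1 R)" "g (l1 \<cdot> e1) = 0" and x: "x \<in> K1 R"
    for g :: "lattice \<Rightarrow> 'k" and x
  proof -
    obtain n where n: "0 \<le> n" "x = (n * l1) \<cdot> e1" using ray[OF x] by blast
    then show ?thesis using additive_ray1[OF g(1) strip1_down n(1)] x g(2) by simp
  qed
  have mem: "l1 \<cdot> e1 \<in> K1 R" if "\<not> l1 dvd m"
  proof -
    have "l1 \<cdot> e1 \<noteq> R + (j * l1) \<cdot> e1" for j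
    proof
      assume "l1 \<cdot> e1 = R + (j * l1) \<cdot> e1"
      then have "l1 * D = (m + j * l1) * D" by (auto simp: coords_eq_iff R e1 algebra_simps)
      then have "l1 = m + j * l1" using D_pos by simp
      then have "m = l1 * (1 - j)" by (simp add: algebra_simps)
      with that show False by simp
    qed
    with ray1_mem[of 1] R0 show ?thesis by (simp add: strip_def e1)
  qed
  show ?thesis
  proof (cases "m < l1")
    case True
    then have "\<not> l1 dvd m" using m zdvd_not_zless[of m l1] by auto
    define h where "h = (\<lambda>x. if x \<in> K1 R then of_int ((pairing x v2 - pairing x v1) div (l1 * D)) else (0 :: 'k))"
    have h: "h \<in> additive_on S (K1 R)"
      unfolding h_def using slope_function[of R] R0 by simp
    moreover have "h (l1 \<cdot> e1) = 1"
      using mem \<open>\<not> l1 dvd m\<close> l_pos D_pos by (simp add: h_def e1)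
    moreover have "h x = 0" if x: "x \<in> K1 R" "x \<in> K2 R" for x
    proof -
      obtain n where n: "0 \<le> n" "x = (n * l1) \<cdot> e1" using ray[OF x(1)] by blast
      have "n * l1 * D \<le> m * D" using x(2) n by (simp add: strip_def R e1)
      then have "n * l1 < 1 * l1" using True D_pos by simp
      then have "n = 0" using n(1) l_pos by (simp only: mult_less_cancel_right) auto
      then show ?thesis using n by (simp add: h_def)
    qed
    ultimately show ?thesis
      using True mem[OF \<open>\<not> l1 dvd m\<close>] vanish unfolding evaluation_basis_def by auto
  next
    case False
    have "\<forall>x\<in>K1 R. g x = 0" if g: "g \<in> additive_on S (K1 R)" "\<forall>x\<in>K1 R \<inter> K2 R. g x = 0" for g :: "lattice \<Rightarrow> 'k"
    proof (cases "l1 dvd m")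
      case True
      then obtain k where k: "m = l1 * k" by (rule dvdE)
      have "x \<notin> K1 R" for x
      proof
        assume x: "x \<in> K1 R"
        then obtain n where "x = (n * l1) \<cdot> e1" using ray by blast
        then have "x = R + ((n - k) * l1) \<cdot> e1" by (simp add: R k coords_eq_iff algebra_simps)
        with x show False by (auto simp: strip_def)
      qed
      then show ?thesis by blast
    next
      case nd: False
      have "l1 \<cdot> e1 \<noteq> R + (j * l2) \<cdot> e2" for j
      proof
        assume eq: "l1 \<cdot> e1 = R + (j * l2) \<cdot> e2"
        have "l1 * D = m * D" using arg_cong[OF eq, of "\<lambda>x. pairing x v2"] by (simp add: R e1 e2)
        then have "m = l1" using D_pos by simp
        with nd show False by simp
      qed
      moreover have "l1 * D \<le> m * D" using False D_pos by simp
      ultimately have "l1 \<cdot> e1 \<in> K2 R"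
        using mem[OF nd] by (simp add: strip_def R e1)
      with g(2) mem[OF nd] have "g (l1 \<cdot> e1) = 0" by blast
      with vanish[OF g(1)] show ?thesis by blast
    qed
    with False show ?thesis unfolding evaluation_basis_def by auto
  qed
qed

lemma evaluation_basis_negative:
  assumes "pairing R v1 < 0"
  shows "evaluation_basis TYPE('k::field_char_0) S (K1 R) (K1 R \<inter> K2 R) {}"
proof -
  have "K1 R = {}" using assms mem_nonneg by (force simp: strip_def)
  then show ?thesis by (simp add: evaluation_basis_def)
qed

end


context cone_monoid
begin

interpretation sw: cone_monoid v2 v1 e2 e1 D p2 p1 l2 l1 by (rule monoid_swap)

text \<open>
  The strips meet in \<open>0\<close> at most, so functions on them can be chosen independently. On the second one
  there are \<open>l2 - 1\<close> classes and the slope, and the linear forms take away two dimensions.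
\<close>

lemma T1_dim_level1:
  fixes w :: "'v::finite \<Rightarrow> lattice"
  assumes "presented_monoid S w" and l: "3 \<le> l2" and R: "R = p2 + m \<cdot> e2" "m \<le> 1" "pairing R v1 \<le> 1"
    and basis: "evaluation_basis TYPE('k::field_char_0) S (K1 R) (K1 R \<inter> K2 R) P"
  shows "T1_dim TYPE('k) S w (- R) = enat (nat l2 - 2 + card P)"
proof -
  interpret pm: presented_monoid S w by fact
  let ?q2 = "\<lambda>n. p2 + n \<cdot> e2"
  have R2: "pairing R v2 = 1" by (simp add: R p2 e2)
  have l1: "3 \<le> l1" using l indices by auto
  have inter: "x = 0" if x: "x \<in> K1 R" "x \<in> K2 R" for x
  proof -
    have "x \<in> S" using x by (simp add: strip_def)
    then show ?thesis
    proof (cases rule: mem_cases)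
      case interior
      with x R(3) R2 have "pairing x v1 = pairing R v1" "pairing x v2 = pairing R v2"
        by (auto simp: strip_def)
      then have "x = R + (0 * l1) \<cdot> e1" by (simp add: coords_eq_iff)
      with x(1) show ?thesis unfolding strip_def by blast
    next
      case (ray1 n)
      have "pairing x v2 \<le> pairing R v2" using x(2) by (simp add: strip_def)
      then have "n * l1 * D \<le> 1" unfolding ray1(4) R2 .
      moreover have "1 < n * l1 * D" if "1 \<le> n"
        using mult_mono[of 1 n 3 l1] mult_mono[of 3 "n * l1" 1 D] that l1 D_pos by simp
      ultimately have "n = 0" using ray1(1) by linarith
      with ray1 show ?thesis by simp
    next
      case (ray2 n)
      have "pairing x v1 \<le> pairing R v1" using x(1) by (simp add: strip_def)
      with R(3) have "n * l2 * D \<le> 1" unfolding ray2(4) by linarith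
      moreover have "1 < n * l2 * D" if "1 \<le> n"
        using mult_mono[of 1 n 3 l2] mult_mono[of 3 "n * l2" 1 D] that l D_pos by simp
      ultimately have "n = 0" using ray2(1) by linarith
      with ray2 show ?thesis by simp
    qed
  qed
  \<comment> \<open>The point with index \<open>n0\<close> is the first one of height one in the second strip; linear forms are
    normalised by their values there and at \<open>l2 e2\<close>.\<close>
  define n0 where "n0 = (if l2 dvd (1 - m) then 2 else (1 :: int))"
  have n0: "1 \<le> n0" "n0 \<le> l2" "\<not> l2 dvd (n0 - m)"
  proof -
    have "\<not> l2 dvd (2 - m)" if "l2 dvd (1 - m)"
      using that dvd_diff[of l2 "2 - m" "1 - m"] l zdvd_imp_le[of l2 1] by auto
    then show "1 \<le> n0" "n0 \<le> l2" "\<not> l2 dvd (n0 - m)" using l by (auto simp: n0_def)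
  qed
  define N where "N = {n \<in> {1..l2}. \<not> l2 dvd (n - m) \<and> n \<noteq> n0}"
  have same: "n = n'" if "n \<in> {1..l2}" "n' \<in> {1..l2}" "n - n' = j * l2" for n n' j
    using sw.same_class_eq[OF that(3)] that(1,2) by auto
  have finite_N: "finite N" unfolding N_def by (rule finite_subset[of _ "{1..l2}"]) auto
  have card_N: "card N = nat l2 - 2"
  proof -
    \<comment> \<open>The representative of the class of \<open>m\<close> between \<open>1\<close> and \<open>l2\<close>; this class is missing from the strip.\<close>
    define n1 where "n1 = (m - 1) mod l2 + 1"
    have n1: "n1 \<in> {1..l2}" "l2 dvd (n1 - m)"
    proof -
      show "n1 \<in> {1..l2}"
        using pos_mod_bound[OF l_pos(2), of "m - 1"] pos_mod_sign[OF l_pos(2), of "m - 1"]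
        unfolding n1_def by simp
      have "n1 - m = - (l2 * ((m - 1) div l2))"
        unfolding n1_def using mult_div_mod_eq[of l2 "m - 1"] by linarith
      then show "l2 dvd (n1 - m)" by simp
    qed
    have "l2 dvd (n - m) \<longleftrightarrow> n = n1" if n: "n \<in> {1..l2}" for n
    proof
      assume "l2 dvd (n - m)"
      then have "l2 dvd (n - m - (n1 - m))" using n1(2) by (rule dvd_diff)
      then have "l2 dvd (n - n1)" by simp
      then obtain j where "n - n1 = l2 * j" by (rule dvdE)
      then have "n - n1 = j * l2" by (simp only: mult.commute)
      then show "n = n1" by (rule same[OF n n1(1)])
    qed (use n1 in simp)
    then have "N = {1..l2} - {n1, n0}" by (auto simp: N_def)
    moreover have "n1 \<noteq> n0" using n1 n0 by auto
    ultimately have "card N = card {1..l2} - card {n1, n0}"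
      using n1 n0 by (simp only:) (rule card_Diff_subset, auto)
    with \<open>n1 \<noteq> n0\<close> show ?thesis by simp
  qed
  have mem: "l2 \<cdot> e2 \<in> K2 R" "\<And>n. 1 \<le> n \<Longrightarrow> \<not> l2 dvd (n - m) \<Longrightarrow> ?q2 n \<in> K2 R"
    using sw.ray1_strip1[of 1 R] sw.strip1_level1_mem[of _ m] R2 by (simp_all add: S_swap R)
  have P2_mem: "?q2 n \<in> K2 R" if "n \<in> N" for n using that mem(2) by (auto simp: N_def)
  have q2_nonzero: "?q2 n \<noteq> 0" for n by (simp add: coords_eq_iff p2 e2)
  have P: "finite P" "P \<subseteq> K1 R" using basis by (auto simp: evaluation_basis_def)
  have disjoint: "?q2 ` N \<inter> P = {}"
    using inter P2_mem P(2) q2_nonzero by blast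
  have "T1_dim TYPE('k) S w (- R) = enat (card (?q2 ` N \<union> P))"
  proof (rule pm.T1_dim_eq_card[of "l2 \<cdot> e2" "- R" "?q2 n0"], unfold gap_eq)
    show "l2 \<cdot> e2 \<in> K1 R \<union> K2 R" "?q2 n0 \<in> K1 R \<union> K2 R" using mem n0 by simp_all
    show "fst (l2 \<cdot> e2) * snd (?q2 n0) \<noteq> snd (l2 \<cdot> e2) * fst (?q2 n0)"
      by (rule independentI) (use D_pos l_pos in \<open>simp add: p2 e2\<close>)
    show "finite (?q2 ` N \<union> P)" using P finite_N by simp
    show "?q2 ` N \<union> P \<subseteq> K1 R \<union> K2 R" using P P2_mem by blast
  next
    fix g :: "lattice \<Rightarrow> 'k"
    assume g: "g \<in> additive_on S (K1 R \<union> K2 R)" "g (l2 \<cdot> e2) = 0" "g (?q2 n0) = 0"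
      "\<forall>p\<in>?q2 ` N \<union> P. g p = 0"
    let ?g = "\<lambda>x. if x \<in> K2 R then g x else 0"
    have res: "?g \<in> additive_on S (K2 R)"
      using sw.restrict_additive[of g R] g(1) by (simp add: S_swap gap_eq)
    have K2: "g x = 0" if x: "x \<in> K2 R" for x
    proof -
      have "?g x = 0"
      proof (rule sw.level1_vanish[of _ m, unfolded S_swap, folded R(1)])
        show "?g \<in> additive_on S (K2 R)" "x \<in> K2 R" by fact+
        show "?g (l2 \<cdot> e2) = 0" using g(2) by simp
        fix n assume "1 \<le> n" "n \<le> l2" "\<not> l2 dvd (n - m)"
        then have "n = n0 \<or> n \<in> N" by (auto simp: N_def)
        then show "?g (?q2 n) = 0" using g(3,4) by auto
      qed
      with x show ?thesis by simp
    qed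
    have "(\<lambda>x. if x \<in> K1 R then g x else 0) \<in> additive_on S (K1 R)"
      using restrict_additive[of g R] g(1) by (simp add: gap_eq)
    moreover have "\<forall>x\<in>K1 R \<inter> K2 R \<union> P. (if x \<in> K1 R then g x else 0) = 0"
      using K2 g(4) by auto
    ultimately have "\<forall>x\<in>K1 R. (if x \<in> K1 R then g x else 0) = 0"
      using basis unfolding evaluation_basis_def by blast
    with K2 show "\<forall>z\<in>K1 R \<union> K2 R. g z = 0" by auto
  next
    fix p assume p: "p \<in> ?q2 ` N \<union> P"
    show "\<exists>g :: lattice \<Rightarrow> 'k. g \<in> additive_on S (K1 R \<union> K2 R) \<and> g (l2 \<cdot> e2) = 0 \<and> g (?q2 n0) = 0 \<and>
        g p = 1 \<and> (\<forall>p'\<in>?q2 ` N \<union> P - {p}. g p' = 0)"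
    proof (cases "p \<in> P")
      case True
      then obtain h :: "lattice \<Rightarrow> 'k" where h: "h \<in> additive_on S (K1 R)" "\<forall>x\<in>K1 R \<inter> K2 R. h x = 0"
        "h p = 1" "\<forall>p'\<in>P - {p}. h p' = 0"
        using basis unfolding evaluation_basis_def by blast
      have zero: "h x = 0" if "x \<in> K2 R" for x using glue_additive(2)[OF h(1,2) that] .
      have "\<forall>p'\<in>?q2 ` N \<union> P - {p}. h p' = 0" using h(4) zero P2_mem by blast
      then show ?thesis
        using glue_additive(1)[OF h(1,2)] h(3) zero mem n0 unfolding gap_eq by (intro exI[of _ h]) simp
    next
      case False
      with p obtain n where n: "n \<in> N" "p = ?q2 n" by blast
      define h where "h = (\<lambda>x. if x \<in> K2 R \<and> (\<exists>j. x = ?q2 n + (j * l2) \<cdot> e2) then (1 :: 'k) else 0)"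
      have h: "h \<in> additive_on S (K2 R)"
        unfolding h_def using sw.class_function[of R n] R2 by (simp add: S_swap)
      have "\<forall>x\<in>K2 R \<inter> K1 R. h x = 0"
        using inter by (auto simp: h_def coords_eq_iff p2 e2)
      note glue = sw.glue_additive[unfolded S_swap, OF h this]
      have other: "h (?q2 n') = 0" if "n' \<in> {1..l2}" "n' \<noteq> n" for n'
        using same[of n' n] that n by (auto simp: h_def sw.q_eq_iff N_def)
      show ?thesis
      proof (intro exI[of _ h] conjI ballI)
        show "h \<in> additive_on S (K1 R \<union> K2 R)" using glue(1) by (simp only: gap_eq)
        show "h (l2 \<cdot> e2) = 0" by (simp add: h_def coords_eq_iff p2 e2)
        show "h (?q2 n0) = 0" using other[of n0] n n0 by (auto simp: N_def)
        have "?q2 n = ?q2 n + (0 * l2) \<cdot> e2" by simp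
        then show "h p = 1" using P2_mem[OF n(1)] n(2) unfolding h_def by metis
        fix p' assume p': "p' \<in> ?q2 ` N \<union> P - {p}"
        show "h p' = 0"
        proof (cases "p' \<in> P")
          case True
          then show ?thesis using glue(2) P by blast
        next
          case False
          then obtain n' where "n' \<in> N" "p' = ?q2 n'" "n' \<noteq> n" using p' n by blast
          then show ?thesis using other by (simp add: N_def)
        qed
      qed
    qed
  qed
  moreover have "card (?q2 ` N \<union> P) = card N + card P"
  proof -
    have "inj_on ?q2 N" using sw.q_eq_iff[of _ _ 0 0] by (intro inj_onI) simp
    then show ?thesis using disjoint P(1) finite_N by (simp add: card_Un_disjoint card_image)
  qed
  ultimately show ?thesis by (simp add: card_N)
qed

end

section \<open>Two wide strips\<close>

context cone_frame
begin

definition box :: "lattice \<Rightarrow> lattice set"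
  where "box R = {x. 0 < pairing x v1 \<and> pairing x v1 < pairing R v1 \<and> 0 < pairing x v2 \<and> pairing x v2 < pairing R v2}"

text \<open>
  The dimension of the space of linear forms vanishing on the intersection of two wide strips. The
  covering indices do not enter, which is why the normalisation and the seminormal monoid agree here.
\<close>

definition box_defect :: "lattice \<Rightarrow> nat"
  where "box_defect R = (if D < pairing R v1 \<or> D < pairing R v2 then 0
    else if box R = {} then 2
    else if \<exists>x\<in>box R. \<exists>y\<in>box R. fst x * snd y \<noteq> snd x * fst y then 0 else 1)"

end

context cone_monoid
begin

lemma strip1_linear:
  fixes g :: "lattice \<Rightarrow> 'k::field_char_0"
  assumes g: "g \<in> additive_on S (K1 R)" and R: "2 \<le> pairing R v1"
  shows "\<exists>t. \<forall>x\<in>K1 R. g x = linear_form t x"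
proof -
  have indep: "fst (l1 \<cdot> e1) * snd (q 1) \<noteq> snd (l1 \<cdot> e1) * fst (q 1)"
    by (rule independentI) (use D_pos l_pos in \<open>simp add: p1 e1\<close>)
  obtain t where t: "linear_form t (l1 \<cdot> e1) = g (l1 \<cdot> e1)" "linear_form t (q 1) = g (q 1)"
    using linear_form_exists[OF indep] by blast
  define h where "h x = g x - (if x \<in> K1 R then linear_form t x else 0)" for x
  have h: "h \<in> additive_on S (K1 R)"
    unfolding h_def using strip1_down by (intro additive_on_diff g additive_on_restrict_linear_form)
  have mem: "l1 \<cdot> e1 \<in> K1 R" "q 1 \<in> K1 R"
    using ray1_strip1[of 1 R] q_strip1[of 1 R] R by auto
  have "g x = linear_form t x" if "x \<in> K1 R" for x
    using strip1_vanish[OF h R _ _ that] mem t that by (simp add: h_def)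
  then show ?thesis by blast
qed

lemma evaluation_basis_linear:
  assumes R: "2 \<le> pairing R v1" and P: "finite P" "P \<subseteq> K1 R"
    and vanish: "\<And>t :: 'k::field_char_0 \<times> 'k. \<forall>x\<in>Z \<union> P. linear_form t x = 0 \<Longrightarrow> \<forall>x\<in>K1 R. linear_form t x = 0"
    and Z: "Z \<subseteq> K1 R"
    and forms: "\<And>p. p \<in> P \<Longrightarrow> \<exists>t :: 'k \<times> 'k. (\<forall>x\<in>Z. linear_form t x = 0) \<and> linear_form t p = 1 \<and>
      (\<forall>p'\<in>P - {p}. linear_form t p' = 0)"
  shows "evaluation_basis TYPE('k) S (K1 R) Z P"
  unfolding evaluation_basis_def
proof (intro conjI allI impI ballI)
  fix g :: "lattice \<Rightarrow> 'k" and x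
  assume g: "g \<in> additive_on S (K1 R)" "\<forall>x\<in>Z \<union> P. g x = 0" and x: "x \<in> K1 R"
  obtain t where t: "\<And>x. x \<in> K1 R \<Longrightarrow> g x = linear_form t x" using strip1_linear[OF g(1) R] by blast
  have "\<forall>x\<in>Z \<union> P. linear_form t x = 0"
  proof
    fix y assume "y \<in> Z \<union> P"
    with t[of y] g(2) P(2) Z show "linear_form t y = 0" by auto
  qed
  from vanish[OF this] t x show "g x = 0" by simp
next
  fix p assume p: "p \<in> P"
  then obtain t :: "'k \<times> 'k" where t: "\<forall>x\<in>Z. linear_form t x = 0" "linear_form t p = 1"
      "\<forall>p'\<in>P - {p}. linear_form t p' = 0" using forms by blast
  let ?g = "\<lambda>x. if x \<in> K1 R then linear_form t x else 0"
  have "?g \<in> additive_on S (K1 R)" using strip1_down by (intro additive_on_restrict_linear_form)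
  moreover have "(\<forall>x\<in>Z. ?g x = 0) \<and> ?g p = 1 \<and> (\<forall>p'\<in>P - {p}. ?g p' = 0)"
    using t p P(2) by auto
  ultimately show "\<exists>g :: lattice \<Rightarrow> 'k. g \<in> additive_on S (K1 R) \<and> (\<forall>x\<in>Z. g x = 0) \<and> g p = 1 \<and>
      (\<forall>p'\<in>P - {p}. g p' = 0)" by blast
qed (use P in auto)

lemma strip1_ltI: "x \<in> S \<Longrightarrow> pairing x v1 < pairing R v1 \<Longrightarrow> x \<in> K1 R"
  by (auto simp: strip_def e1)

lemma strip2_ltI: "x \<in> S \<Longrightarrow> pairing x v2 < pairing R v2 \<Longrightarrow> x \<in> K2 R"
  by (auto simp: strip_def e2)

text \<open>
  The point \<open>q 1\<close> and its mirror image \<open>R - q 1\<close> lie strictly between \<open>0\<close> and \<open>R\<close>. In the seminormal case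
  \<open>R - e1\<close> is interior and belongs to both strips; so \<open>t\<close> vanishes at \<open>R\<close>, then at \<open>e1\<close>, and \<open>e1\<close> is
  independent of \<open>q 1\<close>. In the normal case \<open>e1\<close> itself lies in both strips.
\<close>

lemma inter_spans:
  fixes t :: "'k::field_char_0 \<times> 'k"
  assumes R: "2 \<le> pairing R v1" "2 \<le> pairing R v2" "D < pairing R v2"
    and zero: "\<forall>x\<in>K1 R \<inter> K2 R. linear_form t x = 0"
  shows "linear_form t z = 0"
proof -
  have q1: "pairing (q 1) v1 = 1" "0 < pairing (q 1) v2" "pairing (q 1) v2 \<le> D"
    using p1 q_pos[of 1] by (simp_all add: e1)
  have "q 1 \<in> K1 R \<inter> K2 R"
    using q1 R q_mem[of 1] by (intro IntI strip1_ltI strip2_ltI) auto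
  with zero have tq: "linear_form t (q 1) = 0" by blast
  have te: "linear_form t e1 = 0"
  proof (cases "l1 = 1")
    case True
    have "e1 \<in> S" using ray1_mem[of 1] True by simp
    then have "e1 \<in> K1 R \<inter> K2 R" using R by (intro IntI strip1_ltI strip2_ltI) (auto simp: e1)
    with zero show ?thesis by blast
  next
    case False
    then have l1: "3 \<le> l1" using indices by auto
    have "R - q 1 \<in> S" using q1 R by (intro interior_mem) (auto simp only: pairing_diff)
    then have "R - q 1 \<in> K1 R \<inter> K2 R"
      using q1 by (intro IntI strip1_ltI strip2_ltI) (auto simp only: pairing_diff)
    with zero have "linear_form t (R - q 1) = 0" by blast
    with tq have tR: "linear_form t R = 0" by (simp only: linear_form_diff) simp
    have S: "R - e1 \<in> S" using R by (intro interior_mem) (auto simp: e1)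
    have "R - e1 \<noteq> R + (j * l1) \<cdot> e1" for j
    proof
      assume eq: "R - e1 = R + (j * l1) \<cdot> e1"
      from arg_cong[OF eq, of "\<lambda>x. pairing x v2"] have "(- 1) * D = (j * l1) * D" by (simp add: e1)
      then have "- 1 = j * l1" using D_pos by (simp only: mult_cancel_right) auto
      then have "l1 * (- j) = 1" by (simp add: mult.commute)
      then have "l1 dvd 1" by (metis dvd_triv_left)
      then show False using l1 zdvd_imp_le[of l1 1] by simp
    qed
    then have "R - e1 \<in> K1 R" using S by (simp add: strip_def e1)
    moreover have "R - e1 \<in> K2 R" using S D_pos by (intro strip2_ltI) (auto simp: e1)
    ultimately have "linear_form t (R - e1) = 0" using zero by blast
    with tR show ?thesis by (simp add: linear_form_diff)
  qed
  have "fst (q 1) * snd e1 \<noteq> snd (q 1) * fst e1"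
    by (rule independentI) (use D_pos in \<open>simp add: p1 e1\<close>)
  from linear_form_eq_zero[OF this tq te] show ?thesis .
qed

lemma upper_edge_corner:
  assumes "pairing x v1 = pairing R v1" "0 < pairing x v2" "pairing x v2 \<le> pairing R v2" "pairing R v2 \<le> D"
  shows "x = R"
proof -
  obtain n where n: "x - R = n \<cdot> e1" using basis1[of "x - R"] assms(1) by auto
  then have "pairing x v2 - pairing R v2 = n * D"
    using e1(2) by (metis pairing_diff pairing_zscale)
  then have "- D < n * D" "n * D \<le> 0" using assms(2-4) by linarith+
  then have "- 1 < n" "n \<le> 0"
    using D_pos mult_less_cancel_right[of "-1" D n] by (auto simp: mult_le_0_iff)
  then have "n = 0" by linarith
  then show ?thesis using n by simp
qed

text \<open>
  A nonzero \<open>x\<close> can only be \<open>e1\<close>, with \<open>l1 = 1\<close> and \<open>e1\<close> at the height of \<open>R\<close> over the second edge. Then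
  \<open>e1\<close> lies on \<open>R + \<int> e2\<close>, which is removed from the second strip because also \<open>l2 = 1\<close>.
\<close>

lemma inter_ray1_eq_zero:
  assumes x: "x \<in> K2 R" "0 \<le> n" "x = (n * l1) \<cdot> e1" and R: "pairing R v2 \<le> D"
  shows "x = 0"
proof -
  have x2: "pairing x v2 = n * l1 * D" by (simp add: x(3) e1)
  have le: "pairing x v2 \<le> pairing R v2" using x(1) by (simp add: strip_def)
  have "n = 0"
  proof (rule ccontr)
    assume "n \<noteq> 0"
    then have "1 \<le> n * l1" using x(2) l_pos mult_mono[of 1 n 1 l1] by simp
    moreover have "n * l1 * D \<le> 1 * D" using le R x2 by linarith
    then have "n * l1 \<le> 1" by (rule mult_right_le_imp_le[OF _ D_pos])
    ultimately have nl: "n * l1 = 1" by simp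
    then have "l1 dvd 1" by (metis dvd_triv_right)
    then have "l2 = 1" using indices zdvd_imp_le[of l1 1] by auto
    have "x = e1" using x(3) nl by simp
    have "pairing R v2 = D" using x2 nl le R by simp
    then have "pairing (e1 - R) v2 = 0" by (simp add: e1)
    then obtain j where "e1 - R = j \<cdot> e2" using basis2[of "e1 - R"] by auto
    then have "x = R + (j * l2) \<cdot> e2" by (simp add: \<open>l2 = 1\<close> \<open>x = e1\<close> diff_eq_eq add.commute)
    with x(1) show False by (auto simp: strip_def)
  qed
  with x(3) show ?thesis by simp
qed

end

context cone_monoid
begin

interpretation sw: cone_monoid v2 v1 e2 e1 D p2 p1 l2 l1 by (rule monoid_swap)

lemma inter_box:
  assumes R: "pairing R v1 \<le> D" "pairing R v2 \<le> D"
  shows "box R \<subseteq> K1 R \<inter> K2 R" "K1 R \<inter> K2 R \<subseteq> insert 0 (box R)"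
proof -
  show "box R \<subseteq> K1 R \<inter> K2 R"
    by (auto simp: box_def intro!: strip1_ltI strip2_ltI interior_mem)
  show "K1 R \<inter> K2 R \<subseteq> insert 0 (box R)"
  proof
    fix x assume x: "x \<in> K1 R \<inter> K2 R"
    then have le: "pairing x v1 \<le> pairing R v1" "pairing x v2 \<le> pairing R v2" and "x \<in> S"
      by (auto simp: strip_def)
    have "x \<noteq> R + (0 * l1) \<cdot> e1" using x unfolding strip_def by blast
    then have "x \<noteq> R" by simp
    from \<open>x \<in> S\<close> show "x \<in> insert 0 (box R)"
    proof (cases rule: mem_cases)
      case interior
      then have "pairing x v1 \<noteq> pairing R v1" "pairing x v2 \<noteq> pairing R v2"
        using upper_edge_corner[of x R] sw.upper_edge_corner[of x R] le R \<open>x \<noteq> R\<close> by auto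
      with interior le show ?thesis by (simp add: box_def)
    next
      case (ray1 n)
      then show ?thesis using inter_ray1_eq_zero[of x R n] x R(2) by simp
    next
      case (ray2 n)
      then show ?thesis using sw.inter_ray1_eq_zero[of x R n] x R(1) by (simp add: S_swap)
    qed
  qed
qed

text \<open>
  Additive functions on the first strip are linear, so the question is which linear forms vanish on the
  intersection. If \<open>R\<close> is higher than \<open>e1\<close> or \<open>e2\<close>, there are none (\<open>inter_spans\<close>); otherwise the
  intersection is the box and \<open>0\<close> (\<open>inter_box\<close>), for all covering indices.
\<close>

lemma evaluation_basis_wide:
  assumes R: "2 \<le> pairing R v1" "2 \<le> pairing R v2"
  shows "\<exists>P. evaluation_basis TYPE('k::field_char_0) S (K1 R) (K1 R \<inter> K2 R) P \<and> card P = box_defect R"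
proof -
  let ?Z = "K1 R \<inter> K2 R"
  have mem: "l1 \<cdot> e1 \<in> K1 R" "q 1 \<in> K1 R"
    using ray1_strip1[of 1 R] q_strip1[of 1 R] R by auto
  have empty: ?thesis if "\<And>t :: 'k \<times> 'k. \<forall>x\<in>?Z. linear_form t x = 0 \<Longrightarrow> \<forall>x. linear_form t x = 0" "box_defect R = 0"
    using that by (intro exI[of _ "{}"] conjI evaluation_basis_linear R) auto
  consider "D < pairing R v2" | "D < pairing R v1" | "pairing R v1 \<le> D" "pairing R v2 \<le> D" by linarith
  then show ?thesis
  proof cases
    case 1
    then show ?thesis using inter_spans[OF R 1] by (intro empty) (auto simp: box_defect_def)
  next
    case 2
    have "linear_form t x = 0" if "\<forall>x\<in>?Z. linear_form t x = 0" for t :: "'k \<times> 'k" and x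
      using sw.inter_spans[OF R(2,1) 2, of t x] that by (auto simp: S_swap)
    then show ?thesis using 2 by (intro empty) (auto simp: box_defect_def)
  next
    case 3
    note Z = inter_box[OF 3]
    show ?thesis
    proof (cases "box R = {}")
      case True
      have indep: "fst (l1 \<cdot> e1) * snd (q 1) \<noteq> snd (l1 \<cdot> e1) * fst (q 1)"
        by (rule independentI) (use D_pos l_pos in \<open>simp add: p1 e1\<close>)
      have ne: "l1 \<cdot> e1 \<noteq> q 1" by (simp add: coords_eq_iff p1 e1)
      have "evaluation_basis TYPE('k) S (K1 R) ?Z {l1 \<cdot> e1, q 1}"
      proof (rule evaluation_basis_linear[OF R(1)])
        fix t :: "'k \<times> 'k" assume "\<forall>x\<in>?Z \<union> {l1 \<cdot> e1, q 1}. linear_form t x = 0"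
        then show "\<forall>x\<in>K1 R. linear_form t x = 0" using linear_form_eq_zero[OF indep, of t] by simp
      next
        have Z0: "linear_form t x = 0" if "x \<in> ?Z" for t :: "'k \<times> 'k" and x
          using Z(2) that True by auto
        fix p assume "p \<in> {l1 \<cdot> e1, q 1}"
        moreover obtain t :: "'k \<times> 'k" where "linear_form t (l1 \<cdot> e1) = 1" "linear_form t (q 1) = 0"
          using linear_form_exists[OF indep] by blast
        moreover obtain t' :: "'k \<times> 'k" where "linear_form t' (l1 \<cdot> e1) = 0" "linear_form t' (q 1) = 1"
          using linear_form_exists[OF indep] by blast
        ultimately show "\<exists>t :: 'k \<times> 'k. (\<forall>x\<in>?Z. linear_form t x = 0) \<and> linear_form t p = 1 \<and>
            (\<forall>p'\<in>{l1 \<cdot> e1, q 1} - {p}. linear_form t p' = 0)"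
          using Z0 by (elim insertE) (auto intro: exI[of _ t] exI[of _ t'])
      qed (use mem in auto)
      moreover have "card {l1 \<cdot> e1, q 1} = box_defect R" using ne 3 True by (simp add: box_defect_def)
      ultimately show ?thesis by blast
    next
      case False
      then obtain x0 where x0: "x0 \<in> box R" by blast
      show ?thesis
      proof (cases "\<exists>x\<in>box R. \<exists>y\<in>box R. fst x * snd y \<noteq> snd x * fst y")
        case True
        then obtain x y where xy: "x \<in> box R" "y \<in> box R" "fst x * snd y \<noteq> snd x * fst y" by blast
        have "\<forall>z. linear_form t z = 0" if "\<forall>x\<in>?Z. linear_form t x = 0" for t :: "'k \<times> 'k"
          using that xy Z(1) linear_form_eq_zero[OF xy(3), of t] by blast
        moreover have "box_defect R = 0" unfolding box_defect_def using 3 False True by simp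
        ultimately show ?thesis by (rule empty)
      next
        case dep: False
        have x0': "0 < pairing x0 v1" using x0 by (simp add: box_def)
        then have "x0 \<noteq> 0" by auto
        have indep: "fst x0 * snd (l1 \<cdot> e1) \<noteq> snd x0 * fst (l1 \<cdot> e1)"
          by (rule independentI) (use D_pos l_pos x0' in \<open>simp add: e1\<close>)
        have "evaluation_basis TYPE('k) S (K1 R) ?Z {l1 \<cdot> e1}"
        proof (rule evaluation_basis_linear[OF R(1)])
          fix t :: "'k \<times> 'k" assume "\<forall>x\<in>?Z \<union> {l1 \<cdot> e1}. linear_form t x = 0"
          then have "linear_form t x0 = 0" "linear_form t (l1 \<cdot> e1) = 0" using x0 Z(1) by auto
          then show "\<forall>x\<in>K1 R. linear_form t x = 0" using linear_form_eq_zero[OF indep, of t] by simp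
        next
          obtain t :: "'k \<times> 'k" where t: "linear_form t x0 = 0" "linear_form t (l1 \<cdot> e1) = 1"
            using linear_form_exists[OF indep] by blast
          have "linear_form t x = 0" if "x \<in> ?Z" for x
          proof (cases "x = 0")
            case False
            with that Z(2) have "x \<in> box R" by blast
            then have "fst x0 * snd x = snd x0 * fst x" using dep x0 by blast
            then show ?thesis by (rule linear_form_parallel[OF t(1) \<open>x0 \<noteq> 0\<close>])
          qed simp
          with t(2) show "\<exists>t :: 'k \<times> 'k. (\<forall>x\<in>?Z. linear_form t x = 0) \<and> linear_form t p = 1 \<and>
              (\<forall>p'\<in>{l1 \<cdot> e1} - {p}. linear_form t p' = 0)" if "p \<in> {l1 \<cdot> e1}" for p
            using that by (intro exI[of _ t]) auto
        qed (use mem in auto)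
        moreover have "card {l1 \<cdot> e1} = box_defect R" using 3 False dep by (simp add: box_defect_def)
        ultimately show ?thesis by blast
      qed
    qed
  qed
qed

end


section \<open>The dimension formula in a cone frame\<close>

lemma inv_eqI: "inj p \<Longrightarrow> p m = x \<Longrightarrow> inv p x = m"
  by (metis inv_f_f)

context cone_monoid
begin

lemma inj_lines: "inj (\<lambda>n. n \<cdot> e1)" "inj q"
  using D_pos by (auto intro!: injI simp: coords_eq_iff e1)

abbreviation "contribution1 R \<equiv> local_contribution (\<lambda>n. n \<cdot> e1) q (nat l1) (D = 1) (- R)"

lemma contribution_other:
  assumes "pairing R v1 \<noteq> 0" "pairing R v1 \<noteq> 1"
  shows "contribution1 R = 0"
proof -
  have "R \<notin> range (\<lambda>n. n \<cdot> e1)" "R \<notin> range q" using assms by (auto simp: e1 p1)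
  then show ?thesis by (simp add: local_contribution_def)
qed

lemma contribution_level0:
  assumes "R = m \<cdot> e1"
  shows "contribution1 R = (if 1 \<le> m \<and> m < l1 then 1 else 0)"
proof -
  have "R \<in> range (\<lambda>n. n \<cdot> e1)" "inv (\<lambda>n. n \<cdot> e1) R = m"
    using assms inv_eqI[OF inj_lines(1), of m R] by auto
  then show ?thesis using l_pos by (simp add: local_contribution_def)
qed

lemma contribution_level1:
  assumes "R = q m"
  shows "contribution1 R = (if m \<le> 0 then nat l1 - 2 else if m = 1 then nat l1 - 1
    else if m < l1 then nat (l1 - m + 1) else if m = l1 \<and> D \<noteq> 1 then 1 else 0)"
proof -
  have "R \<notin> range (\<lambda>n. n \<cdot> e1)" using assms by (auto simp: coords_eq_iff e1 p1)
  moreover have "R \<in> range q" "inv q R = m"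
    using assms inv_eqI[OF inj_lines(2), of m R] by auto
  ultimately show ?thesis using l_pos by (simp add: local_contribution_def Let_def)
qed

lemma D_eq_1_iff: "D = 1 \<longleftrightarrow> pairing p1 v2 = 0"
proof
  assume "D = 1"
  then show "pairing p1 v2 = 0" using p1 by simp
next
  assume "pairing p1 v2 = 0"
  then obtain n where "p1 = n \<cdot> e2" using basis2[of p1] by auto
  then have "n * D = 1" using p1(1) by (simp add: e2)
  then show "D = 1" using D_pos by (metis dvd_triv_right zdvd1_eq abs_of_pos)
qed

lemma level1_index:
  assumes "R = q m"
  shows "1 \<le> m \<longleftrightarrow> 0 < pairing R v2" "(m - 1) * D < pairing R v2" "pairing R v2 \<le> m * D"
    "pairing R v2 = m * D \<longleftrightarrow> D = 1"
proof -
  have R: "pairing R v2 = pairing p1 v2 + m * D" by (simp add: assms e1)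
  show *: "(m - 1) * D < pairing R v2" "pairing R v2 \<le> m * D"
    using p1 by (simp_all add: R left_diff_distrib)
  show "pairing R v2 = m * D \<longleftrightarrow> D = 1" unfolding D_eq_1_iff R by simp
  show "1 \<le> m \<longleftrightarrow> 0 < pairing R v2"
  proof
    assume "1 \<le> m"
    then have "0 \<le> (m - 1) * D" using D_pos by simp
    with * show "0 < pairing R v2" by linarith
  next
    assume "0 < pairing R v2"
    with * have "0 < m * D" by linarith
    with D_pos show "1 \<le> m" by (simp add: zero_less_mult_iff)
  qed
qed

end

locale seminormal_pair = X: cone_monoid v1 v2 e1 e2 D p1 p2 l1 l2
  for v1 v2 e1 e2 :: lattice and D :: int and p1 p2 :: lattice and l1 l2 :: int +
  fixes w :: "'v::finite \<Rightarrow> lattice" and w' :: "'x::finite \<Rightarrow> lattice"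
  assumes large: "3 \<le> l1" "3 \<le> l2"
    and presented: "presented_monoid (axis_monoid v1 v2 e1 e2 l1 l2) w"
    and presented_normal: "presented_monoid (axis_monoid v1 v2 e1 e2 1 1) w'"
begin

sublocale N: cone_monoid v1 v2 e1 e2 D p1 p2 1 1
  by unfold_locales simp

interpretation sX: cone_monoid v2 v1 e2 e1 D p2 p1 l2 l1 by (rule X.monoid_swap)
interpretation sN: cone_monoid v2 v1 e2 e1 D p2 p1 1 1 by (rule N.monoid_swap)

text \<open>
  For both monoids \<open>T\<^sup>1\<close> consists of the functions on the first strip which vanish on the intersection;
  the contribution of the first ray is the difference of the two dimensions.
\<close>

lemma T1_dim_second_wide:
  assumes "2 \<le> pairing R v2"
  shows "T1_dim TYPE('k::field_char_0) X.S w (- R) =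
    enat (X.contribution1 R) + T1_dim TYPE('k) N.S w' (- R)"
proof -
  note TX = X.T1_dim_second_strip[OF presented assms]
  note TN = N.T1_dim_second_strip[OF presented_normal assms]
  consider "pairing R v1 < 0" | "pairing R v1 = 0" | "pairing R v1 = 1" | "2 \<le> pairing R v1" by linarith
  then show ?thesis
  proof cases
    case 1
    have "T1_dim TYPE('k) X.S w (- R) = enat (card ({} :: lattice set))"
      by (rule TX[OF X.evaluation_basis_negative[OF 1]])
    moreover have "T1_dim TYPE('k) N.S w' (- R) = enat (card ({} :: lattice set))"
      by (rule TN[OF N.evaluation_basis_negative[OF 1]])
    ultimately show ?thesis using 1 X.contribution_other[of R] by (simp add: zero_enat_def)
  next
    case 2
    obtain m where R: "R = m \<cdot> e1" using X.basis1[of R] 2 by auto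
    have "0 < m * D" using assms by (simp add: R X.e1)
    then have m: "1 \<le> m" using X.D_pos by (simp add: zero_less_mult_iff)
    have "T1_dim TYPE('k) X.S w (- R) = enat (card (if m < l1 then {l1 \<cdot> e1} else {}))"
      by (rule TX[OF X.evaluation_basis_level0[OF m R]])
    moreover have "T1_dim TYPE('k) N.S w' (- R) = enat (card (if m < 1 then {1 \<cdot> e1} else {}))"
      by (rule TN[OF N.evaluation_basis_level0[OF m R]])
    ultimately show ?thesis using X.contribution_level0[OF R] m by (simp add: zero_enat_def)
  next
    case 3
    obtain m where R: "R = p1 + m \<cdot> e1" using X.basis1[of R] 3 by auto
    note index = X.level1_index[OF R]
    have m: "1 \<le> m" using index(1) assms by simp
    have ne: "D \<noteq> pairing R v2"
    proof
      assume eq: "D = pairing R v2"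
      then have "(m - 1) * D < 1 * D" using index(2) by simp
      then have "m = 1" using X.D_pos m by (simp only: mult_less_cancel_right) simp
      then have "D = 1" using index(4) eq by simp
      with eq assms show False by simp
    qed
    have X: "T1_dim TYPE('k) X.S w (- R) = enat (nat (l1 - m) + (if l1 * D \<le> pairing R v2 then 0 else 1))"
      using TX[OF X.evaluation_basis_level1(1)[OF m R]] X.evaluation_basis_level1(2)[OF m R] large by simp
    have N: "T1_dim TYPE('k) N.S w' (- R) = enat (nat (1 - m) + (if D \<le> pairing R v2 then 0 else 1))"
      using TN[OF N.evaluation_basis_level1(1)[OF m R]] N.evaluation_basis_level1(2)[OF m R] ne by simp
    have mono: "a * D \<le> b * D \<longleftrightarrow> a \<le> b" for a b using X.D_pos by simp
    consider "m = 1" | "2 \<le> m" "m < l1" | "2 \<le> m" "m = l1" | "l1 < m" using m by linarith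
    then show ?thesis
    proof cases
      case 1
      have "D < l1 * D" using mono[of l1 1] large by simp
      then show ?thesis using X N index(3) ne 1 X.contribution_level1[OF R] large by simp
    next
      case 2
      have "m * D < l1 * D" "1 * D \<le> (m - 1) * D" using mono[of l1 m] mono[of 1 "m - 1"] 2 by auto
      then show ?thesis using X N index(2,3) 2 X.contribution_level1[OF R] by simp
    next
      case 3
      have "1 * D \<le> (m - 1) * D" using mono[of 1 "m - 1"] 3 by auto
      then show ?thesis using X N index(2,3,4) 3 X.contribution_level1[OF R] large
        by (auto simp: zero_enat_def one_enat_def)
    next
      case 4
      have "1 * D \<le> (m - 1) * D" "l1 * D \<le> (m - 1) * D"
        using mono[of 1 "m - 1"] mono[of l1 "m - 1"] 4 large by auto
      then show ?thesis using X N index(2) 4 X.contribution_level1[OF R] large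
        by (simp add: zero_enat_def)
    qed
  next
    case 4
    obtain P where P: "evaluation_basis TYPE('k) X.S (X.K1 R) (X.K1 R \<inter> X.K2 R) P" "card P = X.box_defect R"
      using X.evaluation_basis_wide[OF 4 assms] by blast
    obtain P' where P': "evaluation_basis TYPE('k) N.S (N.K1 R) (N.K1 R \<inter> N.K2 R) P'" "card P' = X.box_defect R"
      using N.evaluation_basis_wide[OF 4 assms] by blast
    show ?thesis
      using TX[OF P(1)] TN[OF P'(1)] P(2) P'(2) X.contribution_other[of R] 4 by (simp add: zero_enat_def)
  qed
qed

lemma T1_dim_normal_zero:
  assumes "pairing R v1 \<le> 1" "pairing R v2 \<le> 1"
  shows "T1_dim TYPE('k::field_char_0) N.S w' (- R) = 0"
proof (rule N.T1_dim_axes[OF presented_normal])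
  fix x assume "x \<in> shift_gap N.S (- R)"
  then have "x \<in> N.K1 R \<or> x \<in> N.K2 R" by (simp add: N.gap_eq)
  then show "pairing x v1 = 0 \<or> pairing x v2 = 0"
    using N.strip1_level0[of x R] sN.strip1_level0[of x R] assms by (auto simp: N.S_swap)
qed

lemma T1_dim_formula_le:
  assumes le: "pairing R v1 \<le> pairing R v2"
  shows "T1_dim TYPE('k::field_char_0) X.S w (- R) =
    enat (X.contribution1 R) + enat (sX.contribution1 R) + T1_dim TYPE('k) N.S w' (- R)"
proof -
  consider "2 \<le> pairing R v2" | "pairing R v2 = 1" | "pairing R v2 \<le> 0" by linarith
  then show ?thesis
  proof cases
    case 1
    then show ?thesis
      using T1_dim_second_wide[OF 1, where 'k = 'k] sX.contribution_other[of R] by (simp add: zero_enat_def)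
  next
    case 2
    obtain m where R: "R = p2 + m \<cdot> e2" using X.basis2[of R] 2 by auto
    note index = sX.level1_index[OF R]
    have N: "T1_dim TYPE('k) N.S w' (- R) = 0" using 2 le by (intro T1_dim_normal_zero) auto
    have m: "m \<le> 1"
    proof (rule ccontr)
      assume "\<not> m \<le> 1"
      then have "1 * D \<le> (m - 1) * D" using X.D_pos by simp
      with index(2) le 2 X.D_pos show False by linarith
    qed
    note TX = X.T1_dim_level1[OF presented large(2) R m]
    consider "pairing R v1 < 0" | "pairing R v1 = 0" | "pairing R v1 = 1" using le 2 by linarith
    then show ?thesis
    proof cases
      case 1
      then have "m \<le> 0" using index(1) by linarith
      then show ?thesis
        using TX[OF _ X.evaluation_basis_negative[OF 1]] 1 N X.contribution_other[of R] sX.contribution_level1[OF R]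
        by simp
    next
      case 2
      then have "m \<le> 0" using index(1) by linarith
      obtain n where Rn: "R = n \<cdot> e1" using X.basis1[of R] 2 by auto
      have "n * D = 1" using \<open>pairing R v2 = 1\<close> by (simp add: Rn X.e1)
      then have n: "n = 1" using X.D_pos by (metis zmult_eq_1_iff less_minus_one_simps(1) not_less_iff_gr_or_eq)
      show ?thesis
        using TX[OF _ X.evaluation_basis_level0[OF _ Rn]] 2 n large N \<open>m \<le> 0\<close>
          X.contribution_level0[OF Rn] sX.contribution_level1[OF R]
        by simp
    next
      case 3
      then have m1: "m = 1" using index(1) m by linarith
      obtain n where Rn: "R = p1 + n \<cdot> e1" using X.basis1[of R] 3 by auto
      note index' = X.level1_index[OF Rn]
      have n: "n = 1"
      proof -
        have "1 \<le> n" using index'(1) \<open>pairing R v2 = 1\<close> by simp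
        moreover have "\<not> 2 \<le> n"
        proof
          assume "2 \<le> n"
          then have "1 * D \<le> (n - 1) * D" using X.D_pos by simp
          with index'(2) \<open>pairing R v2 = 1\<close> X.D_pos show False by linarith
        qed
        ultimately show ?thesis by linarith
      qed
      have lD: "1 < l1 * D" using large X.D_pos mult_mono[of 3 l1 1 D] by simp
      have "T1_dim TYPE('k) X.S w (- R) = enat (nat l2 - 2 + (nat (l1 - 1) + 1))"
        using TX[OF _ X.evaluation_basis_level1(1)[OF _ Rn]] X.evaluation_basis_level1(2)[OF _ Rn]
          3 n lD \<open>pairing R v2 = 1\<close> by simp
      then show ?thesis
        using N n m1 large X.contribution_level1[OF Rn] sX.contribution_level1[OF R]
        by (simp add: nat_diff_distrib) arith
    qed
  next
    case 3
    have "pairing x v1 = 0 \<or> pairing x v2 = 0" if x: "x \<in> shift_gap X.S (- R)" for x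
    proof -
      have "pairing x v1 \<le> 0 \<or> pairing x v2 \<le> 0" "x \<in> X.S"
        using x le 3 unfolding X.gap_eq by (auto simp: strip_def)
      with X.mem_nonneg[of x] show ?thesis by linarith
    qed
    then have X: "T1_dim TYPE('k) X.S w (- R) = 0" by (rule X.T1_dim_axes[OF presented])
    have N: "T1_dim TYPE('k) N.S w' (- R) = 0" using 3 le by (intro T1_dim_normal_zero) auto
    have "X.contribution1 R = 0"
    proof (cases "pairing R v1 = 0")
      case True
      then obtain n where n: "R = n \<cdot> e1" using X.basis1[of R] by auto
      then have "n * D \<le> 0" using 3 by (simp add: X.e1)
      then have "n \<le> 0" using X.D_pos by (simp add: mult_le_0_iff)
      then show ?thesis using X.contribution_level0[OF n] by simp
    next
      case False
      then show ?thesis using le 3 by (intro X.contribution_other) auto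
    qed
    moreover have "sX.contribution1 R = 0"
    proof (cases "pairing R v2 = 0")
      case True
      then obtain n where n: "R = n \<cdot> e2" using X.basis2[of R] by auto
      then have "n * D \<le> 0" using le True by (simp add: X.e2)
      then have "n \<le> 0" using X.D_pos by (simp add: mult_le_0_iff)
      then show ?thesis using sX.contribution_level0[OF n] by simp
    next
      case False
      then show ?thesis using 3 by (intro sX.contribution_other) auto
    qed
    ultimately show ?thesis using X N by (simp add: zero_enat_def)
  qed
qed

end

context seminormal_pair
begin

lemma pair_swap: "seminormal_pair v2 v1 e2 e1 D p2 p1 l2 l1 w w'"
  using X.monoid_swap large presented presented_normal
  by (simp add: seminormal_pair_def seminormal_pair_axioms_def X.S_swap N.S_swap)

interpretation sw: seminormal_pair v2 v1 e2 e1 D p2 p1 l2 l1 w w' by (rule pair_swap)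

lemma T1_dim_formula:
  "T1_dim TYPE('k::field_char_0) X.S w (- R) =
    enat (X.contribution1 R) + enat (sw.X.contribution1 R) + T1_dim TYPE('k) N.S w' (- R)"
proof (cases "pairing R v1 \<le> pairing R v2")
  case True
  then show ?thesis by (rule T1_dim_formula_le)
next
  case False
  then show ?thesis
    using sw.T1_dim_formula_le[of R, where 'k = 'k] by (simp add: X.S_swap N.S_swap add_ac)
qed

end


section \<open>Two-dimensional cones and their faces\<close>

interpretation qspace: vector_space qscale by (rule vector_space_qscale)

lemma pairing_commute: "pairing x y = pairing y x"
  by (simp add: pairing_def mult.commute)

lemma pairing_zero_right [simp]: "pairing x 0 = 0"
  by (simp add: pairing_def)

lemma pairing_qscale [simp]: "pairing (qscale c x) y = c * pairing x y"
  by (simp add: pairing_def qscale_def algebra_simps)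

lemma pairing_rat_point: "pairing (rat_point m) (rat_point v) = of_int (pairing m v)"
  by (simp add: pairing_def rat_point_def)

lemma qscale_one: "qscale 1 x = x"
  by (simp add: qscale_def)

lemma primitive_parallel:
  fixes v v' :: lattice
  assumes "coprime (fst v) (snd v)" "coprime (fst v') (snd v')" and eq: "fst v * snd v' = snd v * fst v'"
  shows "v' = v \<or> v' = - v"
proof -
  have "fst v dvd snd v * fst v'" "fst v' dvd fst v * snd v'" "snd v dvd fst v * snd v'" "snd v' dvd snd v * fst v'"
    using eq by (metis dvd_triv_left dvd_triv_right)+
  then have "fst v dvd fst v'" "fst v' dvd fst v" "snd v dvd snd v'" "snd v' dvd snd v"
    using assms(1,2) by (simp_all add: coprime_dvd_mult_right_iff coprime_dvd_mult_left_iff coprime_commute)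
  then have "\<bar>fst v\<bar> = \<bar>fst v'\<bar>" "\<bar>snd v\<bar> = \<bar>snd v'\<bar>" by (auto intro: zdvd_antisym_abs)
  then show ?thesis using eq by (auto simp: abs_eq_iff prod_eq_iff)
qed

lemma ray_parallel:
  assumes "rat_point v' \<in> ray v"
  shows "fst v * snd v' = snd v * fst v'"
proof -
  obtain c :: rat where c: "of_int (fst v') = c * of_int (fst v)" "of_int (snd v') = c * of_int (snd v)"
    using assms by (auto simp: ray_def rat_point_def qscale_def)
  have "of_int (fst v * snd v') = (of_int (snd v * fst v') :: rat)"
    by (simp add: c algebra_simps)
  then show ?thesis by (simp only: of_int_eq_iff)
qed

text \<open>
  Otherwise a small multiple of \<open>z\<close> could be subtracted from \<open>x\<close> without leaving the cone.
\<close>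

lemma relint_pos:
  assumes x: "x \<in> relint C" and z: "z \<in> C" "0 < pairing z V" and C: "\<And>y. y \<in> C \<Longrightarrow> 0 \<le> pairing y V"
  shows "0 < pairing x V"
proof (rule ccontr)
  assume "\<not> 0 < pairing x V"
  from x obtain e where e: "x \<in> C" "0 < e" "\<And>y. y \<in> module.span qscale C \<Longrightarrow>
      \<bar>fst y - fst x\<bar> < e \<Longrightarrow> \<bar>snd y - snd x\<bar> < e \<Longrightarrow> y \<in> C"
    by (auto simp: relint_def)
  define s where "s = 1 + \<bar>fst z\<bar> + \<bar>snd z\<bar>"
  have s: "0 < s" "\<bar>fst z\<bar> < s" "\<bar>snd z\<bar> < s" by (auto simp: s_def)
  define y where "y = x - qscale (e / s) z"
  have "\<bar>fst y - fst x\<bar> = e / s * \<bar>fst z\<bar>" "\<bar>snd y - snd x\<bar> = e / s * \<bar>snd z\<bar>"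
    using e(2) s(1) by (simp_all add: y_def qscale_def abs_mult)
  moreover have "e / s * \<bar>fst z\<bar> < e" "e / s * \<bar>snd z\<bar> < e"
    using e(2) s by (simp_all add: field_simps)
  moreover have "y \<in> module.span qscale C"
    unfolding y_def using e(1) z(1)
    by (intro qspace.span_diff qspace.span_scale qspace.span_base)
  ultimately have "y \<in> C" using e(3) by simp
  then have "0 \<le> pairing y V" by (rule C)
  then have "0 \<le> pairing x V - e / s * pairing z V" by (simp add: y_def)
  moreover have "0 < e / s * pairing z V" using e(2) s(1) z(2) by simp
  ultimately show False using \<open>\<not> 0 < pairing x V\<close> by linarith
qed

lemma pairing_pos_open:
  fixes x V :: ratvec
  assumes "0 < pairing x V"
  shows "\<exists>e>0. \<forall>y. \<bar>fst y - fst x\<bar> < e \<longrightarrow> \<bar>snd y - snd x\<bar> < e \<longrightarrow> 0 < pairing y V"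
proof -
  define s where "s = 1 + \<bar>fst V\<bar> + \<bar>snd V\<bar>"
  have s: "0 < s" by (auto simp: s_def)
  define e where "e = pairing x V / s"
  have e: "0 < e" using assms s by (simp add: e_def)
  have "0 < pairing y V" if y: "\<bar>fst y - fst x\<bar> < e" "\<bar>snd y - snd x\<bar> < e" for y
  proof -
    have "\<bar>pairing (y - x) V\<bar> \<le> \<bar>fst y - fst x\<bar> * \<bar>fst V\<bar> + \<bar>snd y - snd x\<bar> * \<bar>snd V\<bar>"
      unfolding pairing_def by (simp flip: abs_mult)
    also have "\<dots> \<le> e * \<bar>fst V\<bar> + e * \<bar>snd V\<bar>"
      using y by (intro add_mono mult_right_mono) auto
    also have "\<dots> < e * s" using e by (simp add: s_def distrib_left)
    also have "\<dots> = pairing x V" using s by (simp add: e_def)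
    finally show ?thesis by simp
  qed
  with e show ?thesis by blast
qed

lemma relintI:
  assumes "x \<in> C" "0 < pairing x V" "0 < pairing x V'"
    and "\<And>y. y \<in> module.span qscale C \<Longrightarrow> 0 < pairing y V \<Longrightarrow> 0 < pairing y V' \<Longrightarrow> y \<in> C"
  shows "x \<in> relint C"
proof -
  obtain e where e: "0 < e" "\<And>y. \<bar>fst y - fst x\<bar> < e \<Longrightarrow> \<bar>snd y - snd x\<bar> < e \<Longrightarrow> 0 < pairing y V"
    using pairing_pos_open[OF assms(2)] by blast
  obtain e' where e': "0 < e'" "\<And>y. \<bar>fst y - fst x\<bar> < e' \<Longrightarrow> \<bar>snd y - snd x\<bar> < e' \<Longrightarrow> 0 < pairing y V'"
    using pairing_pos_open[OF assms(3)] by blast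
  have "\<forall>y\<in>module.span qscale C. \<bar>fst y - fst x\<bar> < min e e' \<and> \<bar>snd y - snd x\<bar> < min e e' \<longrightarrow> y \<in> C"
    using e(2) e'(2) assms(4) by simp
  then show ?thesis unfolding relint_def using assms(1) e(1) e'(1)
    by (intro CollectI conjI exI[of _ "min e e'"]) auto
qed

locale cone_rays =
  fixes C :: "ratvec set" and v1 v2 :: lattice
  assumes prim1: "primitive_ray_generator (dual_cone C) v1"
    and prim2: "primitive_ray_generator (dual_cone C) v2"
    and ne: "v1 \<noteq> v2"
begin

abbreviation "\<sigma> \<equiv> dual_cone C"
abbreviation "V1 \<equiv> rat_point v1"
abbreviation "V2 \<equiv> rat_point v2"

lemma rays_swap: "cone_rays C v2 v1"
  using prim1 prim2 ne by (simp add: cone_rays_def)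

lemma cone_add: "x \<in> \<sigma> \<Longrightarrow> y \<in> \<sigma> \<Longrightarrow> x + y \<in> \<sigma>"
  by (simp add: dual_cone_def pairing_commute[of _ "x + y"]) (simp add: pairing_commute)

lemma cone_scale: "0 \<le> c \<Longrightarrow> x \<in> \<sigma> \<Longrightarrow> qscale c x \<in> \<sigma>"
  by (simp add: dual_cone_def pairing_commute[of _ "qscale c x"]) (simp add: pairing_commute)

lemma ray_mem: "rat_point v \<in> ray v"
  unfolding ray_def by (intro CollectI exI[of _ 1]) (simp add: qscale_one)

lemma V_mem: "V1 \<in> \<sigma>" "V2 \<in> \<sigma>"
  using prim1 prim2 ray_mem[of v1] ray_mem[of v2] by (auto simp: primitive_ray_generator_def is_face_def)

text \<open>
  If they were dependent, the two primitive vectors would be opposite to each other; but a functional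
  cutting out one of the rays would then vanish on the other ray, too.
\<close>

lemma det: "fst v1 * snd v2 \<noteq> snd v1 * fst v2"
proof
  assume eq: "fst v1 * snd v2 = snd v1 * fst v2"
  have cop: "coprime (fst v1) (snd v1)" "coprime (fst v2) (snd v2)"
    using prim1 prim2 by (auto simp: primitive_ray_generator_def)
  then have opp: "v2 = - v1" using primitive_parallel[OF cop eq] ne by auto
  obtain m where m: "ray v1 = {v \<in> \<sigma>. pairing m v = 0}"
    using prim1 by (auto simp: primitive_ray_generator_def is_face_def)
  have "pairing m V1 = 0" using m ray_mem[of v1] by auto
  then have "pairing m V2 = 0" by (simp add: opp rat_point_def pairing_def)
  then have "V2 \<in> ray v1" using m V_mem by simp
  then obtain c :: rat where c: "0 \<le> c" "- of_int (fst v1) = c * of_int (fst v1)" "- of_int (snd v1) = c * of_int (snd v1)"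
    by (auto simp: ray_def opp rat_point_def qscale_def)
  then have "(c + 1) * of_int (fst v1) = 0" "(c + 1) * of_int (snd v1) = 0" by (simp_all add: distrib_right)
  with c(1) have "fst v1 = 0" "snd v1 = 0" by simp_all
  with cop(1) show False by simp
qed

lemma face_functional:
  obtains m where "m \<in> dual_cone \<sigma>" "pairing m V1 = 0" "0 < pairing m V2" "ray v1 = {v \<in> \<sigma>. pairing m v = 0}"
proof -
  obtain m where m: "m \<in> dual_cone \<sigma>" "ray v1 = {v \<in> \<sigma>. pairing m v = 0}"
    using prim1 by (auto simp: primitive_ray_generator_def is_face_def)
  have "pairing m V1 = 0" using m ray_mem[of v1] by auto
  moreover have "0 \<le> pairing m V2" using m(1) V_mem by (auto simp: dual_cone_def[of \<sigma>] pairing_commute)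
  moreover have "pairing m V2 \<noteq> 0"
  proof
    assume "pairing m V2 = 0"
    then have "V2 \<in> ray v1" using m V_mem by simp
    from ray_parallel[OF this] det show False by simp
  qed
  ultimately show ?thesis using m that by simp
qed

lemma decompose: "\<exists>a b. x = qscale a V1 + qscale b V2"
proof -
  define d :: rat where "d = of_int (fst v1 * snd v2 - snd v1 * fst v2)"
  have d: "d \<noteq> 0" using det by (simp add: d_def del: of_int_diff of_int_mult)
  let ?a = "(fst x * of_int (snd v2) - snd x * of_int (fst v2)) / d"
  let ?b = "(snd x * of_int (fst v1) - fst x * of_int (snd v1)) / d"
  have "?a * of_int (fst v1) + ?b * of_int (fst v2) = fst x * d / d"
    "?a * of_int (snd v1) + ?b * of_int (snd v2) = snd x * d / d"
    by (simp_all add: d_def algebra_simps flip: add_divide_distrib diff_divide_distrib)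
  then have "x = qscale ?a V1 + qscale ?b V2"
    using d by (simp add: prod_eq_iff qscale_def rat_point_def)
  then show ?thesis by blast
qed

end

context cone_rays
begin

interpretation sw: cone_rays C v2 v1 by (rule rays_swap)

text \<open>
  The functionals that cut out the two rays read off the coefficients up to positive factors.
\<close>

lemma mem_cone_iff: "x \<in> \<sigma> \<longleftrightarrow> (\<exists>a b. 0 \<le> a \<and> 0 \<le> b \<and> x = qscale a V1 + qscale b V2)"
proof
  assume x: "x \<in> \<sigma>"
  obtain a b where ab: "x = qscale a V1 + qscale b V2" using decompose by blast
  obtain m where m: "m \<in> dual_cone \<sigma>" "pairing m V1 = 0" "0 < pairing m V2" by (rule face_functional)
  obtain m' where m': "m' \<in> dual_cone \<sigma>" "pairing m' V2 = 0" "0 < pairing m' V1" by (rule sw.face_functional)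
  have "0 \<le> pairing x m" "0 \<le> pairing x m'" using x m(1) m'(1) by (auto simp: dual_cone_def[of \<sigma>])
  then have "0 \<le> b * pairing m V2" "0 \<le> a * pairing m' V1"
    using m(2) m'(2) by (simp_all add: ab pairing_commute[of V1] pairing_commute[of V2])
  then have "0 \<le> a" "0 \<le> b" using m(3) m'(3) by (simp_all add: zero_le_mult_iff)
  with ab show "\<exists>a b. 0 \<le> a \<and> 0 \<le> b \<and> x = qscale a V1 + qscale b V2" by blast
qed (auto intro!: cone_add cone_scale V_mem)

lemma mem_dual_iff: "y \<in> dual_cone \<sigma> \<longleftrightarrow> 0 \<le> pairing y V1 \<and> 0 \<le> pairing y V2"
proof
  assume "y \<in> dual_cone \<sigma>"
  then show "0 \<le> pairing y V1 \<and> 0 \<le> pairing y V2"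
    using V_mem by (auto simp: dual_cone_def[of \<sigma>] pairing_commute[of y])
next
  assume y: "0 \<le> pairing y V1 \<and> 0 \<le> pairing y V2"
  have "0 \<le> pairing x y" if "x \<in> \<sigma>" for x
    using that y unfolding mem_cone_iff by (auto simp: pairing_commute[of _ y] simp flip: pairing_commute[of _ y])
  then show "y \<in> dual_cone \<sigma>" by (simp add: dual_cone_def[of \<sigma>])
qed

lemma pairing_combination: "pairing y (qscale a V1 + qscale b V2) = a * pairing y V1 + b * pairing y V2"
  by (simp add: pairing_commute[of y])

lemma face_cases:
  assumes "is_face \<tau> \<sigma>"
  shows "\<tau> = {0} \<or> \<tau> = ray v1 \<or> \<tau> = ray v2 \<or> \<tau> = \<sigma>"
proof -
  obtain m where m: "m \<in> dual_cone \<sigma>" "\<tau> = {v \<in> \<sigma>. pairing m v = 0}"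
    using assms by (auto simp: is_face_def)
  have pos: "0 \<le> pairing m V1" "0 \<le> pairing m V2" using m(1) by (auto simp: mem_dual_iff)
  have mem: "x \<in> \<tau> \<longleftrightarrow> (\<exists>a b. 0 \<le> a \<and> 0 \<le> b \<and> x = qscale a V1 + qscale b V2 \<and>
      (a = 0 \<or> pairing m V1 = 0) \<and> (b = 0 \<or> pairing m V2 = 0))"
    (is "_ \<longleftrightarrow> ?R x") for x
  proof -
    have iff: "pairing m (qscale a V1 + qscale b V2) = 0 \<longleftrightarrow>
        (a = 0 \<or> pairing m V1 = 0) \<and> (b = 0 \<or> pairing m V2 = 0)"
      if "0 \<le> a" "0 \<le> b" for a b
      using pos that by (simp add: pairing_combination add_nonneg_eq_0_iff)
    show ?thesis
    proof
      assume "x \<in> \<tau>"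
      then have "x \<in> \<sigma>" "pairing m x = 0" by (simp_all add: m(2))
      then obtain a b where ab: "0 \<le> a" "0 \<le> b" "x = qscale a V1 + qscale b V2"
        unfolding mem_cone_iff by blast
      with iff[of a b] \<open>pairing m x = 0\<close> show "?R x" by blast
    next
      assume "?R x"
      then obtain a b where ab: "0 \<le> a" "0 \<le> b" "x = qscale a V1 + qscale b V2"
        "(a = 0 \<or> pairing m V1 = 0) \<and> (b = 0 \<or> pairing m V2 = 0)" by blast
      then have "x \<in> \<sigma>" "pairing m x = 0" using iff[of a b] unfolding mem_cone_iff by blast+
      then show "x \<in> \<tau>" by (simp add: m(2))
    qed
  qed
  have zero: "qscale 0 x = 0" for x by (simp add: qscale_def zero_prod_def)
  consider "pairing m V1 = 0" "pairing m V2 = 0" | "pairing m V1 = 0" "pairing m V2 \<noteq> 0"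
    | "pairing m V1 \<noteq> 0" "pairing m V2 = 0" | "pairing m V1 \<noteq> 0" "pairing m V2 \<noteq> 0" by blast
  then show ?thesis
  proof cases
    case 1
    then have "\<tau> = \<sigma>" by (intro set_eqI) (simp add: mem mem_cone_iff)
    then show ?thesis by blast
  next
    case 2
    have "x \<in> \<tau> \<longleftrightarrow> x \<in> ray v1" for x
    proof -
      have "x \<in> \<tau> \<longleftrightarrow> (\<exists>a b. 0 \<le> a \<and> 0 \<le> b \<and> x = qscale a V1 + qscale b V2 \<and> b = 0)"
        by (simp add: mem 2)
      also have "\<dots> \<longleftrightarrow> x \<in> ray v1"
        unfolding ray_def mem_Collect_eq by (metis zero add.right_neutral order_refl)
      finally show ?thesis .
    qed
    then have "\<tau> = ray v1" by (rule set_eqI)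
    then show ?thesis by blast
  next
    case 3
    have "x \<in> \<tau> \<longleftrightarrow> x \<in> ray v2" for x
    proof -
      have "x \<in> \<tau> \<longleftrightarrow> (\<exists>a b. 0 \<le> a \<and> 0 \<le> b \<and> x = qscale a V1 + qscale b V2 \<and> a = 0)"
        by (simp add: mem 3)
      also have "\<dots> \<longleftrightarrow> x \<in> ray v2"
        unfolding ray_def mem_Collect_eq by (metis zero add.left_neutral order_refl)
      finally show ?thesis .
    qed
    then have "\<tau> = ray v2" by (rule set_eqI)
    then show ?thesis by blast
  next
    case 4
    then have "\<tau> = {0}" by (intro set_eqI) (auto simp: mem zero)
    then show ?thesis by blast
  qed
qed

lemma is_face_zero: "is_face {0} \<sigma>"
proof -
  obtain m where m: "m \<in> dual_cone \<sigma>" "pairing m V1 = 0" "0 < pairing m V2" by (rule face_functional)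
  obtain m' where m': "m' \<in> dual_cone \<sigma>" "pairing m' V2 = 0" "0 < pairing m' V1" by (rule sw.face_functional)
  have "v = 0" if v: "v \<in> \<sigma>" "pairing (m + m') v = 0" for v
  proof -
    obtain a b where ab: "0 \<le> a" "0 \<le> b" "v = qscale a V1 + qscale b V2"
      using v(1) unfolding mem_cone_iff by blast
    then have "a * pairing m' V1 + b * pairing m V2 = 0"
      using v(2) pairing_combination[of "m + m'" a b] m m' by simp
    then have "a = 0" "b = 0"
      using ab m(3) m'(3) by (simp_all add: add_nonneg_eq_0_iff)
    then show ?thesis using ab(3) by (simp add: qscale_def zero_prod_def)
  qed
  moreover have "0 \<in> \<sigma>" by (simp add: dual_cone_def)
  ultimately have "{0} = {v \<in> \<sigma>. pairing (m + m') v = 0}"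
    by (intro equalityI subsetI) simp_all
  moreover have "m + m' \<in> dual_cone \<sigma>" using m m' by (simp add: mem_dual_iff)
  ultimately show ?thesis unfolding is_face_def by blast
qed

lemma perp_faces: "perp {0} = UNIV" "perp (ray v1) = {y. pairing y V1 = 0}" "perp \<sigma> = {0}"
proof -
  show "perp {0} = UNIV" by (auto simp: perp_def pairing_def)
  show "perp (ray v1) = {y. pairing y V1 = 0}"
  proof
    show "perp (ray v1) \<subseteq> {y. pairing y V1 = 0}"
      using ray_mem[of v1] by (auto simp: perp_def pairing_commute)
    show "{y. pairing y V1 = 0} \<subseteq> perp (ray v1)"
      by (auto simp: perp_def ray_def pairing_commute[of V1])
  qed
  show "perp \<sigma> = {0}"
  proof
    show "perp \<sigma> \<subseteq> {0}"
    proof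
      fix y assume "y \<in> perp \<sigma>"
      then have y: "pairing V1 y = 0" "pairing V2 y = 0" using V_mem by (auto simp: perp_def)
      define d :: rat where "d = of_int (fst v1 * snd v2 - snd v1 * fst v2)"
      have d: "d \<noteq> 0" using det by (simp add: d_def del: of_int_diff of_int_mult)
      have "d * fst y = of_int (snd v2) * pairing V1 y - of_int (snd v1) * pairing V2 y"
        "d * snd y = of_int (fst v1) * pairing V2 y - of_int (fst v2) * pairing V1 y"
        by (simp_all add: d_def pairing_def rat_point_def algebra_simps)
      with y d show "y \<in> {0}" by (simp add: prod_eq_iff)
    qed
  qed (auto simp: perp_def pairing_def)
qed

lemma relint_dual_iff: "x \<in> relint (dual_cone \<sigma>) \<longleftrightarrow> 0 < pairing x V1 \<and> 0 < pairing x V2"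
proof
  assume x: "x \<in> relint (dual_cone \<sigma>)"
  obtain m where m: "m \<in> dual_cone \<sigma>" "0 < pairing m V2" by (rule face_functional)
  obtain m' where m': "m' \<in> dual_cone \<sigma>" "0 < pairing m' V1" by (rule sw.face_functional)
  show "0 < pairing x V1 \<and> 0 < pairing x V2"
    using relint_pos[OF x m] relint_pos[OF x m'] by (simp add: mem_dual_iff)
qed (auto intro!: relintI[of _ _ V1 V2] simp: mem_dual_iff)

lemma relint_facet_iff:
  "x \<in> relint (dual_cone \<sigma> \<inter> perp (ray v1)) \<longleftrightarrow> pairing x V1 = 0 \<and> 0 < pairing x V2"
proof
  assume x: "x \<in> relint (dual_cone \<sigma> \<inter> perp (ray v1))"
  then have "pairing x V1 = 0" by (simp add: relint_def perp_faces)
  moreover obtain m where m: "m \<in> dual_cone \<sigma>" "pairing m V1 = 0" "0 < pairing m V2" by (rule face_functional)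
  then have "0 < pairing x V2"
    by (intro relint_pos[OF x, of m]) (auto simp: mem_dual_iff perp_faces)
  ultimately show "pairing x V1 = 0 \<and> 0 < pairing x V2" by simp
next
  assume x: "pairing x V1 = 0 \<and> 0 < pairing x V2"
  have span: "pairing y V1 = 0" if "y \<in> module.span qscale (dual_cone \<sigma> \<inter> perp (ray v1))" for y
    using that
    by (induction rule: qspace.span_induct_alt) (auto simp: perp_faces)
  from x span show "x \<in> relint (dual_cone \<sigma> \<inter> perp (ray v1))"
    by (intro relintI[of _ _ V2 V2]) (auto simp: mem_dual_iff perp_faces)
qed

end

section \<open>Seminormal monoids in coordinates\<close>

locale seminormal_cone = cone_rays "cone_over S" v1 v2 for S v1 v2 +
  assumes seminormal: "seminormal S" and zero_mem: "0 \<in> S" and full: "group_closure S = UNIV"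
begin

interpretation sw: cone_rays "cone_over S" v2 v1 by (rule rays_swap)

lemma sigma: "sigma_cone S = \<sigma>"
  by (simp add: sigma_cone_def)

lemma lattice_points_perp: "lattice_points (perp (ray v1)) = {m. pairing m v1 = 0}"
  by (simp add: lattice_points_def perp_faces pairing_rat_point)

lemma normalisation_eq: "normalisation S = {m. 0 \<le> pairing m v1 \<and> 0 \<le> pairing m v2}"
  by (simp add: normalisation_def sigma lattice_points_def mem_dual_iff pairing_rat_point)

lemma mem_iff:
  "x \<in> S \<longleftrightarrow> x = 0 \<or> 0 < pairing x v1 \<and> 0 < pairing x v2 \<or>
    x \<in> face_group S (ray v1) \<and> pairing x v1 = 0 \<and> 0 < pairing x v2 \<or>
    x \<in> face_group S (ray v2) \<and> pairing x v2 = 0 \<and> 0 < pairing x v1"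
proof
  have faces: "x \<in> S \<longleftrightarrow> (\<exists>\<tau>. is_face \<tau> \<sigma> \<and> x \<in> face_group S \<tau> \<and> rat_point x \<in> relint (dual_cone \<sigma> \<inter> perp \<tau>))"
    for x
    using seminormal unfolding seminormal_def sigma by (subst (asm) set_eq_iff) (auto simp: lattice_points_def)
  {
    assume "x \<in> S"
    then obtain \<tau> where \<tau>: "is_face \<tau> \<sigma>" "x \<in> face_group S \<tau>" "rat_point x \<in> relint (dual_cone \<sigma> \<inter> perp \<tau>)"
      unfolding faces by blast
    from face_cases[OF \<tau>(1)] show "x = 0 \<or> 0 < pairing x v1 \<and> 0 < pairing x v2 \<or>
      x \<in> face_group S (ray v1) \<and> pairing x v1 = 0 \<and> 0 < pairing x v2 \<or>
      x \<in> face_group S (ray v2) \<and> pairing x v2 = 0 \<and> 0 < pairing x v1"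
    proof (elim disjE)
      assume "\<tau> = {0}"
      then have "rat_point x \<in> relint (dual_cone \<sigma>)" using \<tau>(3) by (simp add: perp_faces)
      then show ?thesis by (simp add: relint_dual_iff pairing_rat_point)
    next
      assume "\<tau> = ray v1"
      then show ?thesis using \<tau> relint_facet_iff[of "rat_point x"] by (simp add: pairing_rat_point)
    next
      assume "\<tau> = ray v2"
      then show ?thesis using \<tau> sw.relint_facet_iff[of "rat_point x"] by (simp add: pairing_rat_point)
    next
      assume "\<tau> = \<sigma>"
      then have "rat_point x \<in> perp \<sigma>" using \<tau>(3) by (simp add: relint_def)
      then show ?thesis by (simp add: perp_faces rat_point_def prod_eq_iff)
    qed
  next
    have G0: "face_group S {0} = UNIV" by (simp add: face_group_def perp_faces lattice_points_def full)
    have rays: "is_face (ray v1) \<sigma>" "is_face (ray v2) \<sigma>"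
      using prim1 prim2 by (simp_all add: primitive_ray_generator_def)
    assume "x = 0 \<or> 0 < pairing x v1 \<and> 0 < pairing x v2 \<or>
      x \<in> face_group S (ray v1) \<and> pairing x v1 = 0 \<and> 0 < pairing x v2 \<or>
      x \<in> face_group S (ray v2) \<and> pairing x v2 = 0 \<and> 0 < pairing x v1"
    then show "x \<in> S"
    proof (elim disjE conjE)
      assume "0 < pairing x v1" "0 < pairing x v2"
      then have "rat_point x \<in> relint (dual_cone \<sigma> \<inter> perp {0})"
        by (simp add: perp_faces relint_dual_iff pairing_rat_point)
      then show ?thesis unfolding faces using is_face_zero G0 by blast
    next
      assume x: "x \<in> face_group S (ray v1)" "pairing x v1 = 0" "0 < pairing x v2"
      then have "rat_point x \<in> relint (dual_cone \<sigma> \<inter> perp (ray v1))"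
        by (simp add: relint_facet_iff pairing_rat_point)
      then show ?thesis unfolding faces using rays x by blast
    next
      assume x: "x \<in> face_group S (ray v2)" "pairing x v2 = 0" "0 < pairing x v1"
      then have "rat_point x \<in> relint (dual_cone \<sigma> \<inter> perp (ray v2))"
        by (simp add: sw.relint_facet_iff pairing_rat_point)
      then show ?thesis unfolding faces using rays x by blast
    qed (use zero_mem in simp)
  }
qed

end

lemma group_closure_mono: "A \<subseteq> B \<Longrightarrow> x \<in> group_closure A \<Longrightarrow> x \<in> group_closure B"
  by (rotate_tac, induction rule: group_closure.induct) (auto intro: group_closure.intros)

lemma orthogonal_multiples:
  fixes v x :: lattice
  assumes "coprime (fst v) (snd v)" "pairing x v = 0"
  shows "\<exists>n. x = n \<cdot> (- snd v, fst v)"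
proof -
  obtain a b where ab: "a * fst v + b * snd v = 1"
    using bezout_int[of "fst v" "snd v"] assms(1) by auto
  have x: "fst x * fst v = - snd x * snd v" using assms(2) by (simp add: pairing_def eq_neg_iff_add_eq_0)
  have "fst x = fst x * (a * fst v + b * snd v)" by (simp add: ab)
  also have "\<dots> = (a * snd x - b * fst x) * - snd v" using x by (simp add: algebra_simps)
  finally have "fst x = (a * snd x - b * fst x) * - snd v" .
  moreover have "snd x = snd x * (a * fst v + b * snd v)" by (simp add: ab)
  moreover have "snd x * (a * fst v + b * snd v) = (a * snd x - b * fst x) * fst v"
    using x by (simp add: algebra_simps)
  ultimately have "x = (a * snd x - b * fst x) \<cdot> (- snd v, fst v)" by (simp add: prod_eq_iff)
  then show ?thesis by blast
qed

lemma zscale_eq_iff: "e \<noteq> 0 \<Longrightarrow> m \<cdot> e = n \<cdot> e \<longleftrightarrow> m = n"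
  by (auto simp: prod_eq_iff)

text \<open>
  A subgroup of \<open>\<int> e\<close> is \<open>d \<int> e\<close>, with cosets represented by \<open>0, \<dots>, d - 1\<close>. The case \<open>d = 0\<close> is excluded
  because infinitely many cosets would give the cardinality \<open>0\<close>.
\<close>

lemma subgroup_of_index:
  fixes e :: lattice
  assumes e: "e \<noteq> 0" and A: "A \<subseteq> range (\<lambda>n. n \<cdot> e)"
    and index: "card ((\<lambda>m. m +o group_closure A) ` range (\<lambda>n. n \<cdot> e)) = l" "0 < l"
  shows "group_closure A = range (\<lambda>n. (n * int l) \<cdot> e)"
proof -
  let ?G = "group_closure A"
  define H where "H = {n. n \<cdot> e \<in> ?G}"
  have diff: "(m - n) \<cdot> e = m \<cdot> e - n \<cdot> e" for m n by (simp add: prod_eq_iff algebra_simps)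
  have "x \<in> H" if "x \<in> group_closure H" for x
    using that by induction (auto simp: H_def diff intro: group_closure.diff)
  then have H: "H = range ((*) (Gcd H))"
    using group_closure_eq[of H] group_closure.base[of _ H] by blast
  define d where "d = Gcd H"
  have d: "0 \<le> d" "n \<in> H \<longleftrightarrow> d dvd n" for n :: int
    using arg_cong[OF H, of "\<lambda>X. n \<in> X"] by (auto simp: d_def dvd_def image_iff)
  have multiple: "x \<in> range (\<lambda>n. n \<cdot> e)" if "x \<in> ?G" for x
    using that
  proof induction
    case (base s)
    then show ?case using A by (auto intro: image_eqI[of _ _ 0])
  next
    case (diff s t)
    then obtain a b where "s = a \<cdot> e" "t = b \<cdot> e" by blast
    then have "s - t = (a - b) \<cdot> e" by (simp add: prod_eq_iff algebra_simps)
    then show ?case by blast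
  qed
  have G: "?G = (\<lambda>n. n \<cdot> e) ` H"
  proof
    show "?G \<subseteq> (\<lambda>n. n \<cdot> e) ` H"
    proof
      fix x assume x: "x \<in> ?G"
      then obtain n where "x = n \<cdot> e" using multiple by blast
      with x show "x \<in> (\<lambda>n. n \<cdot> e) ` H" by (simp add: H_def)
    qed
  qed (auto simp: H_def)
  have coset: "m \<cdot> e +o ?G = n \<cdot> e +o ?G \<longleftrightarrow> d dvd (m - n)" for m n
  proof
    assume eq: "m \<cdot> e +o ?G = n \<cdot> e +o ?G"
    have "m \<cdot> e + 0 \<in> m \<cdot> e +o ?G" by (rule set_plus_intro2) simp
    then have "m \<cdot> e \<in> n \<cdot> e +o ?G" by (simp add: eq)
    then have "(m - n) \<cdot> e \<in> ?G" by (auto simp: elt_set_plus_def diff)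
    then show "d dvd (m - n)" by (simp add: H_def flip: d(2))
  next
    have sub: "m \<cdot> e +o ?G \<subseteq> n \<cdot> e +o ?G" if "d dvd (m - n)" for m n
    proof
      fix x assume "x \<in> m \<cdot> e +o ?G"
      then obtain g where g: "g \<in> ?G" "x = m \<cdot> e + g" by (auto simp: elt_set_plus_def)
      have "(m - n) \<cdot> e \<in> ?G" using that d(2)[of "m - n"] by (simp add: H_def)
      then have "(m - n) \<cdot> e + g \<in> ?G" using g(1) by (rule group_closure_add)
      moreover have "x = n \<cdot> e + ((m - n) \<cdot> e + g)" by (simp add: g(2) diff)
      ultimately show "x \<in> n \<cdot> e +o ?G" by (auto simp: elt_set_plus_def)
    qed
    assume "d dvd (m - n)"
    with sub[of m n] sub[of n m] show "m \<cdot> e +o ?G = n \<cdot> e +o ?G"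
      by (simp add: dvd_diff_commute subset_antisym)
  qed
  have image: "(\<lambda>m. m +o ?G) ` range (\<lambda>n. n \<cdot> e) = range (\<lambda>n. n \<cdot> e +o ?G)" by auto
  have "d \<noteq> 0"
  proof
    assume "d = 0"
    then have "inj (\<lambda>n. n \<cdot> e +o ?G)" by (intro injI) (simp add: coset)
    then have "infinite (range (\<lambda>n. n \<cdot> e +o ?G))" using infinite_UNIV_int finite_imageD by blast
    with index show False by (simp add: image)
  qed
  then have dpos: "0 < d" using d(1) by simp
  have "range (\<lambda>n. n \<cdot> e +o ?G) = (\<lambda>n. n \<cdot> e +o ?G) ` {0..<d}"
  proof
    show "range (\<lambda>n. n \<cdot> e +o ?G) \<subseteq> (\<lambda>n. n \<cdot> e +o ?G) ` {0..<d}"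
    proof
      fix X assume "X \<in> range (\<lambda>n. n \<cdot> e +o ?G)"
      then obtain n where "X = n \<cdot> e +o ?G" by blast
      moreover have "n \<cdot> e +o ?G = (n mod d) \<cdot> e +o ?G" unfolding coset by (simp add: dvd_minus_mod)
      moreover have "n mod d \<in> {0..<d}" using dpos by simp
      ultimately show "X \<in> (\<lambda>n. n \<cdot> e +o ?G) ` {0..<d}" by blast
    qed
  qed auto
  moreover have "inj_on (\<lambda>n. n \<cdot> e +o ?G) {0..<d}"
  proof (rule inj_onI)
    fix m n assume mn: "m \<in> {0..<d}" "n \<in> {0..<d}" "m \<cdot> e +o ?G = n \<cdot> e +o ?G"
    then have "d dvd (m - n)" unfolding coset by simp
    then have "m mod d = n mod d" by (rule mod_eq_dvd_iff[THEN iffD2])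
    with mn show "m = n" by simp
  qed
  ultimately have "l = nat d" using index(1) by (simp add: image card_image)
  then have l: "int l = d" using dpos by simp
  have "n \<in> H \<longleftrightarrow> n \<in> range (\<lambda>k. k * d)" for n
    by (auto simp: d(2) dvd_def mult.commute)
  then have "H = range (\<lambda>k. k * d)" by (rule set_eqI)
  then show ?thesis unfolding G l by (simp add: image_image)
qed

text \<open>
  The step of the numbering is parallel to the line. Surjectivity makes it \<open>e\<close> or \<open>- e\<close>, and the
  sign condition decides the direction and places the point number \<open>0\<close>.
\<close>

lemma line_numbering_shift:
  assumes p: "line_numbering v v' j p" and e: "pairing e v = 0" "0 < pairing e v'"
    and multiples: "\<forall>x. pairing x v = 0 \<longrightarrow> (\<exists>n. x = n \<cdot> e)"
  shows "p m = p 0 + m \<cdot> e" "pairing (p 0) v = j" "- pairing e v' < pairing (p 0) v'" "pairing (p 0) v' \<le> 0"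
proof -
  have bij: "bij_betw p UNIV {x. pairing x v = j}" and sign: "\<And>m. 0 < m \<longleftrightarrow> 0 < pairing (p m) v'"
    using p by (auto simp: line_numbering_def)
  obtain f where f: "\<And>m. p (m + 1) = p m + f" using p by (auto simp: line_numbering_def)
  have line: "pairing (p m) v = j" for m using bij by (auto simp: bij_betw_def)
  have "pairing f v = 0" using line[of 1] line[of 0] f[of 0] by simp
  then obtain k where k: "f = k \<cdot> e" using multiples by blast
  have p_eq: "p m = p 0 + (m * k) \<cdot> e" for m
  proof (induction m rule: int_induct[of _ 0])
    case (step1 i)
    then show ?case using f[of i] by (simp add: k distrib_right zscale_add_left add.assoc)
  next
    case (step2 i)
    then have "p (i - 1) = p 0 + (i * k) \<cdot> e - k \<cdot> e" using f[of "i - 1"] by (simp add: k eq_diff_eq)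
    then show ?case by (simp add: prod_eq_iff algebra_simps)
  qed simp
  have e0: "e \<noteq> 0" using e(2) by auto
  have "p 0 + e \<in> {x. pairing x v = j}" using line[of 0] e(1) by simp
  then obtain m where "p 0 + e = p m" using bij by (metis bij_betw_imp_surj_on image_iff)
  then have "1 \<cdot> e = (m * k) \<cdot> e" using p_eq[of m] by simp
  then have "m * k = 1" using zscale_eq_iff[OF e0] by metis
  then have k1: "k = 1 \<or> k = - 1" by (metis mult.commute zmult_eq_1_iff)
  have "k \<noteq> - 1"
  proof
    assume "k = - 1"
    let ?c = "pairing (p 0) v'" and ?n = "1 + \<bar>pairing (p 0) v'\<bar>"
    have "0 < pairing (p ?n) v'" by (subst sign[symmetric]) simp
    also have "pairing (p ?n) v' = ?c - ?n * pairing e v'"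
      by (simp add: p_eq[of ?n] \<open>k = - 1\<close> algebra_simps)
    finally have "0 < ?c - ?n * pairing e v'" .
    moreover have "?n * 1 \<le> ?n * pairing e v'" using e(2) by (intro mult_left_mono) auto
    ultimately show False by simp
  qed
  with k1 have "k = 1" by simp
  then show shift: "p m = p 0 + m \<cdot> e" for m using p_eq[of m] by simp
  show "pairing (p 0) v = j" by (rule line)
  show "- pairing e v' < pairing (p 0) v'" using sign[of 1] shift[of 1] by simp
  show "pairing (p 0) v' \<le> 0" using sign[of 0] by simp
qed


section \<open>When the normalisation is the affine plane\<close>

lemma UNIV_two: "(UNIV :: 2 set) = {0, 1}"
  by (rule card_subset_eq[symmetric]) auto

lemma weight_two:
  fixes w :: "2 \<Rightarrow> lattice"
  shows "weight w m = int (Poly_Mapping.lookup m 0) \<cdot> w 0 + int (Poly_Mapping.lookup m 1) \<cdot> w 1"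
  unfolding weight_eq_sum UNIV_two by simp

text \<open>
  If different exponents have different weights, the presentation map is an isomorphism, and its
  inverse is the required one.
\<close>

lemma presentation_iso_affine_plane:
  fixes w :: "2 \<Rightarrow> lattice"
  assumes inj: "inj (weight w)" and S: "S = range (weight w)"
  shows "affine_plane TYPE('k::comm_ring_1) S"
proof -
  let ?A = "monoid_algebra S :: 'k laurent set"
  have lookup: "Poly_Mapping.lookup (presentation w f) (weight w m) = Poly_Mapping.lookup f m"
    for f :: "(2, 'k) mpoly" and m
  proof -
    have "{m' \<in> Poly_Mapping.keys f. weight w m' = weight w m} = (if m \<in> Poly_Mapping.keys f then {m} else {})"
      using inj by (auto dest: injD)
    then show ?thesis by (simp add: presentation_eq_twist lookup_twist in_keys_iff)
  qed
  have pres_inj: "inj (presentation w :: (2, 'k) mpoly \<Rightarrow> _)"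
    by (intro injI poly_mapping_eqI) (metis lookup)
  have pres_mem: "presentation w f \<in> ?A" for f :: "(2, 'k) mpoly"
  proof -
    have "x \<in> S" if x: "Poly_Mapping.lookup (presentation w f) x \<noteq> 0" for x
    proof -
      have "\<exists>m. weight w m = x"
      proof (rule ccontr)
        assume "\<nexists>m. weight w m = x"
        then have "{m \<in> Poly_Mapping.keys f. weight w m = x} = {}" by auto
        then have "Poly_Mapping.lookup (presentation w f) x = 0"
          unfolding presentation_eq_twist lookup_twist by (simp only: sum.empty)
        with x show False by simp
      qed
      then show ?thesis by (auto simp: S)
    qed
    then show ?thesis by (auto simp: monoid_algebra_def in_keys_iff)
  qed
  have pres_surj: "\<exists>f :: (2, 'k) mpoly. presentation w f = a" if a: "a \<in> ?A" for a
  proof (intro exI poly_mapping_eqI)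
    let ?f = "\<Sum>d\<in>Poly_Mapping.keys a. Poly_Mapping.single (inv (weight w) d) (Poly_Mapping.lookup a d)"
    have "presentation w ?f = (\<Sum>d\<in>Poly_Mapping.keys a. Poly_Mapping.single (weight w (inv (weight w) d)) (Poly_Mapping.lookup a d))"
      by (simp add: presentation_eq_twist twist_sum twist_single)
    also have "\<dots> = (\<Sum>d\<in>Poly_Mapping.keys a. Poly_Mapping.single d (Poly_Mapping.lookup a d))"
      using a by (intro sum.cong refl) (auto simp: monoid_algebra_def S f_inv_into_f)
    finally show "Poly_Mapping.lookup (presentation w ?f) x = Poly_Mapping.lookup a x" for x
      using single_sum_monomials[of a] by simp
  qed
  have "range (presentation w :: (2, 'k) mpoly \<Rightarrow> _) = ?A"
    using pres_mem pres_surj by blast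
  with pres_inj have bij: "bij_betw (presentation w :: (2, 'k) mpoly \<Rightarrow> _) UNIV ?A"
    unfolding bij_betw_def by blast
  define F where "F = inv_into UNIV (presentation w :: (2, 'k) mpoly \<Rightarrow> _)"
  have F: "presentation w (F a) = a" if "a \<in> ?A" for a
    using bij_betw_inv_into_right[OF bij that] by (simp add: F_def)
  have FI: "F a = f" if "presentation w f = a" for a f
    using bij_betw_inv_into_left[OF bij, of f] that by (simp add: F_def)
  show ?thesis
    unfolding affine_plane_def
  proof (intro exI[of _ F] conjI allI ballI)
    show "bij_betw F ?A UNIV" unfolding F_def by (rule bij_betw_inv_into[OF bij])
    show "F (Poly_Mapping.single 0 c) = Poly_Mapping.single 0 c" for c
      by (rule FI) (simp add: presentation_single)
    fix a b assume "a \<in> ?A" "b \<in> ?A"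
    then show "F (a + b) = F a + F b" "F (a * b) = F a * F b"
      by (intro FI, simp add: presentation_add presentation_mult F)+
  qed
qed

lemma point_derivation_eq_zero:
  fixes \<delta> \<epsilon> :: "('v::finite, 'k::comm_ring_1) mpoly \<Rightarrow> 'k"
  assumes add: "\<And>f g. \<delta> (f + g) = \<delta> f + \<delta> g"
    and mult: "\<And>f g. \<delta> (f * g) = \<epsilon> f * \<delta> g + \<delta> f * \<epsilon> g"
    and const: "\<And>c. \<delta> (Poly_Mapping.single 0 c) = 0"
    and variables: "\<And>i. \<delta> (Poly_Mapping.single (Poly_Mapping.single i 1) 1) = 0"
  shows "\<delta> f = 0"
proof -
  have monomial: "\<delta> (Poly_Mapping.single m 1) = 0" for m
  proof (induction m rule: monomial_induct)
    case (1 i n)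
    show ?case
    proof (induction n)
      case 0
      show ?case using const[of 1] by simp
    next
      case (Suc n)
      have "Poly_Mapping.single (Poly_Mapping.single i (Suc n)) (1::'k) =
          Poly_Mapping.single (Poly_Mapping.single i 1) 1 * Poly_Mapping.single (Poly_Mapping.single i n) 1"
        by (simp add: mult_single flip: single_add)
      then show ?case by (simp only: mult variables Suc) simp
    qed
  next
    case (2 m n)
    have "Poly_Mapping.single (m + n) (1::'k) = Poly_Mapping.single m 1 * Poly_Mapping.single n 1"
      by (simp add: mult_single)
    then show ?case by (simp only: mult 2) simp
  qed
  show ?thesis
  proof (induction f rule: monomial_induct)
    case (1 m c)
    have "Poly_Mapping.single m c = Poly_Mapping.single 0 c * Poly_Mapping.single m 1"
      by (simp add: mult_single)
    then show ?case by (simp only: mult const monomial) simp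
  qed (simp add: add)
qed

lemma monoid_algebra_mult_closed:
  assumes "\<And>x y. x \<in> S \<Longrightarrow> y \<in> S \<Longrightarrow> x + y \<in> S" "a \<in> monoid_algebra S" "b \<in> monoid_algebra S"
  shows "a * b \<in> monoid_algebra S"
  using assms keys_mult[of a b] unfolding monoid_algebra_def by blast

text \<open>
  Only the two trivial decompositions of \<open>h\<close> contribute to the product. So the coefficient at an
  irreducible element is a point derivation at the origin, the point where all other monomials vanish.
\<close>

lemma coefficient_at_irreducible:
  fixes a b :: "'k::comm_ring_1 laurent"
  assumes a: "a \<in> monoid_algebra S" and b: "b \<in> monoid_algebra S"
    and h: "h \<noteq> 0" "\<And>s t. s \<in> S \<Longrightarrow> t \<in> S \<Longrightarrow> s + t = h \<Longrightarrow> s = 0 \<or> t = 0"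
  shows "Poly_Mapping.lookup (a * b) h =
    Poly_Mapping.lookup a 0 * Poly_Mapping.lookup b h + Poly_Mapping.lookup a h * Poly_Mapping.lookup b 0"
proof -
  let ?l = Poly_Mapping.lookup
  have monomial: "?l (Poly_Mapping.single s c * b) h =
      (if s = 0 then c * ?l b h else 0) + (if s = h then c * ?l b 0 else 0)" if s: "s \<in> S" for s c
  proof -
    have "?l b (h - s) = 0" if "s \<noteq> 0" "s \<noteq> h"
    proof (rule ccontr)
      assume "?l b (h - s) \<noteq> 0"
      then have "h - s \<in> S" using b by (auto simp: monoid_algebra_def in_keys_iff)
      with h(2)[of s "h - s"] s that show False by auto
    qed
    then show ?thesis using h(1) by (auto simp: lookup_single_mult)
  qed
  have "?l (a * b) h = (\<Sum>s\<in>Poly_Mapping.keys a. ?l (Poly_Mapping.single s (?l a s) * b) h)"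
    by (subst single_sum_monomials[of a]) (simp add: sum_distrib_right lookup_sum)
  also have "\<dots> = (\<Sum>s\<in>Poly_Mapping.keys a. (if s = 0 then ?l a s * ?l b h else 0) + (if s = h then ?l a s * ?l b 0 else 0))"
    using a by (intro sum.cong refl monomial) (auto simp: monoid_algebra_def)
  also have "\<dots> = ?l a 0 * ?l b h + ?l a h * ?l b 0"
    by (simp add: sum.distrib in_keys_iff)
  finally show ?thesis .
qed

text \<open>
  The coefficients at the irreducible elements are linearly independent point derivations at one point.
  On a polynomial ring in two variables a point derivation is determined by two values
  (\<open>point_derivation_eq_zero\<close>), so three of them are dependent.
\<close>

lemma affine_plane_irreducibles:
  assumes closed: "0 \<in> S" "\<And>x y. x \<in> S \<Longrightarrow> y \<in> S \<Longrightarrow> x + y \<in> S"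
    and plane: "affine_plane TYPE('k::field) S"
    and H: "finite H" "H \<subseteq> S" "0 \<notin> H" "\<And>h s t. h \<in> H \<Longrightarrow> s \<in> S \<Longrightarrow> t \<in> S \<Longrightarrow> s + t = h \<Longrightarrow> s = 0 \<or> t = 0"
  shows "card H \<le> 2"
proof (rule ccontr)
  assume many: "\<not> card H \<le> 2"
  let ?A = "monoid_algebra S :: 'k laurent set"
  let ?l = Poly_Mapping.lookup
  obtain F :: "'k laurent \<Rightarrow> (2, 'k) mpoly" where F: "bij_betw F ?A UNIV"
    "\<And>c. F (Poly_Mapping.single 0 c) = Poly_Mapping.single 0 c"
    "\<And>a b. a \<in> ?A \<Longrightarrow> b \<in> ?A \<Longrightarrow> F (a + b) = F a + F b \<and> F (a * b) = F a * F b"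
    using plane unfolding affine_plane_def by blast
  define G where "G = inv_into ?A F"
  have G: "G f \<in> ?A" "F (G f) = f" for f
    using bij_betw_imp_surj_on[OF F(1)] inv_into_into[of f F ?A] f_inv_into_f[of f F ?A] by (auto simp: G_def)
  have GI: "G (F a) = a" if "a \<in> ?A" for a
    using bij_betw_inv_into_left[OF F(1) that] by (simp add: G_def)
  have add_closed: "a + b \<in> ?A" if "a \<in> ?A" "b \<in> ?A" for a b
    using that keys_add[of a b] by (auto simp: monoid_algebra_def)
  have mult_closed: "a * b \<in> ?A" if "a \<in> ?A" "b \<in> ?A" for a b
    using closed(2) that by (rule monoid_algebra_mult_closed)
  have G_add: "G (f + g) = G f + G g" for f g
    using GI[OF add_closed[OF G(1)[of f] G(1)[of g]]] F(3)[OF G(1)[of f] G(1)[of g]] by (simp add: G(2))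
  have G_mult: "G (f * g) = G f * G g" for f g
    using GI[OF mult_closed[OF G(1)[of f] G(1)[of g]]] F(3)[OF G(1)[of f] G(1)[of g]] by (simp add: G(2))
  have G_const: "G (Poly_Mapping.single 0 c) = Poly_Mapping.single 0 c" for c
    using GI[of "Poly_Mapping.single 0 c"] closed(1) F(2)[of c] by (simp add: monoid_algebra_def)
  let ?x = "\<lambda>i :: 2. Poly_Mapping.single (Poly_Mapping.single i 1) (1 :: 'k)"
  have "card (UNIV :: 2 set) < card H" using many by simp
  then obtain c where c: "\<exists>h\<in>H. c h \<noteq> 0" "\<And>i. (\<Sum>h\<in>H. c h * ?l (G (?x i)) h) = 0"
    using nontrivial_solution[of "UNIV :: 2 set" H "\<lambda>h i. ?l (G (?x i)) h"] H(1) by auto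
  define \<delta> where "\<delta> f = (\<Sum>h\<in>H. c h * ?l (G f) h)" for f
  have "\<delta> f = 0" for f
  proof (rule point_derivation_eq_zero[where \<epsilon> = "\<lambda>f. ?l (G f) 0"])
    show "\<delta> (f + g) = \<delta> f + \<delta> g" for f g
      by (simp add: \<delta>_def G_add lookup_add distrib_left sum.distrib)
    show "\<delta> (f * g) = ?l (G f) 0 * \<delta> g + \<delta> f * ?l (G g) 0" for f g
    proof -
      have "\<delta> (f * g) = (\<Sum>h\<in>H. c h * (?l (G f) 0 * ?l (G g) h + ?l (G f) h * ?l (G g) 0))"
        unfolding \<delta>_def G_mult
        using H by (intro sum.cong refl) (subst coefficient_at_irreducible[OF G(1) G(1)], auto)
      also have "\<dots> = ?l (G f) 0 * \<delta> g + \<delta> f * ?l (G g) 0"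
        by (simp add: \<delta>_def distrib_left sum.distrib sum_distrib_left sum_distrib_right mult_ac)
      finally show ?thesis .
    qed
    show "\<delta> (Poly_Mapping.single 0 a) = 0" for a
      using H(3) by (auto simp: \<delta>_def G_const lookup_single "when_def" intro!: sum.neutral)
    show "\<delta> (?x i) = 0" for i unfolding \<delta>_def by (rule c(2))
  qed
  moreover obtain h where h: "h \<in> H" "c h \<noteq> 0" using c(1) by blast
  have "\<delta> (F (Poly_Mapping.single h 1)) = (\<Sum>h'\<in>H. if h' = h then c h else 0)"
    unfolding \<delta>_def using H(2) h(1)
    by (subst GI) (auto simp: monoid_algebra_def lookup_single "when_def" intro!: sum.cong)
  ultimately show False using h H(1) by simp
qed

context cone_monoid
begin

lemma mem_normal_iff: "x \<in> axis_monoid v1 v2 e1 e2 1 1 \<longleftrightarrow> 0 \<le> pairing x v1 \<and> 0 \<le> pairing x v2"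
proof
  assume "x \<in> axis_monoid v1 v2 e1 e2 1 1"
  then show "0 \<le> pairing x v1 \<and> 0 \<le> pairing x v2"
    using D_pos by (auto simp: axis_monoid_def e1 e2)
next
  assume x: "0 \<le> pairing x v1 \<and> 0 \<le> pairing x v2"
  consider "0 < pairing x v1" "0 < pairing x v2" | "pairing x v1 = 0" | "pairing x v2 = 0" using x by linarith
  then show "x \<in> axis_monoid v1 v2 e1 e2 1 1"
  proof cases
    case 1
    then show ?thesis by (simp add: axis_monoid_def)
  next
    case 2
    then obtain n where n: "x = n \<cdot> e1" using basis1[of x] by auto
    then have "0 \<le> n" using x D_pos by (simp add: e1 zero_le_mult_iff)
    with n show ?thesis unfolding axis_monoid_def by force
  next
    case 3
    then obtain n where n: "x = n \<cdot> e2" using basis2[of x] by auto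
    then have "0 \<le> n" using x D_pos by (simp add: e2 zero_le_mult_iff)
    with n show ?thesis unfolding axis_monoid_def by force
  qed
qed

lemma ray1_iff:
  "x = 0 \<or> x \<in> range (\<lambda>n. (n * l1) \<cdot> e1) \<and> pairing x v1 = 0 \<and> 0 < pairing x v2 \<longleftrightarrow>
    (\<exists>n\<ge>0. x = (n * l1) \<cdot> e1)"
proof
  assume "x = 0 \<or> x \<in> range (\<lambda>n. (n * l1) \<cdot> e1) \<and> pairing x v1 = 0 \<and> 0 < pairing x v2"
  then show "\<exists>n\<ge>0. x = (n * l1) \<cdot> e1"
  proof (elim disjE conjE)
    assume "x = 0"
    then show ?thesis by (intro exI[of _ 0]) simp
  next
    assume "x \<in> range (\<lambda>n. (n * l1) \<cdot> e1)" "0 < pairing x v2"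
    then obtain n where n: "x = (n * l1) \<cdot> e1" "0 < pairing x v2" by blast
    then have "0 < n * (l1 * D)" by (simp add: e1 mult.assoc)
    moreover have "0 < l1 * D" using l_pos D_pos by simp
    ultimately have "0 < n" by (rule zero_less_mult_pos2)
    with n(1) show ?thesis by (intro exI[of _ n]) simp
  qed
next
  assume "\<exists>n\<ge>0. x = (n * l1) \<cdot> e1"
  then obtain n where n: "0 \<le> n" "x = (n * l1) \<cdot> e1" by blast
  show "x = 0 \<or> x \<in> range (\<lambda>n. (n * l1) \<cdot> e1) \<and> pairing x v1 = 0 \<and> 0 < pairing x v2"
  proof (cases "n = 0")
    case False
    then have "0 < pairing x v2" using n l_pos D_pos by (simp add: e1)
    with n(2) show ?thesis by (auto simp: e1)
  qed (simp add: n)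
qed

lemma e1_irreducible:
  assumes "s \<in> axis_monoid v1 v2 e1 e2 1 1" "t \<in> axis_monoid v1 v2 e1 e2 1 1" "s + t = e1"
  shows "s = 0 \<or> t = 0"
proof -
  have "pairing s v1 = 0 \<and> pairing t v1 = 0"
    using assms e1(1) pairing_add[of s t v1] by (auto simp: mem_normal_iff)
  then obtain a b where ab: "s = a \<cdot> e1" "t = b \<cdot> e1" using basis1[of s] basis1[of t] by auto
  have "(a + b) * D = 1 * D" using assms(3) e1(2) pairing_add[of s t v2] by (simp add: ab distrib_right)
  then have "a + b = 1" using D_pos by (simp only: mult_cancel_right) simp
  moreover have "0 \<le> a" "0 \<le> b" using assms D_pos by (simp_all add: ab mem_normal_iff e1 zero_le_mult_iff)
  ultimately have "a = 0 \<or> b = 0" by linarith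
  then show ?thesis by (auto simp: ab)
qed

end

context cone_monoid
begin

interpretation sw: cone_monoid v2 v1 e2 e1 D p2 p1 l2 l1 by (rule monoid_swap)

text \<open>
  If \<open>D = 1\<close>, the edge generators \<open>e1\<close> and \<open>e2\<close> freely generate the normalisation. Otherwise \<open>p1\<close> is not
  on the second edge, and the first point \<open>q 1\<close> of height one is irreducible, as are \<open>e1\<close> and \<open>e2\<close>.
\<close>

lemma affine_plane_iff: "affine_plane TYPE('k::field) (axis_monoid v1 v2 e1 e2 1 1) \<longleftrightarrow> D = 1"
proof
  assume D: "D = 1"
  define wt :: "2 \<Rightarrow> lattice" where "wt i = (if i = 0 then e1 else e2)" for i
  have coords: "pairing (weight wt m) v1 = int (Poly_Mapping.lookup m 1)"
    "pairing (weight wt m) v2 = int (Poly_Mapping.lookup m 0)" for m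
    by (simp_all add: weight_two wt_def e1 e2 D)
  have two: "i = 0 \<or> i = 1" for i :: 2
    using UNIV_two by blast
  show "affine_plane TYPE('k) (axis_monoid v1 v2 e1 e2 1 1)"
  proof (rule presentation_iso_affine_plane)
    show "inj (weight wt)"
    proof (intro injI poly_mapping_eqI)
      fix m m' i assume "weight wt m = weight wt m'"
      then have "Poly_Mapping.lookup m 0 = Poly_Mapping.lookup m' 0" "Poly_Mapping.lookup m 1 = Poly_Mapping.lookup m' 1"
        using coords[of m] coords[of m'] by simp_all
      then show "Poly_Mapping.lookup m i = Poly_Mapping.lookup m' i" using two[of i] by auto
    qed
    show "axis_monoid v1 v2 e1 e2 1 1 = range (weight wt)"
    proof (intro set_eqI iffI)
      fix x assume "x \<in> axis_monoid v1 v2 e1 e2 1 1"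
      then have x: "0 \<le> pairing x v1" "0 \<le> pairing x v2" by (simp_all add: mem_normal_iff)
      let ?m = "Poly_Mapping.single 0 (nat (pairing x v2)) + Poly_Mapping.single 1 (nat (pairing x v1)) :: 2 \<Rightarrow>\<^sub>0 nat"
      have "x = weight wt ?m"
        using x by (intro coords_eqI) (simp_all add: coords lookup_add lookup_single "when_def")
      then show "x \<in> range (weight wt)" by blast
    next
      fix x assume "x \<in> range (weight wt)"
      then show "x \<in> axis_monoid v1 v2 e1 e2 1 1" by (auto simp: mem_normal_iff coords)
    qed
  qed
next
  assume plane: "affine_plane TYPE('k) (axis_monoid v1 v2 e1 e2 1 1)"
  show "D = 1"
  proof (rule ccontr)
    assume D: "D \<noteq> 1"
    then have p1neg: "pairing p1 v2 < 0" using D_pos p1(3) p1(1) basis2[of p1] 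
      by (cases "pairing p1 v2 = 0") (auto simp: e2 zmult_eq_1_iff)
    let ?N = "axis_monoid v1 v2 e1 e2 1 1"
    have distinct: "e1 \<noteq> e2" "q 1 \<noteq> e1" "q 1 \<noteq> e2"
      using D D_pos by (auto simp: coords_eq_iff e1 e2 p1)
    have level1: "s = 0" if "s \<in> ?N" "t \<in> ?N" "s + t = q 1" "pairing s v1 = 0" for s t
    proof -
      from that(4) obtain n where n: "s = n \<cdot> e1" using basis1[of s] by auto
      have "0 \<le> n" using that(1) D_pos by (simp add: n mem_normal_iff e1 zero_le_mult_iff)
      have "pairing t v2 = pairing p1 v2 + D - n * D"
        using arg_cong[OF that(3), of "\<lambda>x. pairing x v2"] by (simp add: n e1)
      moreover have "0 \<le> pairing t v2" using that(2) by (simp add: mem_normal_iff)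
      ultimately have "n * D < 1 * D" using p1neg by linarith
      then have "n < 1" using D_pos by simp
      with \<open>0 \<le> n\<close> have "n = 0" by linarith
      with n show ?thesis by simp
    qed
    have interior: "s = 0 \<or> t = 0" if "s \<in> ?N" "t \<in> ?N" "s + t = q 1" for s t
    proof -
      have "pairing s v1 + pairing t v1 = 1"
        using arg_cong[OF that(3), of "\<lambda>x. pairing x v1"] by (simp add: e1 p1)
      then have "pairing s v1 = 0 \<or> pairing t v1 = 0" using that by (auto simp: mem_normal_iff)
      then show ?thesis using level1[OF that] level1[OF that(2,1)] that(3) by (auto simp: add.commute)
    qed
    have "card {e1, e2, q 1} \<le> 2"
    proof (rule affine_plane_irreducibles[OF _ _ plane])
      show "{e1, e2, q 1} \<subseteq> ?N"
        using D_pos q_pos[of 1] by (auto simp: mem_normal_iff e1 e2 p1)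
      show "0 \<notin> {e1, e2, q 1}" using D_pos by (auto simp: coords_eq_iff e1 e2 p1)
      fix h s t assume "h \<in> {e1, e2, q 1}" "s \<in> ?N" "t \<in> ?N" "s + t = h"
      then show "s = 0 \<or> t = 0" using e1_irreducible[of s t] sw.e1_irreducible[of s t] interior[of s t]
        unfolding axis_monoid_swap[of v2 v1 e2 e1 1 1] by blast
    qed (auto simp: mem_normal_iff)
    with distinct show False by simp
  qed
qed

end

section \<open>The theorem\<close>

lemma subgroup_index_perp:
  fixes v e :: lattice
  assumes e: "e \<noteq> 0" and perp: "lattice_points (perp (ray v)) = range (\<lambda>n. n \<cdot> e)"
    and index: "0 < covering_index S v"
  shows "face_group S (ray v) = range (\<lambda>n. (n * int (covering_index S v)) \<cdot> e)"
  using subgroup_of_index[OF e, of "S \<inter> lattice_points (perp (ray v))"] index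
  unfolding covering_index_def face_group_def perp by blast

theorem theorem2:
  fixes S :: "(int \<times> int) set"
    and w :: "'v::finite \<Rightarrow> int \<times> int"
    and w' :: "'x::finite \<Rightarrow> int \<times> int"
    and v1 v2 u :: "int \<times> int"
    and p10 p11 p20 p21 :: "int \<Rightarrow> int \<times> int"
  assumes "generates_monoid w S"
    and "group_closure S = UNIV"
    and "vector_space.dim qscale (sigma_cone S) = 2"
    and "seminormal S"
    and "primitive_ray_generator (sigma_cone S) v1"
    and "primitive_ray_generator (sigma_cone S) v2"
    and "v1 \<noteq> v2"
    and "line_numbering v1 v2 0 p10"
    and "line_numbering v1 v2 1 p11"
    and "line_numbering v2 v1 0 p20"
    and "line_numbering v2 v1 1 p21"
    and "covering_index S v1 \<ge> 3"
    and "covering_index S v2 \<ge> 3"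
    and "generates_monoid w' (normalisation S)"
  shows "T1_dim TYPE('k::field_char_0) S w u =
    enat (local_contribution p10 p11 (covering_index S v1)
            (affine_plane TYPE('k) (normalisation S)) u) +
    enat (local_contribution p20 p21 (covering_index S v2)
            (affine_plane TYPE('k) (normalisation S)) u) +
    T1_dim TYPE('k) (normalisation S) w' u"
proof -
  interpret P: presented_monoid S w
    using assms(1,2) by unfold_locales
  interpret C: seminormal_cone S v1 v2
    using assms(2,4-7) P.zero_mem by unfold_locales (simp_all add: sigma_cone_def)
  interpret C': cone_rays "cone_over S" v2 v1 by (rule C.rays_swap)
  have cop: "coprime (fst v1) (snd v1)" "coprime (fst v2) (snd v2)"
    using assms(5,6) by (simp_all add: primitive_ray_generator_def)
  \<comment> \<open>The edges of the dual cone are orthogonal to the rays; the sign turns both quarter rotations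
    towards the cone.\<close>
  define s where "s = sgn (fst v1 * snd v2 - snd v1 * fst v2)"
  define D where "D = \<bar>fst v1 * snd v2 - snd v1 * fst v2\<bar>"
  define e1 where "e1 = s \<cdot> (- snd v1, fst v1)"
  define e2 where "e2 = (- s) \<cdot> (- snd v2, fst v2)"
  have s: "s * s = 1" "D = s * (fst v1 * snd v2 - snd v1 * fst v2)" and D: "0 < D"
    using C.det by (auto simp: s_def D_def sgn_if)
  have e1: "pairing e1 v1 = 0" "pairing e1 v2 = D"
    by (simp_all add: e1_def s(2) pairing_def algebra_simps)
  have e2: "pairing e2 v2 = 0" "pairing e2 v1 = D"
    by (simp_all add: e2_def s(2) pairing_def algebra_simps)
  have nonzero: "e1 \<noteq> 0" "e2 \<noteq> 0" using e1 e2 D by auto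
  have mult1: "\<exists>n. x = n \<cdot> e1" if "pairing x v1 = 0" for x
  proof -
    from orthogonal_multiples[OF cop(1) that] obtain n where "x = n \<cdot> (- snd v1, fst v1)" by blast
    then have "x = (n * s) \<cdot> e1" using s(1) by (simp add: e1_def prod_eq_iff mult.assoc)
    then show ?thesis by blast
  qed
  have mult2: "\<exists>n. x = n \<cdot> e2" if "pairing x v2 = 0" for x
  proof -
    from orthogonal_multiples[OF cop(2) that] obtain n where "x = n \<cdot> (- snd v2, fst v2)" by blast
    then have "x = (- n * s) \<cdot> e2" using s(1) by (simp add: e2_def prod_eq_iff mult.assoc)
    then show ?thesis by blast
  qed
  have e1p: "0 < pairing e1 v2" and e2p: "0 < pairing e2 v1" using e1 e2 D by simp_all
  have all1: "\<forall>x. pairing x v1 = 0 \<longrightarrow> (\<exists>n. x = n \<cdot> e1)"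
    and all2: "\<forall>x. pairing x v2 = 0 \<longrightarrow> (\<exists>n. x = n \<cdot> e2)" using mult1 mult2 by blast+
  note n10 = line_numbering_shift[OF assms(8) e1(1) e1p all1]
  note n11 = line_numbering_shift[OF assms(9) e1(1) e1p all1]
  note n20 = line_numbering_shift[OF assms(10) e2(1) e2p all2]
  note n21 = line_numbering_shift[OF assms(11) e2(1) e2p all2]
  have zero: "x = 0" if "\<exists>n. x = n \<cdot> e" "- pairing e v < pairing x v" "pairing x v \<le> 0" "pairing e v = D"
    for x v e :: lattice
  proof -
    from that(1) obtain n where n: "x = n \<cdot> e" by blast
    have "- 1 * D < n * D" "n * D \<le> 0 * D" using that(2-4) by (simp_all add: n)
    then have "- 1 < n" "n \<le> 0"
      using mult_less_cancel_right_pos[OF D] mult_le_cancel_right_pos[OF D] by metis+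
    then have "n = 0" by linarith
    then show ?thesis by (simp add: n)
  qed
  have p10_0: "p10 0 = 0" by (rule zero[OF mult1[OF n10(2)] n10(3,4) e1(2)])
  have "p10 n = n \<cdot> e1" for n unfolding n10(1)[of n] p10_0 by simp
  then have p10: "p10 = (\<lambda>n. n \<cdot> e1)" by (rule ext)
  have p20_0: "p20 0 = 0" by (rule zero[OF mult2[OF n20(2)] n20(3,4) e2(2)])
  have "p20 n = n \<cdot> e2" for n unfolding n20(1)[of n] p20_0 by simp
  then have p20: "p20 = (\<lambda>n. n \<cdot> e2)" by (rule ext)
  define p1 where "p1 = p11 0"
  define p2 where "p2 = p21 0"
  have p11: "p11 = (\<lambda>n. p1 + n \<cdot> e1)" unfolding p1_def by (intro ext) (rule n11(1))
  have p21: "p21 = (\<lambda>n. p2 + n \<cdot> e2)" unfolding p2_def by (intro ext) (rule n21(1))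
  have frame: "cone_frame v1 v2 e1 e2 D p1 p2"
  proof
    show "\<exists>n. x = pairing x v1 \<cdot> p1 + n \<cdot> e1" for x
      using mult1[of "x - pairing x v1 \<cdot> p1"] n11(2) by (auto simp: p1_def diff_eq_eq add.commute)
    show "\<exists>n. x = pairing x v2 \<cdot> p2 + n \<cdot> e2" for x
      using mult2[of "x - pairing x v2 \<cdot> p2"] n21(2) by (auto simp: p2_def diff_eq_eq add.commute)
  qed (use D e1 e2 n11(2-4) n21(2-4) in \<open>simp_all add: p1_def p2_def\<close>)
  define l1 where "l1 = int (covering_index S v1)"
  define l2 where "l2 = int (covering_index S v2)"
  interpret X: cone_monoid v1 v2 e1 e2 D p1 p2 l1 l2
    using frame assms(12,13) by (simp add: cone_monoid_def cone_monoid_axioms_def l1_def l2_def)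
  interpret sX: cone_monoid v2 v1 e2 e1 D p2 p1 l2 l1 by (rule X.monoid_swap)
  have perp1: "lattice_points (perp (ray v1)) = range (\<lambda>n. n \<cdot> e1)"
  proof -
    have "{x. pairing x v1 = 0} = range (\<lambda>n. n \<cdot> e1)"
      using mult1 by (intro equalityI subsetI) (blast, auto simp: e1)
    then show ?thesis by (simp only: C.lattice_points_perp)
  qed
  have perp2: "lattice_points (perp (ray v2)) = range (\<lambda>n. n \<cdot> e2)"
  proof -
    have "{x. pairing x v2 = 0} = range (\<lambda>n. n \<cdot> e2)"
      using mult2 by (intro equalityI subsetI) (blast, auto simp: e2)
    then show ?thesis by (simp add: lattice_points_def C'.perp_faces pairing_rat_point)
  qed
  have G1: "face_group S (ray v1) = range (\<lambda>n. (n * l1) \<cdot> e1)"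
    unfolding l1_def using nonzero(1) perp1 by (rule subgroup_index_perp) (use assms(12) in simp)
  have G2: "face_group S (ray v2) = range (\<lambda>n. (n * l2) \<cdot> e2)"
    unfolding l2_def using nonzero(2) perp2 by (rule subgroup_index_perp) (use assms(13) in simp)
  have S: "S = axis_monoid v1 v2 e1 e2 l1 l2"
  proof (rule set_eqI)
    fix x
    note ray1 = X.ray1_iff[of x, folded G1] and ray2 = sX.ray1_iff[of x, folded G2]
    show "x \<in> S \<longleftrightarrow> x \<in> axis_monoid v1 v2 e1 e2 l1 l2"
      using C.mem_iff[of x] ray1 ray2 unfolding axis_monoid_def by blast
  qed
  have N: "normalisation S = axis_monoid v1 v2 e1 e2 1 1"
    unfolding C.normalisation_eq by (rule set_eqI) (simp add: X.mem_normal_iff)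
  have "x \<in> normalisation S" if "x \<in> S" for x
    using X.mem_nonneg[of x] that unfolding C.normalisation_eq by (simp flip: S)
  then have full: "group_closure (normalisation S) = UNIV"
    using group_closure_mono[of S "normalisation S"] assms(2) by blast
  interpret T: seminormal_pair v1 v2 e1 e2 D p1 p2 l1 l2 w w'
  proof (unfold seminormal_pair_def seminormal_pair_axioms_def, intro conjI)
    show "cone_monoid v1 v2 e1 e2 D p1 p2 l1 l2" by (rule X.cone_monoid_axioms)
    show "3 \<le> l1" "3 \<le> l2" using assms(12,13) by (simp_all add: l1_def l2_def)
    show "presented_monoid (axis_monoid v1 v2 e1 e2 l1 l2) w"
      using P.presented_monoid_axioms by (simp flip: S)
    show "presented_monoid (axis_monoid v1 v2 e1 e2 1 1) w'"
      using assms(14) full by (simp add: presented_monoid_def flip: N)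
  qed
  show ?thesis
    using T.T1_dim_formula[of "- u", where 'k = 'k]
    unfolding N X.affine_plane_iff p10 p11 p20 p21
    by (simp add: l1_def[symmetric] l2_def[symmetric] flip: S) (simp add: l1_def l2_def)
qed


end
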